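(* Let $n>2$ and let $M$ be an $n$-dimensional Riemannian submanifold of $\mathbb E^{n+2}_1$ lying on $\mathcal{LC}^n\times\mathbb R$ for which the function $\alpha$ of the context vanishes at no point. Then $M$ is a pseudo-umbilical submanifold of $\mathbb E^{n+2}_1$ if and only if every point $p\in M$ has a neighborhood in $M$ that can be parametrized by $$\phi(s,t)=(\hat\alpha(s)\gamma_1(t),\hat\alpha(s)\gamma_2(t),\dots,\hat\alpha(s)\gamma_{n+1}(t),s),\qquad t=(t_2,\dots,t_n),$$ for some smooth non-vanishing function $\hat\alpha$, where $\gamma=(\gamma_1,\dots,\gamma_{n+1})$ is the position vector of a space-like submanifold $\hat M^{n-1}$ of $\mathbb E^{n+1}_1$ lying on $\mathcal{LC}^n$, such that $\hat M^{n-1}$ is totally umbilical with $\hat M^{n-1}\subset\Sigma(a,\tau)\subset\mathbb E^{n+1}_1$ for some constant vector $0\ne a\in\mathbb E^{n+1}_1$ with $\langle a,a\rangle=c\in\{\pm1,0\}$ and some constant $\tau\in(0,\infty)$, and $\hat\alpha$ satisfies $$(n-2)\tau^2\hat\alpha\,\hat\alpha''-(n-1)\left(c+\tau^2(\hat\alpha')^2\right)=0.$$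
   Context: $\mathbb E^{m}_1$ is $\mathbb R^m$ with the metric $\langle\cdot,\cdot\rangle=-dx_1^2+\sum_{i=2}^m dx_i^2$. The (future) light cone is $\mathcal{LC}^n=\{x\in\mathbb E^{n+1}_1:\langle x,x\rangle=0,\ x_1>0\}$, and $\mathcal{LC}^n\times\mathbb R=\{x\in\mathbb E^{n+2}_1: -x_1^2+x_2^2+\cdots+x_{n+1}^2=0,\ x_1>0\}$. For $0\neq a\in\mathbb E^{n+1}_1$ with $\langle a,a\rangle=c\in\{\pm1,0\}$ and $\tau\in(0,\infty)$, $\Sigma(a,\tau)=\{\gamma\in\mathcal{LC}^n:\langle\gamma,a\rangle=\tau\}$. For a Riemannian (space-like) submanifold, $h$, $A$, $\nabla^\perp$ denote the second fundamental form, shape operator and normal connection, and $H=\frac1n\mathrm{trace}\,h$ is the mean curvature vector field of $M$. A submanifold is umbilical along a normal field $\zeta$ if $\langle A_\zeta X,Y\rangle=f_\zeta\langle X,Y\rangle$ for a smooth function $f_\zeta$; it is totally umbilical if it is umbilical along every normal field, and pseudo-umbilical if it is umbilical along $H$. The function $\alpha$ of $M$: if $\phi=(\phi_1,\dots,\phi_{n+2})$ is the position vector of $M$, then $\theta=(\phi_1,\dots,\phi_{n+1},0)$ is a light-like normal field along $M$, and with $e_1=(\partial_{x_{n+2}})^T$ the tangential part of $\partial_{x_{n+2}}|_M$, $\alpha\in C^\infty(M)$ is defined by $\nabla^\perp_{e_1}\theta=\alpha\theta$, equivalently $\partial_{x_{n+2}}|_M=e_1-\alpha\theta$. *)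

theory Defs
  imports "HOL-Analysis.Analysis"
begin

text \<open>
  Coordinates. The Minkowski space with coordinates $(x_1, x_2, \ldots)$ is the type
  \<open>real \<times> 'e\<close>: the first component is the time coordinate $x_1$ and the Euclidean space
  \<open>'e\<close> carries the remaining ones. With $n$ = \<open>CARD('n)\<close>, the $(n+1)$-dimensional space is
  \<open>real \<times> (real^'n)\<close> and the $(n+2)$-dimensional one is \<open>real \<times> (real^'n) \<times> real\<close>, a point being
  $(x_1, ((x_2,\ldots,x_{n+1}), x_{n+2}))$.
\<close>

definition mink :: "real \<times> 'e::real_inner \<Rightarrow> real \<times> 'e \<Rightarrow> real" where
  "mink x y = - fst x * fst y + snd x \<bullet> snd y"

definition light_cone :: "(real \<times> 'e::real_inner) set" where
  "light_cone = {x. mink x x = 0 \<and> fst x > 0}"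

definition light_cone_times_line :: "(real \<times> 'e::real_inner \<times> real) set" where
  "light_cone_times_line = {(x, y, s). (x, y) \<in> light_cone}"

definition cone_section :: "real \<times> 'e::real_inner \<Rightarrow> real \<Rightarrow> (real \<times> 'e) set" where
  "cone_section a \<tau> = {\<gamma> \<in> light_cone. mink \<gamma> a = \<tau>}"


section \<open>Smooth maps\<close>

text \<open>Intended for open \<open>S\<close> in a finite-dimensional space.\<close>

primrec Ck_on ::
  "nat \<Rightarrow> 'a::real_normed_vector set \<Rightarrow> ('a \<Rightarrow> 'b::real_normed_vector) \<Rightarrow> bool" where
  "Ck_on 0 S f \<longleftrightarrow> continuous_on S f"
| "Ck_on (Suc k) S f \<longleftrightarrow>
     (\<forall>x\<in>S. f differentiable (at x)) \<and> (\<forall>v. Ck_on k S (\<lambda>x. frechet_derivative f (at x) v))"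

definition smooth_on ::
  "'a::real_normed_vector set \<Rightarrow> ('a \<Rightarrow> 'b::real_normed_vector) \<Rightarrow> bool" where
  "smooth_on S f \<longleftrightarrow> (\<forall>k. Ck_on k S f)"


section \<open>Geometry of an immersion of a parameter domain\<close>

text \<open>
  \<open>f\<close> is a space-like immersion of an open set of \<open>'u\<close> into Minkowski space. Tangent vectors at the
  parameter \<open>u\<close> are represented by \<open>X :: 'u\<close>, standing for the ambient vector \<open>df f u X\<close>;
  vector fields along the immersion are functions of the parameter.
\<close>

abbreviation df :: "('u::real_normed_vector \<Rightarrow> 'v::real_normed_vector) \<Rightarrow> 'u \<Rightarrow> 'u \<Rightarrow> 'v" where
  "df f u \<equiv> frechet_derivative f (at u)"

definition induced_metric ::
  "('u::euclidean_space \<Rightarrow> real \<times> 'e::euclidean_space) \<Rightarrow> 'u \<Rightarrow> 'u \<Rightarrow> 'u \<Rightarrow> real" where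
  "induced_metric f u X Y = mink (df f u X) (df f u Y)"

definition normal_vectors ::
  "('u::euclidean_space \<Rightarrow> real \<times> 'e::euclidean_space) \<Rightarrow> 'u \<Rightarrow> (real \<times> 'e) set" where
  "normal_vectors f u = {\<xi>. \<forall>X. mink \<xi> (df f u X) = 0}"

definition tangential_part ::
  "('u::euclidean_space \<Rightarrow> real \<times> 'e::euclidean_space) \<Rightarrow> 'u \<Rightarrow> real \<times> 'e \<Rightarrow> 'u" where
  "tangential_part f u v = (THE X. v - df f u X \<in> normal_vectors f u)"

definition normal_part ::
  "('u::euclidean_space \<Rightarrow> real \<times> 'e::euclidean_space) \<Rightarrow> 'u \<Rightarrow> real \<times> 'e \<Rightarrow> real \<times> 'e" where
  "normal_part f u v = v - df f u (tangential_part f u v)"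

text \<open>
  The normal part in the Gauss formula, the second argument \<open>Y\<close> being extended to the vector field
  with constant components in the given parametrization (the value is tensorial, so any extension
  gives the same).
\<close>

definition second_fundamental_form ::
  "('u::euclidean_space \<Rightarrow> real \<times> 'e::euclidean_space) \<Rightarrow> 'u \<Rightarrow> 'u \<Rightarrow> 'u \<Rightarrow> real \<times> 'e" where
  "second_fundamental_form f u X Y = normal_part f u (df (\<lambda>u'. df f u' Y) u X)"

text \<open>The two parts of the Weingarten formula for a normal field \<open>\<zeta>\<close>.\<close>

definition shape_operator ::
  "('u::euclidean_space \<Rightarrow> real \<times> 'e::euclidean_space) \<Rightarrow> ('u \<Rightarrow> real \<times> 'e) \<Rightarrow> 'u \<Rightarrow> 'u \<Rightarrow> 'u" where
  "shape_operator f \<zeta> u X = - tangential_part f u (df \<zeta> u X)"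

definition normal_connection ::
  "('u::euclidean_space \<Rightarrow> real \<times> 'e::euclidean_space) \<Rightarrow> ('u \<Rightarrow> real \<times> 'e) \<Rightarrow> 'u \<Rightarrow> 'u
     \<Rightarrow> real \<times> 'e" where
  "normal_connection f \<zeta> u X = normal_part f u (df \<zeta> u X)"

definition orthonormal_frame ::
  "('u::euclidean_space \<Rightarrow> real \<times> 'e::euclidean_space) \<Rightarrow> 'u \<Rightarrow> 'u set \<Rightarrow> bool" where
  "orthonormal_frame f u B \<longleftrightarrow> finite B \<and> card B = DIM('u) \<and>
     (\<forall>X\<in>B. \<forall>Y\<in>B. induced_metric f u X Y = (if X = Y then 1 else 0))"

definition metric_trace ::
  "('u::euclidean_space \<Rightarrow> real \<times> 'e::euclidean_space) \<Rightarrow> 'u \<Rightarrow> ('u \<Rightarrow> 'u \<Rightarrow> real \<times> 'e)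
     \<Rightarrow> real \<times> 'e" where
  "metric_trace f u b = (THE t. \<forall>B. orthonormal_frame f u B \<longrightarrow> t = (\<Sum>E\<in>B. b E E))"

definition mean_curvature ::
  "('u::euclidean_space \<Rightarrow> real \<times> 'e::euclidean_space) \<Rightarrow> 'u \<Rightarrow> real \<times> 'e" where
  "mean_curvature f u =
     (1 / real DIM('u)) *\<^sub>R metric_trace f u (second_fundamental_form f u)"


section \<open>Submanifolds\<close>

text \<open>
  A submanifold is a space \<open>M\<close> (with the subspace topology of the surrounding type) with its position
  vector \<open>\<phi>\<close>, an immersion; self-intersections are allowed, and an embedded submanifold \<open>M\<close> has
  \<open>\<phi> = (\<lambda>x. x)\<close>. The smooth structure is the one for which \<open>\<phi>\<close> is an immersion, so the local
  parametrizations below form its maximal atlas and need no separate compatibility condition: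
  the transition maps are smooth because they are continuous and the \<open>\<phi> \<circ> x\<close> are immersions.
  The chart type \<open>'u\<close>, passed as \<open>TYPE('u)\<close>, fixes the dimension \<open>DIM('u)\<close> of \<open>M\<close>.
\<close>

definition local_param ::
  "'p::topological_space set \<Rightarrow> ('p \<Rightarrow> real \<times> 'e::euclidean_space) \<Rightarrow>
     'u::euclidean_space set \<Rightarrow> ('u \<Rightarrow> 'p) \<Rightarrow> bool" where
  "local_param M \<phi> D x \<longleftrightarrow>
     open D \<and> openin (top_of_set M) (x ` D) \<and> (\<exists>y. homeomorphism D (x ` D) x y) \<and>
     smooth_on D (\<phi> \<circ> x) \<and> (\<forall>u\<in>D. inj (df (\<phi> \<circ> x) u))"

definition riemannian_submanifold ::
  "'u::euclidean_space itself \<Rightarrow> 'p::topological_space set \<Rightarrow>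
     ('p \<Rightarrow> real \<times> 'e::euclidean_space) \<Rightarrow> bool" where
  "riemannian_submanifold U M \<phi> \<longleftrightarrow>
     (\<forall>p\<in>M. \<exists>(D :: 'u set) x. local_param M \<phi> D x \<and> p \<in> x ` D) \<and>
     (\<forall>(D :: 'u set) x. local_param M \<phi> D x \<longrightarrow>
        (\<forall>u\<in>D. \<forall>X. X \<noteq> 0 \<longrightarrow> induced_metric (\<phi> \<circ> x) u X X > 0))"

definition normal_field ::
  "'u::euclidean_space itself \<Rightarrow> 'p::topological_space set \<Rightarrow>
     ('p \<Rightarrow> real \<times> 'e::euclidean_space) \<Rightarrow> ('p \<Rightarrow> real \<times> 'e) \<Rightarrow> bool" where
  "normal_field U M \<phi> \<zeta> \<longleftrightarrow>
     (\<forall>(D :: 'u set) x. local_param M \<phi> D x \<longrightarrow>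
        smooth_on D (\<zeta> \<circ> x) \<and> (\<forall>u\<in>D. \<zeta> (x u) \<in> normal_vectors (\<phi> \<circ> x) u))"

definition umbilical_along ::
  "'u::euclidean_space itself \<Rightarrow> 'p::topological_space set \<Rightarrow>
     ('p \<Rightarrow> real \<times> 'e::euclidean_space) \<Rightarrow> ('p \<Rightarrow> real \<times> 'e) \<Rightarrow> bool" where
  "umbilical_along U M \<phi> \<zeta> \<longleftrightarrow>
     (\<exists>f :: 'p \<Rightarrow> real. \<forall>(D :: 'u set) x. local_param M \<phi> D x \<longrightarrow>
        smooth_on D (f \<circ> x) \<and>
        (\<forall>u\<in>D. \<forall>X Y. induced_metric (\<phi> \<circ> x) u (shape_operator (\<phi> \<circ> x) (\<zeta> \<circ> x) u X) Y =
                     f (x u) * induced_metric (\<phi> \<circ> x) u X Y))"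

definition totally_umbilical ::
  "'u::euclidean_space itself \<Rightarrow> 'p::topological_space set \<Rightarrow>
     ('p \<Rightarrow> real \<times> 'e::euclidean_space) \<Rightarrow> bool" where
  "totally_umbilical U M \<phi> \<longleftrightarrow> (\<forall>\<zeta>. normal_field U M \<phi> \<zeta> \<longrightarrow> umbilical_along U M \<phi> \<zeta>)"

definition mean_curvature_field ::
  "'u::euclidean_space itself \<Rightarrow> 'p::topological_space set \<Rightarrow>
     ('p \<Rightarrow> real \<times> 'e::euclidean_space) \<Rightarrow> 'p \<Rightarrow> real \<times> 'e" where
  "mean_curvature_field U M \<phi> p =
     (THE H. \<forall>(D :: 'u set) x. \<forall>u\<in>D. local_param M \<phi> D x \<and> x u = p \<longrightarrow>
        H = mean_curvature (\<phi> \<circ> x) u)"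

definition pseudo_umbilical ::
  "'u::euclidean_space itself \<Rightarrow> 'p::topological_space set \<Rightarrow>
     ('p \<Rightarrow> real \<times> 'e::euclidean_space) \<Rightarrow> bool" where
  "pseudo_umbilical U M \<phi> \<longleftrightarrow> umbilical_along U M \<phi> (mean_curvature_field U M \<phi>)"


section \<open>Submanifolds of the light cone times a line\<close>

definition theta ::
  "('p \<Rightarrow> real \<times> 'e::euclidean_space \<times> real) \<Rightarrow> 'p \<Rightarrow> real \<times> 'e \<times> real" where
  "theta \<phi> p = (fst (\<phi> p), fst (snd (\<phi> p)), 0)"

text \<open>The tangential part of the last coordinate vector field $\partial_{x_{n+2}}$.\<close>

definition e1 ::
  "('u::euclidean_space \<Rightarrow> real \<times> 'e::euclidean_space \<times> real) \<Rightarrow> 'u \<Rightarrow> 'u" where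
  "e1 f u = tangential_part f u (0, 0, 1)"

definition alpha ::
  "'u::euclidean_space itself \<Rightarrow> 'p::topological_space set \<Rightarrow>
     ('p \<Rightarrow> real \<times> 'e::euclidean_space \<times> real) \<Rightarrow> 'p \<Rightarrow> real" where
  "alpha U M \<phi> p =
     (THE a. \<forall>(D :: 'u set) x. \<forall>u\<in>D. local_param M \<phi> D x \<and> x u = p \<longrightarrow>
        normal_connection (\<phi> \<circ> x) (theta \<phi> \<circ> x) u (e1 (\<phi> \<circ> x) u) = a *\<^sub>R theta \<phi> p)"

end

theory Submission
  imports Defs
begin


text \<open>
  Write \<open>n\<close> for the dimension of \<open>M\<close>. The tangent hyperplanes of the light cone times the line are
  degenerate along the rays of the cone, so a space-like hypersurface \<open>M\<close> of it is transversal to the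
  rays and hence, locally, a graph. Any section of the cone that meets the rays once can serve as the
  domain; the section by the null hyperplane \<open>\<langle>y,\<nu>\<rangle> = -1\<close> (a horosphere of hyperbolic space) is flat,
  has a polynomial isometric parametrization \<open>hor\<close>, and turns \<open>M\<close> into
  \<open>(s,t) \<mapsto> (R(s,t) hor(t), s)\<close> with the metric \<open>ds\<^sup>2 + R\<^sup>2 |dt|\<^sup>2\<close>.

  The normal plane of \<open>M\<close> is Lorentzian, spanned by the null normal \<open>\<theta>\<close> and a second null normal \<open>\<eta>\<close>
  with \<open>\<langle>\<theta>,\<eta>\<rangle> = -1\<close>. The shape operator of \<open>\<theta>\<close> is always minus the projection onto the complement of
  \<open>e\<^sub>1\<close>, whence \<open>n H = (n-1) \<eta> - tr(A\<^sub>\<eta>) \<theta>\<close>. Being umbilical along \<open>H\<close> therefore says that \<open>A\<^sub>\<eta>\<close> has the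
  eigenvalue \<open>b\<close> on \<open>e\<^sub>1\<close> and \<open>k\<close> on its complement, with \<open>(n-2) b = 2 (n-1) k\<close>
  (\<open>pseudo_umbilical_at_cone_line\<close>). In both directions of the theorem only this criterion is used.

  For a graph, the vanishing of the mixed entries reads \<open>R R\<^sub>s\<^sub>t = R\<^sub>s R\<^sub>t\<close>; it separates the variables,
  \<open>R = \<alpha>(s) \<rho>(t)\<close>, and produces the factor \<open>\<gamma> = \<rho> hor\<close>. The entry along \<open>e\<^sub>1\<close> is \<open>b = -\<alpha>''/\<alpha>\<close>, so \<open>b\<close>,
  and with it \<open>k\<close>, depends on \<open>s\<close> only. The remaining entries then say that the Hessian of \<open>1/\<rho>\<close> is a
  multiple of the identity in the precise way that makes the sum of \<open>\<kappa> \<gamma>\<close> and the null normal of \<open>\<gamma>\<close> that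
  has the product \<open>-1\<close> with \<open>\<gamma>\<close> a constant vector (\<open>horosphere_graph_in_hyperplane\<close>), where \<open>\<kappa> = \<alpha>\<^sup>2 k + (\<alpha>')\<^sup>2/2\<close> is a constant. This vector has
  the square \<open>-2\<kappa>\<close> and the product \<open>-1\<close> with \<open>\<gamma>\<close>; up to a scalar it is the vector \<open>a\<close>, and
  \<open>(n-2) b = 2 (n-1) k\<close> becomes the differential equation for \<open>\<alpha>\<close>. Conversely, on a product of the
  given form \<open>\<eta>\<close> can be written down in terms of \<open>a\<close>, and the same computation verifies the criterion.
  The factor \<open>\<gamma>\<close> is totally umbilical because its normal plane is spanned by the position vector, along
  which every submanifold is umbilical, and by the constant \<open>a\<close>, whose shape operator vanishes.

  The mean curvature field and pseudo-umbilicity refer to all charts at once, so charts have to be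
  compared. The coordinates \<open>(s,t)\<close> are smooth functions on an open part of the ambient space, hence
  the transition map from an arbitrary chart to a graph chart is given by a formula and is smooth;
  the inverse function theorem enters only to show that graph charts exist.
\<close>


section \<open>Smooth maps\<close>

lemma Ck_on_cong:
  assumes "open S" "\<And>x. x \<in> S \<Longrightarrow> f x = g x"
  shows "Ck_on k S f \<Longrightarrow> Ck_on k S g"
  using assms(2)
proof (induction k arbitrary: f g)
  case 0
  then show ?case
    by (metis Ck_on.simps(1) continuous_on_cong)
next
  case (Suc k)
  have D: "frechet_derivative f (at x) = frechet_derivative g (at x)" if "x \<in> S" for x
    using frechet_derivative_transform_within_open[of f x S g] Suc.prems \<open>open S\<close> that by auto
  have "g differentiable (at x)" if "x \<in> S" for x
    using Suc.prems that assms(1)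
    by (metis Ck_on.simps(2) differentiable_def has_derivative_transform_within_open)
  moreover have "Ck_on k S (\<lambda>x. frechet_derivative g (at x) v)" for v
    using Suc.IH[of "\<lambda>x. frechet_derivative f (at x) v"] D Suc.prems(1) by auto
  ultimately show ?case by auto
qed

lemma Ck_on_subset: "Ck_on k S f \<Longrightarrow> T \<subseteq> S \<Longrightarrow> Ck_on k T f"
  by (induction k arbitrary: f) (auto intro: continuous_on_subset)

lemma Ck_on_SucD: "Ck_on (Suc k) S f \<Longrightarrow> Ck_on k S f"
proof (induction k arbitrary: f)
  case 0
  then show ?case
    by (auto intro!: continuous_at_imp_continuous_on differentiable_imp_continuous_within)
next
  case (Suc k)
  then show ?case by (metis Ck_on.simps(2))
qed

lemma Ck_on_local:
  assumes "\<And>x. x \<in> S \<Longrightarrow> \<exists>N. open N \<and> x \<in> N \<and> Ck_on k N f"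
  shows "Ck_on k S f"
  using assms
proof (induction k arbitrary: f)
  case 0
  have "isCont f x" if x: "x \<in> S" for x
  proof -
    obtain N where "open N" "x \<in> N" "continuous_on N f"
      using 0[OF x] by auto
    then show ?thesis
      by (simp add: continuous_on_eq_continuous_at)
  qed
  then show ?case
    by (simp add: continuous_at_imp_continuous_on)
next
  case (Suc k)
  have "f differentiable (at x)" if "x \<in> S" for x
    using Suc.prems[OF that] by auto
  moreover have "Ck_on k S (\<lambda>x. frechet_derivative f (at x) v)" for v
    using Suc.prems by (intro Suc.IH) fastforce
  ultimately show ?case by auto
qed

text \<open>The form in which the induction steps below are done: any formula for the derivative may be used
  in place of the Frechet derivative.\<close>

lemma Ck_on_SucI:
  assumes "open S"
    and "\<And>x. x \<in> S \<Longrightarrow> (f has_derivative f' x) (at x)"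
    and "\<And>v. Ck_on k S (\<lambda>x. f' x v)"
  shows "Ck_on (Suc k) S f"
proof -
  have "frechet_derivative f (at x) = f' x" if "x \<in> S" for x
    using assms(2) that frechet_derivative_at by metis
  then show ?thesis
    using assms Ck_on_cong[OF \<open>open S\<close>, of "\<lambda>x. f' x v" "\<lambda>x. frechet_derivative f (at x) v" k for v]
    by (auto simp: differentiable_def)
qed

lemma Ck_on_has_derivative:
  "Ck_on (Suc k) S f \<Longrightarrow> x \<in> S \<Longrightarrow> (f has_derivative frechet_derivative f (at x)) (at x)"
  by (simp add: frechet_derivative_works)

lemma Ck_on_const [simp]: "Ck_on k S (\<lambda>x. c)"
  by (induction k arbitrary: c) auto

lemma Ck_on_linear:
  assumes "bounded_linear L"
  shows "Ck_on k S L"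
proof (cases k)
  case 0
  then show ?thesis using assms by (auto intro: linear_continuous_on)
next
  case (Suc k)
  have "frechet_derivative L (at x) = L" for x
    using assms bounded_linear_imp_has_derivative frechet_derivative_at by metis
  with Suc show ?thesis
    using assms by (auto intro: bounded_linear_imp_differentiable)
qed

lemma Ck_on_add:
  assumes "open S"
  shows "Ck_on k S f \<Longrightarrow> Ck_on k S g \<Longrightarrow> Ck_on k S (\<lambda>x. f x + g x)"
proof (induction k arbitrary: f g)
  case 0 then show ?case by (auto intro: continuous_intros)
next
  case (Suc k)
  show ?case
    by (rule Ck_on_SucI[OF assms has_derivative_add])
       (use Suc in \<open>auto intro: Ck_on_has_derivative\<close>)
qed

lemma Ck_on_bilinear:
  assumes "open S" "bounded_bilinear bop"
  shows "Ck_on k S f \<Longrightarrow> Ck_on k S g \<Longrightarrow> Ck_on k S (\<lambda>x. bop (f x) (g x))"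
proof (induction k arbitrary: f g)
  case 0 then show ?case
    using assms(2) by (auto intro: bounded_bilinear.continuous_on)
next
  case (Suc k)
  show ?case
    by (rule Ck_on_SucI[OF assms(1) bounded_bilinear.FDERIV[OF assms(2)]])
       (use Suc in \<open>auto intro!: Ck_on_add assms Suc.IH dest: Ck_on_SucD intro: Ck_on_has_derivative Ck_on_SucD\<close>)
qed

lemma Ck_on_linear_compose:
  assumes "open S" "bounded_linear L"
  shows "Ck_on k S f \<Longrightarrow> Ck_on k S (\<lambda>x. L (f x))"
proof (induction k arbitrary: f)
  case 0 then show ?case
    using assms(2) by (auto intro: bounded_linear.continuous_on)
next
  case (Suc k)
  show ?case
    by (rule Ck_on_SucI[OF assms(1) bounded_linear.has_derivative[OF assms(2)]])
       (use Suc in \<open>auto intro: Ck_on_has_derivative\<close>)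
qed

lemma Ck_on_sum:
  assumes "open S" "\<And>i. i \<in> A \<Longrightarrow> Ck_on k S (f i)"
  shows "Ck_on k S (\<lambda>x. \<Sum>i\<in>A. f i x)"
  using assms(2)
  by (induction A rule: infinite_finite_induct) (auto intro: Ck_on_add assms(1))

lemma Ck_on_inverse:
  fixes f :: "'a::real_normed_vector \<Rightarrow> real"
  assumes "open S" "\<And>x. x \<in> S \<Longrightarrow> f x \<noteq> 0"
  shows "Ck_on k S f \<Longrightarrow> Ck_on k S (\<lambda>x. inverse (f x))"
proof (induction k)
  case 0 then show ?case
    using assms(2) by (auto intro: continuous_intros)
next
  case (Suc k)
  have "((\<lambda>x. inverse (f x)) has_derivative
      (\<lambda>v. - (inverse (f x) * frechet_derivative f (at x) v * inverse (f x)))) (at x)" if "x \<in> S" for x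
    by (rule Deriv.has_derivative_inverse[OF assms(2)[OF that] Ck_on_has_derivative[OF Suc.prems that]])
  moreover have "Ck_on k S (\<lambda>x. - (inverse (f x) * frechet_derivative f (at x) v * inverse (f x)))" for v
    using Suc.IH[OF Ck_on_SucD[OF Suc.prems]] Suc.prems
    by (intro Ck_on_linear_compose[OF \<open>open S\<close> bounded_linear_minus[OF bounded_linear_ident]]
         Ck_on_bilinear[OF \<open>open S\<close> bounded_bilinear_mult])
       auto
  ultimately show ?case by (intro Ck_on_SucI[OF \<open>open S\<close>])
qed

text \<open>The chain rule has to be expanded in a basis, because only the directional derivatives
  of \<open>f\<close> are known to be of class \<open>C\<^sup>k\<close>.\<close>

lemma Ck_on_compose:
  fixes g :: "'a::real_normed_vector \<Rightarrow> 'b::euclidean_space"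
  assumes "open S" "open T" "g ` S \<subseteq> T"
  shows "Ck_on k S g \<Longrightarrow> Ck_on k T f \<Longrightarrow> Ck_on k S (\<lambda>x. f (g x))"
proof (induction k arbitrary: f)
  case 0 then show ?case
    using assms(3) by (auto intro: continuous_on_compose2)
next
  case (Suc k)
  let ?D = "\<lambda>x v. \<Sum>b\<in>Basis. (frechet_derivative g (at x) v \<bullet> b) *\<^sub>R frechet_derivative f (at (g x)) b"
  have "((\<lambda>x. f (g x)) has_derivative ?D x) (at x)" if "x \<in> S" for x
  proof -
    have gx: "g x \<in> T" using that assms(3) by auto
    have 1: "((\<lambda>x. f (g x)) has_derivative (\<lambda>v. frechet_derivative f (at (g x)) (frechet_derivative g (at x) v))) (at x)"
      using diff_chain_at[OF Ck_on_has_derivative[OF Suc.prems(1) that] Ck_on_has_derivative[OF Suc.prems(2) gx]]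
      by (simp add: o_def)
    have 2: "frechet_derivative f (at (g x)) w = (\<Sum>b\<in>Basis. (w \<bullet> b) *\<^sub>R frechet_derivative f (at (g x)) b)" for w
    proof -
      have lin: "linear (frechet_derivative f (at (g x)))"
        using Ck_on_has_derivative[OF Suc.prems(2) gx] by (rule has_derivative_linear)
      show ?thesis
        using linear_sum[OF lin, of "\<lambda>b. (w \<bullet> b) *\<^sub>R b" Basis]
        by (simp only: euclidean_representation linear_scale[OF lin])
    qed
    show ?thesis using 1 unfolding 2[symmetric] .
  qed
  moreover have "Ck_on k S (\<lambda>x. ?D x v)" for v
    using Suc.prems Ck_on_SucD[OF Suc.prems(1)]
    by (intro Ck_on_sum Ck_on_bilinear[OF assms(1) bounded_bilinear_scaleR] assms
         Ck_on_linear_compose[OF assms(1) bounded_linear_inner_left]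
         Suc.IH[of "\<lambda>y. frechet_derivative f (at y) b" for b]) auto
  ultimately show ?case by (intro Ck_on_SucI[OF \<open>open S\<close>])
qed

lemma Ck_on_Pair:
  assumes "open S"
  shows "Ck_on k S f \<Longrightarrow> Ck_on k S g \<Longrightarrow> Ck_on k S (\<lambda>x. (f x, g x))"
proof (induction k arbitrary: f g)
  case 0 then show ?case by (auto intro: continuous_intros)
next
  case (Suc k)
  show ?case
    by (rule Ck_on_SucI[OF assms has_derivative_Pair])
       (use Suc in \<open>auto intro: Ck_on_has_derivative\<close>)
qed

lemma smooth_on_cong:
  "open S \<Longrightarrow> (\<And>x. x \<in> S \<Longrightarrow> f x = g x) \<Longrightarrow> smooth_on S f \<Longrightarrow> smooth_on S g"
  unfolding smooth_on_def using Ck_on_cong by blast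

lemma smooth_on_subset: "smooth_on S f \<Longrightarrow> T \<subseteq> S \<Longrightarrow> smooth_on T f"
  unfolding smooth_on_def using Ck_on_subset by blast

lemma smooth_on_local:
  "(\<And>x. x \<in> S \<Longrightarrow> \<exists>N. open N \<and> x \<in> N \<and> smooth_on N f) \<Longrightarrow> smooth_on S f"
  unfolding smooth_on_def by (meson Ck_on_local)

lemma smooth_on_has_derivative:
  "smooth_on S f \<Longrightarrow> x \<in> S \<Longrightarrow> (f has_derivative frechet_derivative f (at x)) (at x)"
  unfolding smooth_on_def using Ck_on_has_derivative by blast

lemma smooth_on_continuous: "smooth_on S f \<Longrightarrow> continuous_on S f"
  unfolding smooth_on_def by (meson Ck_on.simps(1))

lemma smooth_on_df_linear: "smooth_on S f \<Longrightarrow> x \<in> S \<Longrightarrow> linear (df f x)"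
  using smooth_on_has_derivative has_derivative_linear by blast

named_theorems smooth_intros

lemma smooth_on_df [smooth_intros]: "smooth_on S f \<Longrightarrow> smooth_on S (\<lambda>x. frechet_derivative f (at x) v)"
  unfolding smooth_on_def using Ck_on.simps(2) by blast

lemma smooth_on_const [smooth_intros]: "smooth_on S (\<lambda>x. c)"
  by (simp add: smooth_on_def)

lemma smooth_on_linear: "bounded_linear L \<Longrightarrow> smooth_on S L"
  by (simp add: smooth_on_def Ck_on_linear)

lemma smooth_on_ident [smooth_intros]: "smooth_on S (\<lambda>x. x)"
  by (simp add: smooth_on_linear)

lemma smooth_on_linear_compose:
  "bounded_linear L \<Longrightarrow> open S \<Longrightarrow> smooth_on S f \<Longrightarrow> smooth_on S (\<lambda>x. L (f x))"
  by (simp add: smooth_on_def Ck_on_linear_compose)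

lemmas smooth_on_fst [smooth_intros] = smooth_on_linear_compose[OF bounded_linear_fst]
lemmas smooth_on_snd [smooth_intros] = smooth_on_linear_compose[OF bounded_linear_snd]
lemmas smooth_on_minus [smooth_intros] =
  smooth_on_linear_compose[OF bounded_linear_minus[OF bounded_linear_ident]]

lemma smooth_on_add [smooth_intros]:
  "open S \<Longrightarrow> smooth_on S f \<Longrightarrow> smooth_on S g \<Longrightarrow> smooth_on S (\<lambda>x. f x + g x)"
  by (simp add: smooth_on_def Ck_on_add)

lemma smooth_on_diff [smooth_intros]:
  "open S \<Longrightarrow> smooth_on S f \<Longrightarrow> smooth_on S g \<Longrightarrow> smooth_on S (\<lambda>x. f x - g x)"
  using smooth_on_add[of S f "\<lambda>x. - g x"] smooth_on_minus by auto

lemma smooth_on_bilinear: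
  "bounded_bilinear bop \<Longrightarrow> open S \<Longrightarrow> smooth_on S f \<Longrightarrow> smooth_on S g \<Longrightarrow>
    smooth_on S (\<lambda>x. bop (f x) (g x))"
  by (simp add: smooth_on_def Ck_on_bilinear)

lemmas smooth_on_scaleR [smooth_intros] = smooth_on_bilinear[OF bounded_bilinear_scaleR]
lemmas smooth_on_mult [smooth_intros] = smooth_on_bilinear[OF bounded_bilinear_mult]
lemmas smooth_on_inner [smooth_intros] = smooth_on_bilinear[OF bounded_bilinear_inner]

lemma smooth_on_power [smooth_intros]:
  fixes f :: "'a::real_normed_vector \<Rightarrow> real"
  shows "open S \<Longrightarrow> smooth_on S f \<Longrightarrow> smooth_on S (\<lambda>x. f x ^ k)"
  by (induction k) (auto intro: smooth_intros)

lemma smooth_on_sum [smooth_intros]: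
  "open S \<Longrightarrow> (\<And>i. i \<in> A \<Longrightarrow> smooth_on S (f i)) \<Longrightarrow> smooth_on S (\<lambda>x. \<Sum>i\<in>A. f i x)"
  by (simp add: smooth_on_def Ck_on_sum)

lemma smooth_on_divide [smooth_intros]:
  fixes f g :: "'a::real_normed_vector \<Rightarrow> real"
  shows "open S \<Longrightarrow> smooth_on S f \<Longrightarrow> smooth_on S g \<Longrightarrow> (\<And>x. x \<in> S \<Longrightarrow> g x \<noteq> 0) \<Longrightarrow>
    smooth_on S (\<lambda>x. f x / g x)"
  unfolding divide_inverse
  by (intro smooth_on_mult) (auto simp: smooth_on_def Ck_on_inverse)

lemma smooth_on_Pair [smooth_intros]:
  "open S \<Longrightarrow> smooth_on S f \<Longrightarrow> smooth_on S g \<Longrightarrow> smooth_on S (\<lambda>x. (f x, g x))"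
  by (simp add: smooth_on_def Ck_on_Pair)

lemma smooth_on_compose:
  fixes g :: "'a::real_normed_vector \<Rightarrow> 'b::euclidean_space"
  shows "open S \<Longrightarrow> open T \<Longrightarrow> g ` S \<subseteq> T \<Longrightarrow> smooth_on S g \<Longrightarrow> smooth_on T f \<Longrightarrow>
    smooth_on S (\<lambda>x. f (g x))"
  by (auto simp: smooth_on_def intro: Ck_on_compose)

lemma smooth_on_mink [smooth_intros]:
  fixes f g :: "'a::real_normed_vector \<Rightarrow> real \<times> 'e::real_inner"
  shows "open S \<Longrightarrow> smooth_on S f \<Longrightarrow> smooth_on S g \<Longrightarrow> smooth_on S (\<lambda>x. mink (f x) (g x))"
  unfolding mink_def by (intro smooth_intros)

section \<open>Inverse functions\<close>

text \<open>A product rule for a factor \<open>p\<close> that is only continuous: where \<open>g\<close> vanishes, the increment of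
  \<open>p\<close> is multiplied by a quantity of first order. It is needed because the inverse of an operator has
  to be differentiated before it is known to be differentiable.\<close>

lemma has_derivative_scaleR_zero:
  fixes p :: "'a::real_normed_vector \<Rightarrow> real" and g :: "'a \<Rightarrow> 'b::real_normed_vector"
  assumes p: "isCont p x" and g: "(g has_derivative g') (at x)" and 0: "g x = 0"
  shows "((\<lambda>y. p y *\<^sub>R g y) has_derivative (\<lambda>h. p x *\<^sub>R g' h)) (at x)"
proof -
  interpret bl: bounded_linear g' using g by (rule has_derivative_bounded_linear)
  obtain K where K: "\<And>h. norm (g' h) \<le> norm h * K" using bl.bounded by blast
  let ?r = "\<lambda>y. norm (g y - g x - g' (y - x)) / norm (y - x)"
  have r: "(?r \<longlongrightarrow> 0) (at x)"
    using g by (simp add: has_derivative_iff_norm)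
  have px: "(p \<longlongrightarrow> p x) (at x)" using p by (simp add: isCont_def)
  have "((\<lambda>y. \<bar>p y\<bar> * ?r y + \<bar>p y - p x\<bar> * K) \<longlongrightarrow> \<bar>p x\<bar> * 0 + \<bar>p x - p x\<bar> * K) (at x)"
    by (intro tendsto_intros px r)
  then have lim: "((\<lambda>y. \<bar>p y\<bar> * ?r y + \<bar>p y - p x\<bar> * K) \<longlongrightarrow> 0) (at x)" by simp
  have bound: "norm (p y *\<^sub>R g y - p x *\<^sub>R g x - p x *\<^sub>R g' (y - x)) / norm (y - x)
      \<le> \<bar>p y\<bar> * ?r y + \<bar>p y - p x\<bar> * K" if "y \<noteq> x" for y
  proof -
    have "p y *\<^sub>R g y - p x *\<^sub>R g x - p x *\<^sub>R g' (y - x)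
        = p y *\<^sub>R (g y - g x - g' (y - x)) + (p y - p x) *\<^sub>R g' (y - x)"
      using 0 by (simp add: algebra_simps)
    then have "norm (p y *\<^sub>R g y - p x *\<^sub>R g x - p x *\<^sub>R g' (y - x))
        \<le> \<bar>p y\<bar> * norm (g y - g x - g' (y - x)) + \<bar>p y - p x\<bar> * norm (g' (y - x))"
      by (metis norm_scaleR norm_triangle_ineq)
    also have "\<dots> \<le> \<bar>p y\<bar> * norm (g y - g x - g' (y - x)) + \<bar>p y - p x\<bar> * (norm (y - x) * K)"
      by (intro add_left_mono mult_left_mono K) auto
    finally show ?thesis using that by (simp add: field_simps)
  qed
  have "((\<lambda>y. norm (p y *\<^sub>R g y - p x *\<^sub>R g x - p x *\<^sub>R g' (y - x)) / norm (y - x)) \<longlongrightarrow> 0) (at x)"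
    by (rule Lim_null_comparison[OF _ lim])
       (use bound in \<open>auto simp: eventually_at_filter\<close>)
  moreover have "bounded_linear (\<lambda>h. p x *\<^sub>R g' h)"
    by (intro bounded_linear_const_scaleR bl.bounded_linear_axioms)
  ultimately show ?thesis by (simp add: has_derivative_iff_norm)
qed

lemma linear_basis_expansion:
  fixes L :: "'b::euclidean_space \<Rightarrow> 'c::real_vector"
  assumes "linear L"
  shows "L v = (\<Sum>b\<in>Basis. (v \<bullet> b) *\<^sub>R L b)"
  using linear_sum[OF assms, of "\<lambda>b. (v \<bullet> b) *\<^sub>R b" Basis]
  by (simp only: euclidean_representation linear_scale[OF assms])

text \<open>The resolvent identity \<open>W\<^sub>y z = W\<^sub>0 z - W\<^sub>0 (A\<^sub>y - A\<^sub>0) W\<^sub>y z\<close> gives first the boundedness,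
  then the continuity, of the inverse \<open>W\<close>.\<close>

lemma isCont_inverse_operator:
  fixes A W :: "'a::real_normed_vector \<Rightarrow> 'b::euclidean_space \<Rightarrow> 'b"
  assumes "open S" and y0: "y0 \<in> S"
    and linA: "\<And>y. y \<in> S \<Longrightarrow> linear (A y)" and linW: "\<And>y. y \<in> S \<Longrightarrow> linear (W y)"
    and inv: "\<And>y z. y \<in> S \<Longrightarrow> W y (A y z) = z" "\<And>y z. y \<in> S \<Longrightarrow> A y (W y z) = z"
    and cont: "\<And>b. isCont (\<lambda>y. A y b) y0"
  shows "isCont (\<lambda>y. W y z) y0"
proof -
  obtain K where K: "K > 0" "\<And>v. norm (W y0 v) \<le> K * norm v"
    using linear_bounded_pos[OF linW[OF y0]] by blast
  let ?e = "\<lambda>y. \<Sum>b\<in>Basis. norm (A y b - A y0 b)"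
  have e0: "?e y0 = 0" by simp
  have e: "(?e \<longlongrightarrow> 0) (at y0)"
    using cont unfolding isCont_def
    by (intro tendsto_null_sum tendsto_norm_zero) (simp add: LIM_zero)
  have E: "norm (A y v - A y0 v) \<le> ?e y * norm v" if "y \<in> S" for y v
  proof -
    have "A y v - A y0 v = (\<Sum>b\<in>Basis. (v \<bullet> b) *\<^sub>R (A y b - A y0 b))"
      unfolding linear_basis_expansion[OF linA[OF that], of v] linear_basis_expansion[OF linA[OF y0], of v]
      by (simp add: sum_subtractf scaleR_diff_right)
    also have "norm \<dots> \<le> (\<Sum>b\<in>Basis. norm v * norm (A y b - A y0 b))"
      by (intro sum_norm_le) (auto intro: mult_right_mono Basis_le_norm)
    finally show ?thesis by (simp add: sum_distrib_left mult.commute)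
  qed
  have res: "W y z - W y0 z = - W y0 (A y (W y z) - A y0 (W y z))" if "y \<in> S" for y
    using that y0 by (simp add: inv linear_diff[OF linW[OF y0]])
  have d: "norm (W y z - W y0 z) \<le> K * ?e y * norm (W y z)" if "y \<in> S" for y
  proof -
    have "norm (W y z - W y0 z) \<le> K * norm (A y (W y z) - A y0 (W y z))"
      unfolding res[OF that] using K(2) by simp
    also have "\<dots> \<le> K * (?e y * norm (W y z))"
      using E[OF that] K(1) by (intro mult_left_mono) auto
    finally show ?thesis by (simp add: mult.assoc)
  qed
  have evS: "\<forall>\<^sub>F y in at y0. y \<in> S"
    using \<open>open S\<close> y0 by (simp add: eventually_at_in_open')
  have "((\<lambda>y. K * ?e y) \<longlongrightarrow> K * 0) (at y0)" by (intro tendsto_intros e)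
  then have "\<forall>\<^sub>F y in at y0. K * ?e y < 1/2"
    by (rule order_tendstoD(2)) simp
  with evS have ev: "\<forall>\<^sub>F y in at y0. norm (W y z - W y0 z) \<le> K * ?e y * (2 * norm (W y0 z))"
  proof eventually_elim
    case (elim y)
    have "norm (W y z) \<le> norm (W y0 z) + norm (W y z - W y0 z)"
      by (metis norm_triangle_sub)
    also have "\<dots> \<le> norm (W y0 z) + K * ?e y * norm (W y z)" using d[OF elim(1)] by simp
    also have "\<dots> \<le> norm (W y0 z) + 1/2 * norm (W y z)"
      using elim(2) by (intro add_left_mono mult_right_mono) auto
    finally have "norm (W y z) \<le> 2 * norm (W y0 z)" by simp
    then have "K * ?e y * norm (W y z) \<le> K * ?e y * (2 * norm (W y0 z))"
      using K(1) by (intro mult_left_mono mult_nonneg_nonneg sum_nonneg) auto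
    with d[OF elim(1)] show ?case by linarith
  qed
  have "((\<lambda>y. K * ?e y * (2 * norm (W y0 z))) \<longlongrightarrow> K * 0 * (2 * norm (W y0 z))) (at y0)"
    by (intro tendsto_intros e)
  then have "((\<lambda>y. W y z - W y0 z) \<longlongrightarrow> 0) (at y0)"
    using Lim_null_comparison[OF ev] by simp
  then show ?thesis by (simp add: isCont_def LIM_zero_iff)
qed

text \<open>The resolvent identity also shows that \<open>dW = - W (dA) W\<close>, an expression in \<open>W\<close> itself and one
  derivative of \<open>A\<close>; so \<open>W\<close> gains one order of differentiability at each step of the induction.\<close>

lemma Ck_on_inverse_operator:
  fixes A W :: "'a::real_normed_vector \<Rightarrow> 'b::euclidean_space \<Rightarrow> 'b"
  assumes "open S"
    and linA: "\<And>y. y \<in> S \<Longrightarrow> linear (A y)" and linW: "\<And>y. y \<in> S \<Longrightarrow> linear (W y)"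
    and inv: "\<And>y z. y \<in> S \<Longrightarrow> W y (A y z) = z" "\<And>y z. y \<in> S \<Longrightarrow> A y (W y z) = z"
  shows "(\<And>b. Ck_on k S (\<lambda>y. A y b)) \<Longrightarrow> Ck_on k S (\<lambda>y. W y z)"
proof (induction k arbitrary: z)
  case 0
  have "isCont (\<lambda>y. W y z) y" if y: "y \<in> S" for y
    using 0 by (intro isCont_inverse_operator[OF \<open>open S\<close> y linA linW inv])
      (auto simp: continuous_on_eq_continuous_at[OF \<open>open S\<close>] y)
  then show ?case by (simp add: continuous_at_imp_continuous_on)
next
  case (Suc k)
  have AC: "Ck_on k S (\<lambda>y. A y b)" for b using Suc.prems Ck_on_SucD by blast
  have WC: "Ck_on k S (\<lambda>y. W y z)" for z using Suc.IH AC by blast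
  let ?dA = "\<lambda>y b. frechet_derivative (\<lambda>y. A y b) (at y)"
  let ?D = "\<lambda>y h. - (\<Sum>b\<in>Basis. (W y z \<bullet> b) *\<^sub>R (\<Sum>c\<in>Basis. (?dA y b h \<bullet> c) *\<^sub>R W y c))"
  have dA: "((\<lambda>y. A y b) has_derivative ?dA y b) (at y)" if "y \<in> S" for y b
    using Ck_on_has_derivative[OF Suc.prems that] .
  have "((\<lambda>y. W y z) has_derivative ?D y0) (at y0)" if y0: "y0 \<in> S" for y0
  proof -
    have cA: "isCont (\<lambda>y. A y b) y0" for b
      using has_derivative_continuous[OF dA[OF y0]] .
    have cW: "isCont (\<lambda>y. W y z) y0"
      by (rule isCont_inverse_operator[OF \<open>open S\<close> y0 linA linW inv cA])
    have bW: "bounded_linear (W y0)" using linW[OF y0] linear_conv_bounded_linear by blast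
    have g: "((\<lambda>y. W y0 (A y b - A y0 b)) has_derivative (\<lambda>h. W y0 (?dA y0 b h))) (at y0)" for b
      by (rule bounded_linear.has_derivative[OF bW]) (auto intro!: derivative_eq_intros dA y0)
    \<comment> \<open>The right-hand side of the resolvent identity, which has a derivative at \<open>y0\<close>.\<close>
    let ?F = "\<lambda>y. W y0 z - (\<Sum>b\<in>Basis. (W y z \<bullet> b) *\<^sub>R W y0 (A y b - A y0 b))"
    have s: "((\<lambda>y. (W y z \<bullet> b) *\<^sub>R W y0 (A y b - A y0 b)) has_derivative
        (\<lambda>h. (W y0 z \<bullet> b) *\<^sub>R W y0 (?dA y0 b h))) (at y0)" for b
      by (rule has_derivative_scaleR_zero[OF _ g]) 
         (auto intro!: continuous_intros cW simp: linear_0[OF linW[OF y0]])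
    have "(?F has_derivative (\<lambda>h. 0 - (\<Sum>b\<in>Basis. (W y0 z \<bullet> b) *\<^sub>R W y0 (?dA y0 b h)))) (at y0)"
      by (intro has_derivative_diff has_derivative_const has_derivative_sum s)
    moreover have "(\<lambda>h. 0 - (\<Sum>b\<in>Basis. (W y0 z \<bullet> b) *\<^sub>R W y0 (?dA y0 b h))) = ?D y0"
      by (subst linear_basis_expansion[OF linW[OF y0], symmetric]) simp
    ultimately have F: "(?F has_derivative ?D y0) (at y0)" by metis
    have eq: "?F y = W y z" if y: "y \<in> S" for y
    proof -
      have "(\<Sum>b\<in>Basis. (W y z \<bullet> b) *\<^sub>R W y0 (A y b - A y0 b)) = W y0 (\<Sum>b\<in>Basis. (W y z \<bullet> b) *\<^sub>R (A y b - A y0 b))"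
        by (simp add: linear_sum[OF linW[OF y0]] linear_scale[OF linW[OF y0]])
      also have "(\<Sum>b\<in>Basis. (W y z \<bullet> b) *\<^sub>R (A y b - A y0 b)) = A y (W y z) - A y0 (W y z)"
        unfolding linear_basis_expansion[OF linA[OF y], of "W y z"] linear_basis_expansion[OF linA[OF y0], of "W y z"]
        by (simp add: sum_subtractf scaleR_diff_right)
      finally show ?thesis
        using y y0 by (simp add: inv linear_diff[OF linW[OF y0]])
    qed
    show ?thesis
      by (rule has_derivative_transform_within_open[OF F \<open>open S\<close> y0]) (simp add: eq)
  qed
  moreover have "Ck_on k S (\<lambda>y. ?D y h)" for h
    using Suc.prems
    by (intro Ck_on_linear_compose[OF \<open>open S\<close> bounded_linear_minus[OF bounded_linear_ident]]
        Ck_on_sum[OF \<open>open S\<close>] Ck_on_bilinear[OF \<open>open S\<close> bounded_bilinear_scaleR] WC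
        Ck_on_linear_compose[OF \<open>open S\<close> bounded_linear_inner_left]) auto
  ultimately show ?case by (intro Ck_on_SucI[OF \<open>open S\<close>])
qed

text \<open>The derivative of the inverse \<open>g\<close> at \<open>y\<close> is the inverse of \<open>df f (g y)\<close>. If \<open>g\<close> is of class \<open>C\<^sup>k\<close>, then so
  is this operator, and \<open>g\<close> is of class \<open>C\<^sup>k\<^sup>+\<^sup>1\<close>.\<close>

lemma smooth_inverse_function:
  fixes f :: "'a::euclidean_space \<Rightarrow> 'a"
  assumes U: "open U" "x0 \<in> U" and f: "smooth_on U f" and inj: "inj (df f x0)"
  obtains U' V g where "open U'" "U' \<subseteq> U" "x0 \<in> U'" "open V" "homeomorphism U' V f g"
    "smooth_on V g" "\<And>y. y \<in> V \<Longrightarrow> inj (df g y)"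
proof -
  let ?f' = "\<lambda>x. Blinfun (df f x)"
  have bl: "bounded_linear (df f x)" if "x \<in> U" for x
    using smooth_on_has_derivative[OF f that] by (rule has_derivative_bounded_linear)
  have app: "blinfun_apply (?f' x) = df f x" if "x \<in> U" for x
    using bl[OF that] by (rule bounded_linear_Blinfun_apply)
  have der: "(f has_derivative blinfun_apply (?f' x)) (at x)" if "x \<in> U" for x
    using smooth_on_has_derivative[OF f that] app[OF that] by simp
  have cont: "continuous_on U ?f'"
  proof (rule continuous_on_blinfun_componentwise)
    fix i :: 'a
    have "continuous_on U (\<lambda>x. df f x i)"
      by (intro smooth_on_continuous smooth_intros f)
    then show "continuous_on U (\<lambda>x. blinfun_apply (?f' x) i)"
      by (rule continuous_on_eq) (simp add: app)
  qed
  have lin0: "linear (df f x0)" using bl[OF U(2)] by (rule bounded_linear.linear)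
  obtain h where h: "linear h" "h \<circ> df f x0 = id"
    using linear_injective_left_inverse[OF lin0 inj] by blast
  have "bounded_linear h" using h(1) linear_conv_bounded_linear by blast
  then have linv: "Blinfun h o\<^sub>L ?f' x0 = id_blinfun"
    using h(2) app[OF U(2)]
    by (intro blinfun_eqI) (simp add: bounded_linear_Blinfun_apply fun_eq_iff)
  obtain U' V g g' where U': "open U'" "U' \<subseteq> U" "x0 \<in> U'" and V: "open V" "f x0 \<in> V"
    and hom: "homeomorphism U' V f g"
    and dg: "\<And>y. y \<in> V \<Longrightarrow> (g has_derivative g' y) (at y)"
    and g': "\<And>y. y \<in> V \<Longrightarrow> g' y = inv (blinfun_apply (?f' (g y)))"
    and bij: "\<And>y. y \<in> V \<Longrightarrow> bij (blinfun_apply (?f' (g y)))"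
    apply (rule inverse_function_theorem[OF U(1) der cont U(2) linv])
     apply assumption
    subgoal premises p for U' V g g' using p(2-) by (rule p(1))
    done
  have gU: "g y \<in> U" if "y \<in> V" for y
    using hom that U'(2) by (auto simp: homeomorphism_def)
  have g'': "g' y = inv (df f (g y))" and bij': "bij (df f (g y))" if "y \<in> V" for y
    using g'[OF that] bij[OF that] app[OF gU[OF that]] by auto
  have "Ck_on k V g" for k
  proof (induction k)
    case 0
    then show ?case using hom by (simp add: homeomorphism_def)
  next
    case (Suc k)
    have sm: "Ck_on k U (\<lambda>x. df f x b)" for b
      using smooth_on_df[OF f, of b] unfolding smooth_on_def by blast
    have a1: "Ck_on k V (\<lambda>y. df f (g y) b)" for b
      by (rule Ck_on_compose[OF V(1) U(1) _ Suc sm]) (use gU in auto)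
    have a2: "linear (df f (g y))" if "y \<in> V" for y
      using smooth_on_df_linear[OF f gU[OF that]] .
    have a3: "linear (inv (df f (g y)))" if "y \<in> V" for y
      using has_derivative_linear[OF dg[OF that]] unfolding g''[OF that] .
    have a4: "inv (df f (g y)) (df f (g y) z) = z" "df f (g y) (inv (df f (g y)) z) = z"
      if "y \<in> V" for y z
      using bij'[OF that] by (simp_all add: bij_is_inj bij_is_surj surj_f_inv_f)
    have "Ck_on k V (\<lambda>y. inv (df f (g y)) v)" for v
      by (rule Ck_on_inverse_operator[where A = "\<lambda>y. df f (g y)", OF V(1) a2 a3 a4 a1])
    then have "Ck_on k V (\<lambda>y. g' y v)" for v
      by (rule Ck_on_cong[OF V(1), rotated]) (simp add: g'')
    then show ?case using dg by (intro Ck_on_SucI[OF V(1)])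
  qed
  then have "smooth_on V g" by (simp add: smooth_on_def)
  moreover have "inj (df g y)" if "y \<in> V" for y
    using frechet_derivative_at[OF dg[OF that]] g''[OF that] bij'[OF that]
    by (metis bij_imp_bij_inv bij_is_inj)
  ultimately show thesis using that U' V hom by blast
qed

section \<open>Linear algebra of a space-like immersion at a point\<close>

lemma bounded_bilinear_mink:
  "bounded_bilinear (mink :: real \<times> 'e::real_inner \<Rightarrow> real \<times> 'e \<Rightarrow> real)"
proof -
  have 1: "bounded_bilinear (\<lambda>(x :: real \<times> 'e) (y :: real \<times> 'e). snd x \<bullet> snd y)"
    by (rule bounded_bilinear.comp[OF bounded_bilinear_inner bounded_linear_snd bounded_linear_snd])
  have 2: "bounded_bilinear (\<lambda>(x :: real \<times> 'e) (y :: real \<times> 'e). fst x * fst y)"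
    by (rule bounded_bilinear.comp[OF bounded_bilinear_mult bounded_linear_fst bounded_linear_fst])
  interpret i1: bounded_bilinear "\<lambda>(x :: real \<times> 'e) (y :: real \<times> 'e). snd x \<bullet> snd y" by (rule 1)
  interpret i2: bounded_bilinear "\<lambda>(x :: real \<times> 'e) (y :: real \<times> 'e). fst x * fst y" by (rule 2)
  show ?thesis
  proof
    obtain K L where KL: "\<And>(a :: real \<times> 'e) (b :: real \<times> 'e). norm (snd a \<bullet> snd b) \<le> norm a * norm b * K"
      "\<And>(a :: real \<times> 'e) (b :: real \<times> 'e). norm (fst a * fst b) \<le> norm a * norm b * L"
      using i1.bounded i2.bounded by blast
    have "norm (mink a b) \<le> norm a * norm b * (K + L)" for a b :: "real \<times> 'e"
    proof -
      have "norm (mink a b) \<le> norm (fst a * fst b) + norm (snd a \<bullet> snd b)"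
        by (simp add: mink_def)
      then show ?thesis using KL[of a b] by (simp only: distrib_left)
    qed
    then show "\<exists>K. \<forall>a b :: real \<times> 'e. norm (mink a b) \<le> norm a * norm b * K" by blast
  qed (auto simp: mink_def algebra_simps inner_add_left inner_add_right)
qed

interpretation mink: bounded_bilinear "mink :: real \<times> 'e::real_inner \<Rightarrow> real \<times> 'e \<Rightarrow> real"
  by (rule bounded_bilinear_mink)

lemma mink_commute: "mink x y = mink y x"
  by (simp add: mink_def inner_commute mult.commute)

text \<open>The derivative in the direction \<open>X\<close> of the tangent field with the constant components \<open>Y\<close>; its normal
  part is the second fundamental form.\<close>

abbreviation D2 :: "('u::real_normed_vector \<Rightarrow> 'v::real_normed_vector) \<Rightarrow> 'u \<Rightarrow> 'u \<Rightarrow> 'u \<Rightarrow> 'v" where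
  "D2 f u X Y \<equiv> df (\<lambda>u'. df f u' Y) u X"

lemma D2_bilinear:
  assumes "open D" "smooth_on D f" "u \<in> D"
  shows "bilinear (D2 f u)"
proof -
  have d: "((\<lambda>u'. df f u' Y) has_derivative df (\<lambda>u'. df f u' Y) u) (at u)" for Y
    by (rule smooth_on_has_derivative[OF smooth_on_df[OF assms(2)] assms(3)])
  have lin: "linear (df f u')" if "u' \<in> D" for u'
    using smooth_on_df_linear[OF assms(2) that] .
  have "D2 f u X (Y + Z) = D2 f u X Y + D2 f u X Z" for X Y Z
  proof -
    have "((\<lambda>u'. df f u' (Y + Z)) has_derivative (\<lambda>X. D2 f u X Y + D2 f u X Z)) (at u)"
      by (rule has_derivative_transform_within_open[OF has_derivative_add[OF d d] assms(1) assms(3)])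
         (simp add: linear_add[OF lin])
    from frechet_derivative_at[OF this, symmetric] show ?thesis by simp
  qed
  moreover have "D2 f u X (c *\<^sub>R Y) = c *\<^sub>R D2 f u X Y" for X Y c
  proof -
    have "((\<lambda>u'. df f u' (c *\<^sub>R Y)) has_derivative (\<lambda>X. c *\<^sub>R D2 f u X Y)) (at u)"
      by (rule has_derivative_transform_within_open[OF has_derivative_scaleR_right[OF d] assms(1) assms(3)])
         (simp add: linear_scale[OF lin])
    from frechet_derivative_at[OF this, symmetric] show ?thesis by simp
  qed
  ultimately show ?thesis
    unfolding bilinear_def using has_derivative_linear[OF d] by (auto intro: linearI)
qed

locale spacelike_immersion_at =
  fixes f :: "'u::euclidean_space \<Rightarrow> real \<times> 'e::euclidean_space" and u :: 'u
  assumes lin: "linear (df f u)"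
    and pos: "\<And>X. X \<noteq> 0 \<Longrightarrow> induced_metric f u X X > 0"
begin

abbreviation g where "g \<equiv> induced_metric f u"

lemma g_sum_left: "g (\<Sum>i\<in>A. c i *\<^sub>R h i) Y = (\<Sum>i\<in>A. c i * g (h i) Y)"
  by (simp add: induced_metric_def linear_sum[OF lin] linear_scale[OF lin] mink.sum_left mink.scaleR_left)

lemma g_bilinear:
  "g (X + Y) Z = g X Z + g Y Z" "g (X - Y) Z = g X Z - g Y Z" "g (c *\<^sub>R X) Z = c * g X Z"
  "g X (c *\<^sub>R Z) = c * g X Z" "g X (Y + Z) = g X Y + g X Z" "g 0 Z = 0"
  by (simp_all add: induced_metric_def linear_add[OF lin] linear_diff[OF lin] linear_scale[OF lin]
     mink.add_left mink.add_right mink.diff_left mink.scaleR_left mink.scaleR_right linear_0[OF lin] mink.zero_left)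

lemma g_commute: "g X Y = g Y X"
  by (simp add: induced_metric_def mink_commute)

lemma g_eq_0: "g X X = 0 \<Longrightarrow> X = 0"
  using pos[of X] by force

text \<open>Positivity of the metric makes an orthonormal family of the right size a basis, and a vector
  orthogonal to a basis vanishes.\<close>

lemma frame_expansion:
  assumes "orthonormal_frame f u B"
  shows "X = (\<Sum>E\<in>B. g X E *\<^sub>R E)"
proof -
  have fin: "finite B" and card: "card B = DIM('u)"
    and on: "\<And>E F. E \<in> B \<Longrightarrow> F \<in> B \<Longrightarrow> g E F = (if E = F then 1 else 0)"
    using assms by (auto simp: orthonormal_frame_def)
  have "independent B"
    unfolding independent_explicit_finite_subsets
  proof (intro allI impI ballI)
    fix A c E assume A: "A \<subseteq> B" "finite A" "(\<Sum>E\<in>A. c E *\<^sub>R E) = 0" "E \<in> A"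
    have "0 = g (\<Sum>F\<in>A. c F *\<^sub>R F) E" using A by (simp add: g_bilinear)
    also have "\<dots> = (\<Sum>F\<in>A. c F * (if F = E then 1 else 0))"
      unfolding g_sum_left using A by (intro sum.cong) (auto simp: on subsetD)
    also have "\<dots> = c E" using A by (simp add: if_distrib cong: if_cong)
    finally show "c E = 0" by simp
  qed
  then have "span B = UNIV"
    using card dim_eq_card_independent dim_eq_full by metis
  define Y where "Y = X - (\<Sum>E\<in>B. g X E *\<^sub>R E)"
  have Y: "g Y F = 0" if "F \<in> B" for F
  proof -
    have "(\<Sum>E\<in>B. g X E * g E F) = (\<Sum>E\<in>B. g X E * (if E = F then 1 else 0))"
      using that by (intro sum.cong) (auto simp: on)
    also have "\<dots> = g X F" using that fin by (simp add: if_distrib cong: if_cong)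
    finally show ?thesis by (simp add: Y_def g_bilinear g_sum_left)
  qed
  have "subspace {Z. g Y Z = 0}"
    by (auto simp: subspace_def g_bilinear) (metis g_bilinear(6) g_commute)
  then have "span B \<subseteq> {Z. g Y Z = 0}" using Y by (intro span_minimal) auto
  then have "g Y Y = 0" using \<open>span B = UNIV\<close> by auto
  then show ?thesis using g_eq_0 Y_def by force
qed

lemma parseval:
  assumes "orthonormal_frame f u B"
  shows "g X Y = (\<Sum>E\<in>B. g X E * g E Y)"
proof -
  have "g X Y = g (\<Sum>E\<in>B. g X E *\<^sub>R E) Y" using frame_expansion[OF assms, of X] by simp
  then show ?thesis by (simp only: g_sum_left)
qed

text \<open>Gram-Schmidt orthonormalization: a family smaller than the dimension does not span and can be
  enlarged.\<close>

lemma orthonormal_frame_exists: "\<exists>B. orthonormal_frame f u B"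
proof -
  have "\<exists>B. finite B \<and> card B = k \<and> (\<forall>X\<in>B. \<forall>Y\<in>B. g X Y = (if X = Y then 1 else 0))"
    if "k \<le> DIM('u)" for k
    using that
  proof (induction k)
    case 0
    then show ?case by (intro exI[of _ "{}"]) auto
  next
    case (Suc k)
    then obtain B where B: "finite B" "card B = k"
      and on: "\<And>X Y. X \<in> B \<Longrightarrow> Y \<in> B \<Longrightarrow> g X Y = (if X = Y then 1 else 0)" by auto
    have "dim (span B) \<le> k" using B dim_le_card' dim_span by metis
    then have "dim (span B) \<noteq> DIM('u)" using Suc.prems by linarith
    then have "span B \<noteq> UNIV" using dim_UNIV by metis
    then obtain v where v: "v \<notin> span B" by auto
    define w where "w = v - (\<Sum>E\<in>B. g v E *\<^sub>R E)"
    have "(\<Sum>E\<in>B. g v E *\<^sub>R E) \<in> span B" by (intro span_sum span_scale span_base)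
    then have "w \<noteq> 0" using v by (auto simp: w_def)
    then have p: "g w w > 0" by (rule pos)
    have wF: "g w F = 0" if "F \<in> B" for F
    proof -
      have "(\<Sum>E\<in>B. g v E * g E F) = (\<Sum>E\<in>B. g v E * (if E = F then 1 else 0))"
        using that by (intro sum.cong) (auto simp: on)
      also have "\<dots> = g v F" using that B by (simp add: if_distrib cong: if_cong)
      finally show ?thesis by (simp add: w_def g_bilinear g_sum_left)
    qed
    let ?E = "(1 / sqrt (g w w)) *\<^sub>R w"
    have EE: "g ?E ?E = 1" using p by (simp add: g_bilinear)
    have EF: "g ?E F = 0" "g F ?E = 0" if "F \<in> B" for F
      using wF[OF that] by (auto simp: g_bilinear g_commute[of F])
    have nin: "?E \<notin> B" using EE EF by force
    show ?case
      using B nin on EE EF by (intro exI[of _ "insert ?E B"]) auto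
  qed
  then show ?thesis by (auto simp: orthonormal_frame_def)
qed

text \<open>Expand one frame in the other and apply Parseval's identity. This makes the
  definite description in the definition of the trace meaningful.\<close>

lemma trace_independent:
  assumes b: "bilinear b" and B: "orthonormal_frame f u B" and C: "orthonormal_frame f u C"
  shows "(\<Sum>E\<in>B. b E E) = (\<Sum>F\<in>C. b F F)"
proof -
  have fin: "finite B" "finite C" using B C by (auto simp: orthonormal_frame_def)
  have l1: "b (\<Sum>F\<in>C. p F *\<^sub>R F) Z = (\<Sum>F\<in>C. p F *\<^sub>R b F Z)" for p Z
  proof -
    have "linear (\<lambda>x. b x Z)" using b by (simp add: bilinear_def)
    from linear_sum[OF this, of "\<lambda>F. p F *\<^sub>R F" C] linear_scale[OF this] show ?thesis by simp
  qed
  have l2: "b Z (\<Sum>F\<in>C. p F *\<^sub>R F) = (\<Sum>F\<in>C. p F *\<^sub>R b Z F)" for p Z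
  proof -
    have "linear (b Z)" using b by (simp add: bilinear_def)
    from linear_sum[OF this, of "\<lambda>F. p F *\<^sub>R F" C] linear_scale[OF this] show ?thesis by simp
  qed
  have bEE: "b E E = (\<Sum>F\<in>C. \<Sum>G\<in>C. (g E F * g E G) *\<^sub>R b F G)" for E
  proof -
    have "b E E = b (\<Sum>F\<in>C. g E F *\<^sub>R F) (\<Sum>G\<in>C. g E G *\<^sub>R G)"
      using frame_expansion[OF C, of E] by simp
    also have "\<dots> = (\<Sum>F\<in>C. \<Sum>G\<in>C. (g E F * g E G) *\<^sub>R b F G)"
      by (simp only: l1 l2 scaleR_sum_right scaleR_scaleR)
         (rule trans[OF sum.swap], intro sum.cong refl, simp add: mult.commute)
    finally show ?thesis .
  qed
  have "(\<Sum>E\<in>B. b E E) = (\<Sum>F\<in>C. \<Sum>G\<in>C. \<Sum>E\<in>B. (g E F * g E G) *\<^sub>R b F G)"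
    unfolding bEE by (subst sum.swap, rule sum.cong[OF refl], rule sum.swap)
  also have "\<dots> = (\<Sum>F\<in>C. \<Sum>G\<in>C. g F G *\<^sub>R b F G)"
    unfolding scaleR_sum_left[symmetric]
    by (intro sum.cong refl arg_cong2[of _ _ _ _ scaleR])
       (subst parseval[OF B], simp add: g_commute)
  also have "\<dots> = (\<Sum>F\<in>C. \<Sum>G\<in>C. if G = F then b F F else 0)"
    using C by (intro sum.cong refl) (auto simp: orthonormal_frame_def)
  also have "\<dots> = (\<Sum>F\<in>C. b F F)" using fin by (simp add: if_distrib cong: if_cong)
  finally show ?thesis .
qed

lemma metric_trace_eq:
  assumes b: "bilinear b" and B: "orthonormal_frame f u B"
  shows "metric_trace f u b = (\<Sum>E\<in>B. b E E)"
  unfolding metric_trace_def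
proof (rule the_equality)
  show "\<forall>C. orthonormal_frame f u C \<longrightarrow> (\<Sum>E\<in>B. b E E) = (\<Sum>E\<in>C. b E E)"
    using trace_independent[OF b B] by blast
  fix t assume "\<forall>C. orthonormal_frame f u C \<longrightarrow> t = (\<Sum>E\<in>C. b E E)"
  then show "t = (\<Sum>E\<in>B. b E E)" using B by blast
qed

lemma normal_unique: "v - df f u X \<in> normal_vectors f u \<Longrightarrow> v - df f u X' \<in> normal_vectors f u \<Longrightarrow> X = X'"
proof -
  assume "v - df f u X \<in> normal_vectors f u" "v - df f u X' \<in> normal_vectors f u"
  then have "g (X - X') (X - X') = 0"
    unfolding normal_vectors_def induced_metric_def
    by (auto simp: linear_diff[OF lin] mink.diff_left mink.diff_right)
  then show "X = X'" using g_eq_0 by fastforce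
qed

lemma tangential_part_eq: "v - df f u X \<in> normal_vectors f u \<Longrightarrow> tangential_part f u v = X"
  unfolding tangential_part_def using normal_unique by blast

lemma normal_part_eq: "v - df f u X \<in> normal_vectors f u \<Longrightarrow> normal_part f u v = v - df f u X"
  unfolding normal_part_def by (simp add: tangential_part_eq)

text \<open>The orthogonal projection onto the tangent space, written in a frame, shows that the tangential
  part exists.\<close>

lemma normal_part_normal: "normal_part f u v \<in> normal_vectors f u"
proof -
  obtain B where B: "orthonormal_frame f u B" using orthonormal_frame_exists by blast
  let ?X = "\<Sum>E\<in>B. mink v (df f u E) *\<^sub>R E"
  have "mink (v - df f u ?X) (df f u Y) = 0" for Y
  proof -
    have "mink v (df f u Y) = (\<Sum>E\<in>B. g Y E * mink v (df f u E))"
      by (subst frame_expansion[OF B, of Y])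
         (simp only: linear_sum[OF lin] linear_scale[OF lin] mink.sum_right mink.scaleR_right real_scaleR_def)
    moreover have "mink (df f u ?X) (df f u Y) = (\<Sum>E\<in>B. mink v (df f u E) * g E Y)"
      using g_sum_left[of "\<lambda>E. mink v (df f u E)" "\<lambda>E. E" B Y] by (simp add: induced_metric_def)
    ultimately show ?thesis by (simp add: mink.diff_left g_commute mult.commute)
  qed
  then have n: "v - df f u ?X \<in> normal_vectors f u" by (simp add: normal_vectors_def)
  then show ?thesis using normal_part_eq[OF n] by simp
qed

lemma mink_normal_part:
  "\<zeta> \<in> normal_vectors f u \<Longrightarrow> mink \<zeta> (normal_part f u v) = mink \<zeta> v"
  by (simp add: normal_part_def mink.diff_right normal_vectors_def)

lemma mink_tangential_part: "mink (df f u (tangential_part f u v)) (df f u Y) = mink v (df f u Y)"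
  using normal_part_normal[of v] by (simp add: normal_part_def normal_vectors_def mink.diff_left)

lemma normal_vectors_subspace: "subspace (normal_vectors f u)"
  by (auto simp: subspace_def normal_vectors_def mink.add_left mink.scaleR_left mink.zero_left)

lemma normal_part_add: "normal_part f u (v + w) = normal_part f u v + normal_part f u w"
proof -
  have "(v + w) - df f u (tangential_part f u v + tangential_part f u w) \<in> normal_vectors f u"
    using subspace_add[OF normal_vectors_subspace normal_part_normal normal_part_normal, of v w]
    by (simp add: normal_part_def linear_add[OF lin] algebra_simps)
  from normal_part_eq[OF this] show ?thesis
    by (simp add: normal_part_def linear_add[OF lin] algebra_simps)
qed

lemma normal_part_scale: "normal_part f u (c *\<^sub>R v) = c *\<^sub>R normal_part f u v"
proof -
  have "c *\<^sub>R v - df f u (c *\<^sub>R tangential_part f u v) \<in> normal_vectors f u"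
    using subspace_scale[OF normal_vectors_subspace normal_part_normal, of c v]
    by (simp add: normal_part_def linear_scale[OF lin] algebra_simps)
  from normal_part_eq[OF this] show ?thesis
    by (simp add: normal_part_def linear_scale[OF lin] algebra_simps)
qed

lemma normal_part_tangent: "normal_part f u (df f u X) = 0"
  using normal_part_eq[of "df f u X" X] by (simp add: normal_vectors_def mink.zero_left)

lemma normal_part_linear: "linear (normal_part f u)"
  by (intro linearI normal_part_add normal_part_scale)

lemma second_fundamental_form_bilinear:
  assumes "bilinear (D2 f u)"
  shows "bilinear (second_fundamental_form f u)"
  using assms unfolding bilinear_def second_fundamental_form_def
  by (auto intro!: linear_compose[OF _ normal_part_linear, unfolded o_def])

text \<open>In codimension two a null normal \<open>\<nu>\<close> and a normal \<open>\<mu>\<close> with \<open>\<langle>\<nu>,\<mu>\<rangle> \<noteq> 0\<close> are independent of each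
  other and of the tangent space, so by dimension they span the normal space.\<close>

lemma codim2_decomposition:
  assumes dim: "DIM('u) + 1 = DIM('e)"
    and n: "\<nu> \<in> normal_vectors f u" "\<mu> \<in> normal_vectors f u"
    and null: "mink \<nu> \<nu> = 0" and nz: "mink \<nu> \<mu> \<noteq> 0"
  shows "\<exists>X p q. v = df f u X + p *\<^sub>R \<nu> + q *\<^sub>R \<mu>"
proof -
  let ?L = "\<lambda>z::'u \<times> real \<times> real. df f u (fst z) + fst (snd z) *\<^sub>R \<nu> + snd (snd z) *\<^sub>R \<mu>"
  have l: "linear ?L"
    by (intro linearI) (auto simp: linear_add[OF lin] linear_scale[OF lin] algebra_simps)
  have "inj ?L"
  proof (rule linear_injective_0[OF l, THEN iffD2], intro allI impI)
    fix z :: "'u \<times> real \<times> real"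
    obtain X p q where z: "z = (X, p, q)" by (cases z) auto
    assume "?L z = 0"
    then have 0: "df f u X + p *\<^sub>R \<nu> + q *\<^sub>R \<mu> = 0" by (simp add: z)
    have "g X X = mink (df f u X + p *\<^sub>R \<nu> + q *\<^sub>R \<mu>) (df f u X)"
      using n by (simp add: induced_metric_def mink.add_left mink.scaleR_left normal_vectors_def)
    then have X: "X = 0" using 0 g_eq_0 by (simp add: mink.zero_left)
    then have 0: "p *\<^sub>R \<nu> + q *\<^sub>R \<mu> = 0" using 0 linear_0[OF lin] by simp
    have "mink \<nu> (p *\<^sub>R \<nu> + q *\<^sub>R \<mu>) = q * mink \<nu> \<mu>"
      by (simp add: mink.add_right mink.scaleR_right null)
    then have q: "q = 0" using 0 nz by (simp add: mink.zero_right)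
    then have "p *\<^sub>R \<nu> = 0" using 0 by simp
    moreover have "\<nu> \<noteq> 0" using nz by (auto simp: mink.zero_left)
    ultimately have "p = 0" by simp
    with X q z show "z = 0" by (simp add: zero_prod_def)
  qed
  have "dim (range ?L) = DIM('u \<times> real \<times> real)"
    using dim_image_eq[OF l, of UNIV] \<open>inj ?L\<close> by (simp only: span_UNIV dim_UNIV)
  then have "span (range ?L) = UNIV"
    using dim dim_eq_full[of "range ?L"] by simp
  moreover have "span (range ?L) = range ?L"
    by (rule span_eq_iff[THEN iffD2], rule linear_subspace_image[OF l subspace_UNIV])
  ultimately have "range ?L = UNIV" by (simp only:)
  then have "v \<in> range ?L" by simp
  then obtain z where "v = ?L z" by (rule rangeE)
  then show ?thesis
    by (intro exI[of _ "fst z"] exI[of _ "fst (snd z)"] exI[of _ "snd (snd z)"])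
qed

end

lemma smooth_spacelike_immersion_at:
  assumes "smooth_on D f" "u \<in> D" "\<And>X. X \<noteq> 0 \<Longrightarrow> induced_metric f u X X > 0"
  shows "spacelike_immersion_at f u"
  using assms smooth_on_df_linear by (intro spacelike_immersion_at.intro) blast+

section \<open>Mean curvature and reparametrization\<close>

context spacelike_immersion_at
begin

lemma mean_curvature_frame:
  assumes "bilinear (D2 f u)" "orthonormal_frame f u B"
  shows "mean_curvature f u = (1 / real DIM('u)) *\<^sub>R (\<Sum>E\<in>B. second_fundamental_form f u E E)"
  unfolding mean_curvature_def
  by (simp add: metric_trace_eq[OF second_fundamental_form_bilinear[OF assms(1)] assms(2)])

lemma mean_curvature_normal:
  assumes "bilinear (D2 f u)"
  shows "mean_curvature f u \<in> normal_vectors f u"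
proof -
  obtain B where B: "orthonormal_frame f u B" using orthonormal_frame_exists by blast
  show ?thesis
    unfolding mean_curvature_frame[OF assms B]
    by (intro subspace_scale[OF normal_vectors_subspace] subspace_sum[OF normal_vectors_subspace])
       (simp add: second_fundamental_form_def normal_part_normal)
qed

end

text \<open>Pairing \<open>H\<close> with second derivatives of the position vector instead of with the second
  fundamental form is harmless, because \<open>H\<close> is normal.\<close>

definition pseudo_umbilical_at ::
  "('u::euclidean_space \<Rightarrow> real \<times> 'e::euclidean_space) \<Rightarrow> 'u \<Rightarrow> bool" where
  "pseudo_umbilical_at f u \<longleftrightarrow>
     (\<exists>c. \<forall>X Y. mink (mean_curvature f u) (D2 f u X Y) = c * induced_metric f u X Y)"

text \<open>Taking the trace identifies the factor: it is \<open>\<langle>H,H\<rangle>\<close>. Hence the factors at the single points fit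
  together to a function on the submanifold that is as smooth as \<open>H\<close>.\<close>

lemma (in spacelike_immersion_at) pseudo_umbilical_at_iff:
  assumes "bilinear (D2 f u)"
  shows "pseudo_umbilical_at f u \<longleftrightarrow> (\<forall>X Y. mink (mean_curvature f u) (D2 f u X Y) =
    mink (mean_curvature f u) (mean_curvature f u) * g X Y)" (is "_ \<longleftrightarrow> ?R")
proof
  let ?H = "mean_curvature f u"
  assume "pseudo_umbilical_at f u"
  then obtain c where c: "\<And>X Y. mink ?H (D2 f u X Y) = c * g X Y"
    by (auto simp: pseudo_umbilical_at_def)
  obtain B where B: "orthonormal_frame f u B" using orthonormal_frame_exists by blast
  have "mink ?H ?H = (1 / real DIM('u)) * (\<Sum>E\<in>B. mink ?H (second_fundamental_form f u E E))"
    by (subst (2) mean_curvature_frame[OF assms B]) (simp add: mink.scaleR_right mink.sum_right)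
  also have "(\<Sum>E\<in>B. mink ?H (second_fundamental_form f u E E)) = (\<Sum>E\<in>B. c * g E E)"
    by (simp add: second_fundamental_form_def mink_normal_part[OF mean_curvature_normal[OF assms]] c)
  also have "\<dots> = (\<Sum>E\<in>B. c)"
    using B by (intro sum.cong) (auto simp: orthonormal_frame_def)
  also have "\<dots> = real DIM('u) * c" using B by (simp add: orthonormal_frame_def)
  finally have "mink ?H ?H = c" by simp
  with c show ?R by simp
qed (auto simp: pseudo_umbilical_at_def)

lemma all2_surj:
  assumes "surj k"
  shows "(\<forall>X Y. P (k X) (k Y)) \<longleftrightarrow> (\<forall>X Y. P X Y)"
proof (intro iffI allI)
  fix X Y assume "\<forall>X Y. P (k X) (k Y)"
  then have "P (k (inv k X)) (k (inv k Y))" by blast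
  then show "P X Y" by (simp add: surj_f_inv_f[OF assms])
qed blast

text \<open>\<open>F\<close> and \<open>f\<close> describe the same piece of a submanifold in the parameters \<open>u\<close> and \<open>h u\<close>.\<close>

locale reparametrization =
  fixes f F :: "'u::euclidean_space \<Rightarrow> real \<times> 'e::euclidean_space" and h :: "'u \<Rightarrow> 'u"
    and D N :: "'u set" and u :: 'u
  assumes D: "open D" "smooth_on D f" and N: "open N" "u \<in> N" and h: "smooth_on N h" "h ` N \<subseteq> D"
    and F: "\<And>u'. u' \<in> N \<Longrightarrow> F u' = f (h u')"
    and injF: "inj (df F u)"
    and sp: "\<And>X. X \<noteq> 0 \<Longrightarrow> induced_metric f (h u) X X > 0"
begin

lemma hD: "u' \<in> N \<Longrightarrow> h u' \<in> D" using h(2) by auto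

lemma df_F: 
  assumes "u' \<in> N"
  shows "(F has_derivative (\<lambda>X. df f (h u') (df h u' X))) (at u')" "df F u' X = df f (h u') (df h u' X)"
proof -
  have "((\<lambda>u'. f (h u')) has_derivative (\<lambda>X. df f (h u') (df h u' X))) (at u')"
    using diff_chain_at[OF smooth_on_has_derivative[OF h(1) assms] smooth_on_has_derivative[OF D(2) hD[OF assms]]]
    by (simp add: o_def)
  then show 1: "(F has_derivative (\<lambda>X. df f (h u') (df h u' X))) (at u')"
    by (rule has_derivative_transform_within_open[OF _ N(1) assms]) (simp add: F)
  show "df F u' X = df f (h u') (df h u' X)"
    using frechet_derivative_at[OF 1] by metis
qed

lemma lin_h: "linear (df h u)"
  using smooth_on_df_linear[OF h(1) N(2)] .

lemma inj: "inj (df h u)"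
proof (rule injI)
  fix X Y assume "df h u X = df h u Y"
  then have "df F u X = df F u Y" by (simp add: df_F(2)[OF N(2)])
  then show "X = Y" using injF by (simp add: inj_eq)
qed

lemma surj_h: "surj (df h u)"
  using linear_injective_imp_surjective[OF lin_h inj] by simp

lemma D2_f_bilinear: "bilinear (D2 f (h u))"
  by (rule D2_bilinear[OF D hD[OF N(2)]])

text \<open>The second derivatives of \<open>h\<close> contribute a tangent vector only, which makes the second fundamental
  form tensorial.\<close>

lemma D2_F: "D2 F u X Y = df f (h u) (D2 h u X Y) + D2 f (h u) (df h u X) (df h u Y)"
proof -
  have hu: "h u \<in> D" using hD N(2) .
  have d1: "((\<lambda>u'. df h u' Y \<bullet> b) has_derivative (\<lambda>X. D2 h u X Y \<bullet> b)) (at u)" for b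
    by (rule bounded_linear.has_derivative[OF bounded_linear_inner_left
          smooth_on_has_derivative[OF smooth_on_df[OF h(1)] N(2)]])
  have d2: "((\<lambda>u'. df f (h u') b) has_derivative (\<lambda>X. D2 f (h u) (df h u X) b)) (at u)" for b
    using diff_chain_at[OF smooth_on_has_derivative[OF h(1) N(2)]
        smooth_on_has_derivative[OF smooth_on_df[OF D(2)] hu], of b]
    by (simp add: o_def)
  let ?S = "\<lambda>u'. \<Sum>b\<in>Basis. (df h u' Y \<bullet> b) *\<^sub>R df f (h u') b"
  have S: "df F u' Y = ?S u'" if "u' \<in> N" for u'
    unfolding df_F(2)[OF that]
    by (rule linear_basis_expansion[OF smooth_on_df_linear[OF D(2) hD[OF that]]])
  have "(?S has_derivative (\<lambda>X. \<Sum>b\<in>Basis. (df h u Y \<bullet> b) *\<^sub>R D2 f (h u) (df h u X) b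
      + (D2 h u X Y \<bullet> b) *\<^sub>R df f (h u) b)) (at u)"
    by (intro has_derivative_sum has_derivative_scaleR d1 d2)
  then have "((\<lambda>u'. df F u' Y) has_derivative (\<lambda>X. \<Sum>b\<in>Basis. (df h u Y \<bullet> b) *\<^sub>R D2 f (h u) (df h u X) b
      + (D2 h u X Y \<bullet> b) *\<^sub>R df f (h u) b)) (at u)"
    by (rule has_derivative_transform_within_open[OF _ N]) (simp add: S)
  from frechet_derivative_at[OF this, symmetric]
  have "D2 F u X Y = (\<Sum>b\<in>Basis. (df h u Y \<bullet> b) *\<^sub>R D2 f (h u) (df h u X) b)
      + (\<Sum>b\<in>Basis. (D2 h u X Y \<bullet> b) *\<^sub>R df f (h u) b)"
    by (simp add: sum.distrib)
  moreover have "linear (D2 f (h u) (df h u X))" using D2_f_bilinear by (simp add: bilinear_def)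
  from linear_basis_expansion[OF this, of "df h u Y"]
  have "(\<Sum>b\<in>Basis. (df h u Y \<bullet> b) *\<^sub>R D2 f (h u) (df h u X) b) = D2 f (h u) (df h u X) (df h u Y)" ..
  moreover from linear_basis_expansion[OF smooth_on_df_linear[OF D(2) hu], of "D2 h u X Y"]
  have "(\<Sum>b\<in>Basis. (D2 h u X Y \<bullet> b) *\<^sub>R df f (h u) b) = df f (h u) (D2 h u X Y)" ..
  ultimately show ?thesis by simp
qed

lemma metric_F: "induced_metric F u X Y = induced_metric f (h u) (df h u X) (df h u Y)"
  by (simp add: induced_metric_def df_F(2)[OF N(2)])

sublocale f: spacelike_immersion_at f "h u"
  by (rule smooth_spacelike_immersion_at[OF D(2) hD[OF N(2)] sp])

lemma linear_df_F: "linear (df F u)"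
proof -
  have "df F u = (\<lambda>X. df f (h u) (df h u X))" using df_F(2)[OF N(2)] by blast
  then show ?thesis using linear_compose[OF lin_h f.lin] by (simp add: o_def)
qed

sublocale F: spacelike_immersion_at F u
proof
  fix X :: 'u assume "X \<noteq> 0"
  then have "df h u X \<noteq> 0" using inj linear_0[OF lin_h] by (metis injD)
  then show "induced_metric F u X X > 0" by (simp add: metric_F sp)
qed (use linear_df_F in \<open>auto simp: linear_iff\<close>)

lemma normal_vectors_F: "normal_vectors F u = normal_vectors f (h u)"
proof -
  have "(\<forall>X. mink \<xi> (df F u X) = 0) \<longleftrightarrow> (\<forall>X. mink \<xi> (df f (h u) X) = 0)" for \<xi>
    using surj_h unfolding df_F(2)[OF N(2)] by (metis surjD)
  then show ?thesis by (simp add: normal_vectors_def)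
qed

lemma normal_part_F: "normal_part F u v = normal_part f (h u) v"
proof -
  have "v - df f (h u) (df h u (tangential_part F u v)) \<in> normal_vectors f (h u)"
    using F.normal_part_normal[of v] by (simp add: normal_part_def df_F(2)[OF N(2)] normal_vectors_F)
  from f.normal_part_eq[OF this] show ?thesis
    by (simp add: normal_part_def[of F] df_F(2)[OF N(2)])
qed

lemma second_fundamental_form_F:
  "second_fundamental_form F u X Y = second_fundamental_form f (h u) (df h u X) (df h u Y)"
  by (simp add: second_fundamental_form_def normal_part_F D2_F f.normal_part_add f.normal_part_tangent)

lemma D2_F_bilinear: "bilinear (D2 F u)"
proof -
  have s: "smooth_on N (\<lambda>x. f (h x))"
    by (rule smooth_on_compose[OF N(1) D(1) h(2) h(1) D(2)])
  have "smooth_on N F"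
    by (rule smooth_on_cong[OF N(1) _ s]) (simp add: F)
  then show ?thesis using D2_bilinear[OF N(1) _ N(2)] by blast
qed

lemma mean_curvature_F: "mean_curvature F u = mean_curvature f (h u)"
proof -
  obtain B where B: "orthonormal_frame F u B" using F.orthonormal_frame_exists by blast
  have io: "inj_on (df h u) B" using inj by (rule inj_on_subset) simp
  have hB: "orthonormal_frame f (h u) (df h u ` B)"
    using B io unfolding orthonormal_frame_def metric_F
    by (auto simp: card_image inj_on_eq_iff)
  show ?thesis
    unfolding F.mean_curvature_frame[OF D2_F_bilinear B] f.mean_curvature_frame[OF D2_f_bilinear hB]
    by (simp add: sum.reindex[OF io] second_fundamental_form_F)
qed

lemma pseudo_umbilical_at_F: "pseudo_umbilical_at F u \<longleftrightarrow> pseudo_umbilical_at f (h u)"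
proof -
  have n: "mink (mean_curvature f (h u)) (df f (h u) Z) = 0" for Z
    using f.mean_curvature_normal[OF D2_f_bilinear] by (simp add: normal_vectors_def)
  have "(\<forall>X Y. mink (mean_curvature f (h u)) (D2 f (h u) (df h u X) (df h u Y))
         = c * induced_metric f (h u) (df h u X) (df h u Y)) \<longleftrightarrow>
      (\<forall>X Y. mink (mean_curvature f (h u)) (D2 f (h u) X Y) = c * induced_metric f (h u) X Y)" for c
    by (rule all2_surj[OF surj_h, of "\<lambda>X Y. mink (mean_curvature f (h u)) (D2 f (h u) X Y) =
      c * induced_metric f (h u) X Y"])
  then show ?thesis
    by (simp add: pseudo_umbilical_at_def mean_curvature_F D2_F metric_F mink.add_right n)
qed

end

section \<open>Space-like immersions into the light cone times a line\<close>

lemma theta_derivative: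
  assumes "smooth_on D F" "u \<in> D"
  shows "(theta F has_derivative
           (\<lambda>X. (fst (df F u X), fst (snd (df F u X)), 0))) (at u)"
proof -
  note d = smooth_on_has_derivative[OF assms]
  have 1: "((\<lambda>u. fst (F u)) has_derivative (\<lambda>X. fst (df F u X))) (at u)"
    by (rule bounded_linear.has_derivative[OF bounded_linear_fst d])
  have 2: "((\<lambda>u. fst (snd (F u))) has_derivative (\<lambda>X. fst (snd (df F u X)))) (at u)"
    by (rule bounded_linear.has_derivative[OF bounded_linear_fst bounded_linear.has_derivative[OF bounded_linear_snd d]])
  show ?thesis
    unfolding theta_def[abs_def] by (intro has_derivative_Pair 1 2 has_derivative_const)
qed

locale cone_line_immersion =
  fixes F :: "'u::euclidean_space \<Rightarrow> real \<times> 'e::euclidean_space \<times> real" and D :: "'u set"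
  assumes D: "open D" "smooth_on D F"
    and cone: "\<And>u. u \<in> D \<Longrightarrow> F u \<in> light_cone_times_line"
begin

lemma theta_null: "u \<in> D \<Longrightarrow> mink (theta F u) (theta F u) = 0"
  using cone by (force simp: light_cone_times_line_def light_cone_def theta_def mink_def)

lemma theta_normal:
  assumes "u \<in> D" 
  shows "mink (theta F u) (df F u X) = 0"
proof -
  have 1: "((\<lambda>u. mink (theta F u) (theta F u)) has_derivative
      (\<lambda>X. mink (theta F u) (fst (df F u X), fst (snd (df F u X)), 0) +
        mink (fst (df F u X), fst (snd (df F u X)), 0) (theta F u))) (at u)"
    using theta_derivative[OF D(2) assms] theta_derivative[OF D(2) assms]
    by (rule mink.FDERIV)
  have 2: "((\<lambda>u. mink (theta F u) (theta F u)) has_derivative (\<lambda>X. 0)) (at u)"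
    by (rule has_derivative_transform_within_open[OF has_derivative_const[of 0] D(1) assms])
       (simp add: theta_null)
  have "mink (theta F u) (fst (df F u X), fst (snd (df F u X)), 0) +
        mink (fst (df F u X), fst (snd (df F u X)), 0) (theta F u) = 0"
    by (rule fun_cong[OF has_derivative_unique[OF 1 2], of X])
  then show ?thesis by (simp add: mink_def theta_def inner_commute inner_prod_def)
qed

text \<open>Differentiate \<open>\<langle>\<theta>, F\<^sub>* Y\<rangle> = 0\<close>. Since \<open>\<theta>\<close> is the position vector without its line coordinate, its
  derivative is the tangent vector without its line component: up to the sign, the shape operator of \<open>\<theta>\<close>
  is the projection onto the complement of \<open>e\<^sub>1\<close>.\<close>

lemma theta_D2:
  assumes "u \<in> D" 
  shows "mink (theta F u) (D2 F u X Y) =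
    - (induced_metric F u X Y - snd (snd (df F u X)) * snd (snd (df F u Y)))"
proof -
  note d2 = smooth_on_has_derivative[OF smooth_on_df[OF D(2)] assms, of Y]
  have 1: "((\<lambda>u. mink (theta F u) (df F u Y)) has_derivative
      (\<lambda>X. mink (theta F u) (D2 F u X Y) + mink (fst (df F u X), fst (snd (df F u X)), 0) (df F u Y))) (at u)"
    using theta_derivative[OF D(2) assms] d2
    by (rule mink.FDERIV)
  have 2: "((\<lambda>u. mink (theta F u) (df F u Y)) has_derivative (\<lambda>X. 0)) (at u)"
    by (rule has_derivative_transform_within_open[OF has_derivative_const[of 0] D(1) assms])
       (simp add: theta_normal)
  have "mink (theta F u) (D2 F u X Y) + mink (fst (df F u X), fst (snd (df F u X)), 0) (df F u Y) = 0"
    by (rule fun_cong[OF has_derivative_unique[OF 1 2], of X])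
  then show ?thesis by (simp add: mink_def induced_metric_def inner_prod_def)
qed

end

text \<open>\<open>\<eta>\<close> is the second null normal. The dimension of the parameter space is that of \<open>'e\<close>, so the
  codimension is two.\<close>

locale cone_line_hypersurface_at = cone_line_immersion F D + spacelike_immersion_at F u
  for F :: "'u::euclidean_space \<Rightarrow> real \<times> 'e::euclidean_space \<times> real" and D u +
  fixes \<eta> :: "real \<times> 'e \<times> real" and n :: real
  assumes n_def: "n = real DIM('u)" and uD: "u \<in> D" and dim: "DIM('u) = DIM('e)" "DIM('u) > 1"
    and eta: "\<eta> \<in> normal_vectors F u" "mink \<eta> \<eta> = 0" "mink \<eta> (theta F u) = -1"
begin

abbreviation \<sigma> where "\<sigma> X \<equiv> snd (snd (df F u X))"

lemma theta_in_normal_vectors: "theta F u \<in> normal_vectors F u"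
  using theta_normal[OF uD] by (simp add: normal_vectors_def)

lemma normal_part_of_normal: "v \<in> normal_vectors F u \<Longrightarrow> normal_part F u v = v"
  using normal_part_eq[of v 0] by (simp add: linear_0[OF lin])

lemma normal_part_formula:
  "normal_part F u v = - mink v \<eta> *\<^sub>R theta F u - mink v (theta F u) *\<^sub>R \<eta>"
proof -
  have "mink (theta F u) \<eta> \<noteq> 0" using eta by (simp add: mink_commute)
  then obtain X p q where v: "v = df F u X + p *\<^sub>R theta F u + q *\<^sub>R \<eta>"
    using codim2_decomposition[OF _ theta_in_normal_vectors eta(1) theta_null[OF uD], of v] dim by auto
  have "mink (df F u X) \<eta> = 0" "mink (df F u X) (theta F u) = 0"
    using eta(1) theta_in_normal_vectors by (simp_all add: normal_vectors_def mink_commute)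
  then have "mink v \<eta> = - p" "mink v (theta F u) = - q"
    using eta theta_null[OF uD]
    by (simp_all add: v mink.add_left mink.scaleR_left mink_commute[of "theta F u" \<eta>])
  moreover have "normal_part F u v = p *\<^sub>R theta F u + q *\<^sub>R \<eta>"
    by (simp add: v normal_part_add normal_part_scale normal_part_tangent normal_part_of_normal theta_in_normal_vectors eta(1))
  ultimately show ?thesis by simp
qed

text \<open>\<open>\<sigma>\<close> is the product with \<open>e\<^sub>1\<close>, the tangential part of the unit vector of the line. That unit vector
  is orthogonal to \<open>\<theta>\<close>, so its normal part is a multiple of the null vector \<open>\<theta>\<close> and \<open>e\<^sub>1\<close> has length one.\<close>

lemma frame_sigma:
  assumes B: "orthonormal_frame F u B"
  shows "(\<Sum>E\<in>B. \<sigma> E * \<sigma> E) = 1"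
proof -
  let ?d = "(0, 0, 1) :: real \<times> 'e \<times> real"
  let ?e = "tangential_part F u ?d"
  have s: "g ?e E = \<sigma> E" for E
    unfolding induced_metric_def mink_tangential_part by (simp add: mink_def inner_prod_def)
  have dth: "mink ?d (theta F u) = 0" by (simp add: mink_def theta_def)
  have "df F u ?e = ?d - normal_part F u ?d" by (simp add: normal_part_def)
  then have "\<sigma> ?e = 1 - snd (snd (normal_part F u ?d))" by simp
  also have "\<dots> = 1" unfolding normal_part_formula dth by (simp add: theta_def)
  finally have "1 = g ?e ?e" by (simp add: s)
  also have "\<dots> = (\<Sum>E\<in>B. g ?e E * g E ?e)" by (rule parseval[OF B])
  finally show ?thesis by (simp add: s g_commute[of _ ?e])
qed

lemma frame_card: "orthonormal_frame F u B \<Longrightarrow> (\<Sum>E\<in>B. g E E) = n"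
  by (simp add: orthonormal_frame_def n_def)

lemma mean_curvature_formula:
  assumes B: "orthonormal_frame F u B"
  shows "mean_curvature F u =
    (1 / n) *\<^sub>R ((n - 1) *\<^sub>R \<eta> - (\<Sum>E\<in>B. mink (D2 F u E E) \<eta>) *\<^sub>R theta F u)"
proof -
  have "second_fundamental_form F u E E =
      (g E E - \<sigma> E * \<sigma> E) *\<^sub>R \<eta> - mink (D2 F u E E) \<eta> *\<^sub>R theta F u" for E
    unfolding second_fundamental_form_def normal_part_formula
    by (simp add: mink_commute[of _ "theta F u"] theta_D2[OF uD] algebra_simps)
  then have "(\<Sum>E\<in>B. second_fundamental_form F u E E) =
      (\<Sum>E\<in>B. g E E - \<sigma> E * \<sigma> E) *\<^sub>R \<eta> - (\<Sum>E\<in>B. mink (D2 F u E E) \<eta>) *\<^sub>R theta F u"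
    by (simp only: scaleR_sum_left flip: sum_subtractf)
  also have "(\<Sum>E\<in>B. g E E - \<sigma> E * \<sigma> E) = n - 1"
    using frame_card[OF B] frame_sigma[OF B] by (simp add: sum_subtractf)
  finally show ?thesis
    using mean_curvature_frame[OF D2_bilinear[OF D uD] B] by (simp add: n_def)
qed

text \<open>By the formula for \<open>H\<close>, the pairing of \<open>n H\<close> with second derivatives is \<open>(n-1) A + T (g - \<sigma> \<sigma>)\<close>, where
  \<open>A\<close> is the second fundamental form along \<open>\<eta>\<close> and \<open>T\<close> its trace. If this is \<open>n c g\<close>, then \<open>A\<close> is a
  combination \<open>k g + (b - k) \<sigma> \<sigma>\<close>; computing the trace of this combination expresses \<open>T\<close> by \<open>k\<close> and \<open>b\<close> and
  leaves the single relation between them.\<close>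

theorem pseudo_umbilical_at_cone_line:
  "pseudo_umbilical_at F u \<longleftrightarrow>
    (\<exists>k b. (n - 2) * b = 2 * (n - 1) * k \<and>
       (\<forall>X Y. mink (D2 F u X Y) \<eta> = k * g X Y + (b - k) * (\<sigma> X * \<sigma> Y)))" (is "_ \<longleftrightarrow> ?R")
proof -
  obtain B where B: "orthonormal_frame F u B" using orthonormal_frame_exists by blast
  define T where "T = (\<Sum>E\<in>B. mink (D2 F u E E) \<eta>)"
  have n: "n > 1" using dim(2) by (simp add: n_def)
  have H: "mink (mean_curvature F u) (D2 F u X Y) =
     (1 / n) * ((n - 1) * mink (D2 F u X Y) \<eta> + T * (g X Y - \<sigma> X * \<sigma> Y))" for X Y
    unfolding mean_curvature_formula[OF B] T_def[symmetric]
    by (simp only: mink.scaleR_left mink.diff_left theta_D2[OF uD] mink_commute[of \<eta>] real_scaleR_def)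
       (simp add: algebra_simps)
  have tr: "T = n * k + (b - k)"
    if "\<forall>X Y. mink (D2 F u X Y) \<eta> = k * g X Y + (b - k) * (\<sigma> X * \<sigma> Y)" for k b
    using frame_card[OF B] frame_sigma[OF B] that
    by (simp add: T_def sum.distrib flip: sum_distrib_left) 
  show ?thesis
  proof
    assume "pseudo_umbilical_at F u"
    then obtain c where c: "\<And>X Y. mink (mean_curvature F u) (D2 F u X Y) = c * g X Y"
      by (auto simp: pseudo_umbilical_at_def)
    define k where "k = (n * c - T) / (n - 1)"
    define b where "b = k + T / (n - 1)"
    have A: "\<forall>X Y. mink (D2 F u X Y) \<eta> = k * g X Y + (b - k) * (\<sigma> X * \<sigma> Y)"
    proof (intro allI)
      fix X Y
      have "(n - 1) * mink (D2 F u X Y) \<eta> + T * (g X Y - \<sigma> X * \<sigma> Y) = n * c * g X Y"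
        using c[where X = X and Y = Y] n unfolding H by (simp add: field_simps)
      then have "mink (D2 F u X Y) \<eta> = (n * c * g X Y - T * (g X Y - \<sigma> X * \<sigma> Y)) / (n - 1)"
        using n by (simp add: field_simps)
      also have "\<dots> = k * g X Y + (b - k) * (\<sigma> X * \<sigma> Y)"
        unfolding b_def k_def by (simp add: diff_divide_distrib add_divide_distrib algebra_simps)
      finally show "mink (D2 F u X Y) \<eta> = k * g X Y + (b - k) * (\<sigma> X * \<sigma> Y)" .
    qed
    have "(n - 1) * (b - k) = T" using n by (simp add: b_def)
    then have "(n - 2) * b = 2 * (n - 1) * k"
      using tr[OF A] by (simp add: algebra_simps)
    with A show ?R by blast
  next
    assume ?R
    then obtain k b where kb: "(n - 2) * b = 2 * (n - 1) * k"
      and A: "\<forall>X Y. mink (D2 F u X Y) \<eta> = k * g X Y + (b - k) * (\<sigma> X * \<sigma> Y)" by auto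
    have "mink (mean_curvature F u) (D2 F u X Y) = ((b + 2 * (n - 1) * k) / n) * g X Y" for X Y
    proof -
      have "(n - 1) * mink (D2 F u X Y) \<eta> + T * (g X Y - \<sigma> X * \<sigma> Y)
         = (b + 2 * (n - 1) * k) * g X Y + ((n - 2) * b - 2 * (n - 1) * k) * (\<sigma> X * \<sigma> Y)"
        unfolding tr[OF A] A[rule_format] by (simp add: algebra_simps)
      then show ?thesis unfolding H kb by simp
    qed
    then show "pseudo_umbilical_at F u" unfolding pseudo_umbilical_at_def by blast
  qed
qed

end

section \<open>Horospherical coordinates on the light cone\<close>

definition lift :: "real \<times> 'e \<Rightarrow> real \<Rightarrow> real \<times> 'e \<times> real" where
  "lift y s = (fst y, snd y, s)"

lemma lift_simps [simp]: "fst (lift y s) = fst y" "fst (snd (lift y s)) = snd y" "snd (snd (lift y s)) = s"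
  by (simp_all add: lift_def)

definition base :: "real \<times> 'e \<times> real \<Rightarrow> real \<times> 'e" where "base z = (fst z, fst (snd z))"

lemma base_lift [simp]: "base (lift y s) = y" by (simp add: base_def)

lemma smooth_on_base [smooth_intros]: "open S \<Longrightarrow> smooth_on S z \<Longrightarrow> smooth_on S (\<lambda>u. base (z u))"
  unfolding base_def by (intro smooth_intros)

lemma mink_lift: "mink (lift y s) (lift z t) = mink y z + s * t"
  by (simp add: mink_def lift_def)

lemma lift_light_cone: "lift y s \<in> light_cone_times_line \<longleftrightarrow> y \<in> light_cone"
  by (simp add: lift_def light_cone_times_line_def)

lemma theta_lift: "theta (\<lambda>u. lift (y u) (s u)) u = lift (y u) 0"
  by (simp add: theta_def lift_def)

lemma lift_has_derivative:
  assumes "(y has_derivative y') (at u)" "(s has_derivative s') (at u)"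
  shows "((\<lambda>u. lift (y u) (s u)) has_derivative (\<lambda>X. lift (y' X) (s' X))) (at u)"
  unfolding lift_def
  by (intro has_derivative_Pair bounded_linear.has_derivative[OF bounded_linear_fst]
      bounded_linear.has_derivative[OF bounded_linear_snd] assms)

lemma smooth_on_lift [smooth_intros]:
  "open S \<Longrightarrow> smooth_on S y \<Longrightarrow> smooth_on S s \<Longrightarrow> smooth_on S (\<lambda>u. lift (y u) (s u))"
  unfolding lift_def by (intro smooth_intros)

lemma fst_has_derivative: "(fst has_derivative fst) (at u)"
  by (rule bounded_linear_imp_has_derivative[OF bounded_linear_fst])

text \<open>Graphs over the horosphere and warped products both have the line coordinate as a parameter. All
  that depends on the immersion then takes place in the component \<open>y\<close> on the light cone.\<close>

lemma df_lift:
  assumes "smooth_on D y" "u \<in> D"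
  shows "df (\<lambda>u. lift (y u) (fst u)) u X = lift (df y u X) (fst X)"
  using frechet_derivative_at[OF lift_has_derivative[OF smooth_on_has_derivative[OF assms] fst_has_derivative]]
  by metis

lemma D2_lift:
  assumes "open D" "smooth_on D y" "u \<in> D"
  shows "D2 (\<lambda>u. lift (y u) (fst u)) u X Y = lift (D2 y u X Y) 0"
proof -
  have "((\<lambda>u. lift (df y u Y) (fst Y)) has_derivative (\<lambda>X. lift (D2 y u X Y) 0)) (at u)"
    by (rule lift_has_derivative[OF smooth_on_has_derivative[OF smooth_on_df[OF assms(2)] assms(3)] has_derivative_const])
  then have "((\<lambda>u. df (\<lambda>u. lift (y u) (fst u)) u Y) has_derivative (\<lambda>X. lift (D2 y u X Y) 0)) (at u)"
    by (rule has_derivative_transform_within_open[OF _ assms(1,3)]) (simp add: df_lift[OF assms(2)])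
  from frechet_derivative_at[OF this] show ?thesis by metis
qed

text \<open>\<open>hor\<close> parametrizes the section of the light cone by the null hyperplane \<open>\<langle>y,\<nu>\<rangle> = -1\<close>, where
  \<open>\<nu> = (1,-w)\<close>. It is isometric, so a graph over it has an explicit orthonormal frame, and it meets
  every ray of the light cone except the one through \<open>\<nu>\<close>. The map \<open>J\<close> identifies the parameter space
  with the complement of the unit vector \<open>w\<close>; \<open>dhor\<close> is the derivative of \<open>hor\<close>.\<close>

locale horosphere =
  fixes w :: "'e::euclidean_space" and J :: "'v::euclidean_space \<Rightarrow> 'e"
  assumes w: "w \<bullet> w = 1" and J: "linear J" "\<And>x y. J x \<bullet> J y = x \<bullet> y" "\<And>x. w \<bullet> J x = 0"
    and span: "\<And>y. y = J (adjoint J y) + (y \<bullet> w) *\<^sub>R w"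
begin

definition \<nu> :: "real \<times> 'e" where "\<nu> = (1, - w)"
definition hor :: "'v \<Rightarrow> real \<times> 'e" where
  "hor t = ((1 + t \<bullet> t) / 2, J t + ((1 - t \<bullet> t) / 2) *\<^sub>R w)"
definition dhor :: "'v \<Rightarrow> 'v \<Rightarrow> real \<times> 'e" where
  "dhor t v = (t \<bullet> v, J v - (t \<bullet> v) *\<^sub>R w)"

text \<open>Polar coordinates relative to the horosphere: \<open>y = radius y \<cdot> hor (horo_coord y)\<close> on the light cone.
  Both are defined on the ambient space, where they are smooth off the null hyperplane \<open>\<langle>y,\<nu>\<rangle> = 0\<close>.\<close>

definition radius :: "real \<times> 'e \<Rightarrow> real" where "radius y = fst y + snd y \<bullet> w"
definition horo_coord :: "real \<times> 'e \<Rightarrow> 'v" where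
  "horo_coord y = (1 / radius y) *\<^sub>R adjoint J (snd y)"

lemma J_inner_w [simp]: "J x \<bullet> w = 0" using J(3)[of x] by (simp add: inner_commute)
lemma w_inner_J [simp]: "w \<bullet> J x = 0" by (rule J(3))

lemmas inner_expand = inner_add_left inner_add_right inner_diff_left inner_diff_right

lemma mink_hor [simp]: "mink (hor t) (hor t) = 0" "mink (hor t) \<nu> = -1" "mink \<nu> (hor t) = -1"
  "mink \<nu> \<nu> = 0" "mink (hor t) (dhor t v) = 0" "mink (dhor t v) (hor t) = 0"
  "mink \<nu> (dhor t v) = 0" "mink (dhor t v) \<nu> = 0" "mink (dhor t v) (dhor t v') = v \<bullet> v'"
  by (simp_all add: mink_def hor_def \<nu>_def dhor_def inner_expand w J(2) field_simps inner_commute)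

lemma hor_pos: "fst (hor t) > 0"
  by (simp add: hor_def add_pos_nonneg)

lemma bounded_linear_J: "bounded_linear J"
  using J(1) linear_conv_bounded_linear by blast

lemma hor_has_derivative: "(hor has_derivative dhor t) (at t)"
proof -
  have "((\<lambda>t. ((1 + t \<bullet> t) / 2, J t + ((1 - t \<bullet> t) / 2) *\<^sub>R w)) has_derivative dhor t) (at t)"
    unfolding dhor_def[abs_def]
    by (auto intro!: derivative_eq_intros bounded_linear.has_derivative[OF bounded_linear_J]
        simp: inner_commute field_simps)
  then show ?thesis by (simp add: hor_def[abs_def])
qed

lemma dhor_linear: "dhor t (v + v') = dhor t v + dhor t v'" "dhor t (c *\<^sub>R v) = c *\<^sub>R dhor t v" "dhor t 0 = 0"
  by (simp_all add: dhor_def linear_add[OF J(1)] linear_scale[OF J(1)] linear_0[OF J(1)] inner_expand algebra_simps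
     zero_prod_def)

lemma dhor_has_derivative: "((\<lambda>t. dhor t v) has_derivative (\<lambda>h. (h \<bullet> v) *\<^sub>R \<nu>)) (at t)"
proof -
  have "(\<lambda>h. (h \<bullet> v) *\<^sub>R \<nu>) = (\<lambda>h. (h \<bullet> v, 0 - (h \<bullet> v) *\<^sub>R w))"
    by (simp add: \<nu>_def)
  then show ?thesis
    unfolding dhor_def
    by (auto intro!: derivative_eq_intros)
qed

lemma smooth_on_hor_compose [smooth_intros]:
  "open S \<Longrightarrow> smooth_on S h \<Longrightarrow> smooth_on S (\<lambda>u. hor (h u))"
  unfolding hor_def
  by (intro smooth_intros smooth_on_linear_compose[OF bounded_linear_J]) auto

lemma smooth_on_dhor_compose [smooth_intros]:
  "open S \<Longrightarrow> smooth_on S h \<Longrightarrow> smooth_on S k \<Longrightarrow> smooth_on S (\<lambda>u. dhor (h u) (k u))"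
  unfolding dhor_def
  by (intro smooth_intros smooth_on_linear_compose[OF bounded_linear_J]) auto

lemma adjoint_J: "adjoint J (J t) = t"
proof -
  have "x \<bullet> adjoint J (J t) = x \<bullet> t" for x
    using adjoint_works[OF J(1), of x "J t"] by (simp add: J(2))
  then show ?thesis by (metis vector_eq_rdot inner_commute)
qed

lemma adjoint_w: "adjoint J w = 0"
proof -
  have "x \<bullet> adjoint J w = 0" for x
    using adjoint_works[OF J(1), of x w] by simp
  then show ?thesis by (metis inner_eq_zero_iff)
qed

lemma adjoint_J_linear: "linear (adjoint J)" by (rule adjoint_linear[OF J(1)])

lemma radius_hor: "radius (c *\<^sub>R hor t) = c"
  by (simp add: radius_def hor_def inner_expand w algebra_simps add_divide_distrib diff_divide_distrib)

lemma horo_coord_hor: "c \<noteq> 0 \<Longrightarrow> horo_coord (c *\<^sub>R hor t) = t"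
  by (simp add: horo_coord_def radius_hor)
     (simp add: hor_def linear_add[OF adjoint_J_linear] linear_scale[OF adjoint_J_linear] adjoint_J adjoint_w)

lemma radius_horo_coord:
  assumes "y \<in> light_cone" "radius y \<noteq> 0"
  shows "y = radius y *\<^sub>R hor (horo_coord y)"
proof -
  define z where "z = adjoint J (snd y)"
  define a where "a = snd y \<bullet> w"
  define r where "r = radius y"
  have r: "r \<noteq> 0" "r = fst y + a" using assms by (auto simp: r_def radius_def a_def)
  have s: "snd y = J z + a *\<^sub>R w" unfolding z_def a_def by (rule span)
  have "snd y \<bullet> snd y = z \<bullet> z + a * a" by (simp add: s inner_expand J(2) w)
  moreover have "snd y \<bullet> snd y = fst y * fst y" using assms by (simp add: light_cone_def mink_def)
  ultimately have zz: "z \<bullet> z = r * (fst y - a)" using r(2) by (simp add: algebra_simps)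
  have c: "horo_coord y = (1 / r) *\<^sub>R z" by (simp add: horo_coord_def r_def z_def)
  have cc: "r * (horo_coord y \<bullet> horo_coord y) = fst y - a"
    using r(1) unfolding c by (simp add: zz)
  have "r * ((1 + horo_coord y \<bullet> horo_coord y) / 2) = fst y"
    using cc r(2) by (simp add: algebra_simps add_divide_distrib diff_divide_distrib)
  moreover have "r * ((1 - horo_coord y \<bullet> horo_coord y) / 2) = a"
    using cc r(2) by (simp add: algebra_simps add_divide_distrib diff_divide_distrib)
  moreover have "r *\<^sub>R J (horo_coord y) = J z"
    using r(1) by (simp add: c linear_scale[OF J(1)])
  ultimately show ?thesis
    unfolding r_def[symmetric] using s
    by (simp add: hor_def prod_eq_iff scaleR_add_right)
qed

lemma smooth_on_radius [smooth_intros]: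
  "open S \<Longrightarrow> smooth_on S y \<Longrightarrow> smooth_on S (\<lambda>u. radius (y u))"
  unfolding radius_def by (intro smooth_intros)

lemma smooth_on_horo_coord [smooth_intros]:
  "open S \<Longrightarrow> smooth_on S y \<Longrightarrow> (\<And>u. u \<in> S \<Longrightarrow> radius (y u) \<noteq> 0) \<Longrightarrow> smooth_on S (\<lambda>u. horo_coord (y u))"
  unfolding horo_coord_def
  by (intro smooth_intros smooth_on_linear_compose[of "adjoint J"])
     (use adjoint_J_linear linear_conv_bounded_linear in auto)

end

text \<open>\<open>J\<close> is an isometry onto the hyperplane orthogonal to \<open>w\<close>, which has the dimension of \<open>'v\<close>.\<close>

lemma horosphere_exists:
  assumes "w \<bullet> w = (1::real)" "DIM('e) = DIM('v) + 1"
  shows "\<exists>J :: 'v::euclidean_space \<Rightarrow> 'e::euclidean_space. horosphere w J"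
proof -
  have "w \<noteq> 0" using assms(1) by auto
  then have "dim (UNIV :: 'v set) = dim {y. w \<bullet> y = 0}"
    using assms(2) by (simp add: dim_hyperplane)
  from isometry_subspaces[OF subspace_UNIV subspace_hyperplane this]
  obtain J :: "'v \<Rightarrow> 'e" where J: "linear J" "J ` UNIV = {y. w \<bullet> y = 0}"
    and norm: "\<And>x. x \<in> UNIV \<Longrightarrow> norm (J x) = norm x"
    by auto
  have inner: "J x \<bullet> J y = x \<bullet> y" for x y
  proof -
    have "norm (J x + J y) = norm (x + y)" using norm linear_add[OF J(1)] by (metis UNIV_I)
    then have "norm (J x + J y)^2 = norm (x + y)^2" by simp
    then show ?thesis
      using norm[of x] norm[of y] by (simp add: dot_norm)
  qed
  have orth: "w \<bullet> J x = 0" for x using J(2) by blast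
  have "y = J (adjoint J y) + (y \<bullet> w) *\<^sub>R w" for y
  proof -
    have "w \<bullet> (y - (y \<bullet> w) *\<^sub>R w) = 0" using assms(1) by (simp add: inner_diff_right inner_commute)
    then have "y - (y \<bullet> w) *\<^sub>R w \<in> range J" using J(2) by blast
    then obtain x where x: "y - (y \<bullet> w) *\<^sub>R w = J x" by blast
    have "z \<bullet> adjoint J y = z \<bullet> x" for z
    proof -
      have "z \<bullet> adjoint J y = J z \<bullet> (J x + (y \<bullet> w) *\<^sub>R w)"
        unfolding adjoint_works[OF J(1)] x[symmetric] by simp
      also have "\<dots> = z \<bullet> x" using orth[of z] by (simp add: inner_add_right inner inner_commute)
      finally show ?thesis .
    qed
    then have "adjoint J y = x" by (metis vector_eq_rdot inner_commute)
    then show ?thesis using x by (simp add: algebra_simps)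
  qed
  then show ?thesis
    using assms(1) J(1) inner orth unfolding horosphere_def by blast
qed

section \<open>Graph charts of a submanifold\<close>

lemma local_param_reparametrize:
  assumes x: "local_param M \<phi> D x"
    and U: "open U" "U \<subseteq> D" "open V" and hom: "homeomorphism V U k h"
    and k: "smooth_on V k" "\<And>v. v \<in> V \<Longrightarrow> inj (df k v)"
  shows "local_param M \<phi> V (x \<circ> k)"
  unfolding local_param_def
proof (intro conjI ballI)
  have xD: "open D" "openin (top_of_set M) (x ` D)" "smooth_on D (\<phi> \<circ> x)"
    and inj: "\<And>u. u \<in> D \<Longrightarrow> inj (df (\<phi> \<circ> x) u)"
    using x by (auto simp: local_param_def)
  obtain y where y: "homeomorphism D (x ` D) x y" using x by (auto simp: local_param_def)
  show "open V" by fact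
  have kV: "k ` V = U" using hom by (simp add: homeomorphism_def)
  have im: "(x \<circ> k) ` V = x ` U" unfolding image_comp[symmetric] kV ..
  have "openin (top_of_set (x ` D)) (x ` U)"
    by (rule homeomorphism_imp_open_map[OF y open_openin_trans[OF xD(1) U(1,2)]])
  then show "openin (top_of_set M) ((x \<circ> k) ` V)"
    unfolding im using xD(2) by (rule openin_trans)
  have "homeomorphism U (x ` U) x y"
    by (rule homeomorphism_of_subsets[OF y U(2)]) auto
  from homeomorphism_compose[OF hom this]
  show "\<exists>y. homeomorphism V ((x \<circ> k) ` V) (x \<circ> k) y" unfolding im by blast
  have kD: "k ` V \<subseteq> D" using kV U(2) by simp
  show "smooth_on V (\<phi> \<circ> (x \<circ> k))"
    using smooth_on_compose[OF U(3) xD(1) kD k(1) xD(3)] by (simp add: o_def)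
  fix v assume v: "v \<in> V"
  then have kv: "k v \<in> D" using kD by auto
  have "(\<phi> \<circ> (x \<circ> k) has_derivative df (\<phi> \<circ> x) (k v) \<circ> df k v) (at v)"
    using diff_chain_at[OF smooth_on_has_derivative[OF k(1) v] smooth_on_has_derivative[OF xD(3) kv]]
    by (simp only: comp_assoc)
  from frechet_derivative_at[OF this, symmetric]
  show "inj (df (\<phi> \<circ> (x \<circ> k)) v)"
    using inj_compose[OF inj[OF kv] k(2)[OF v]] by simp
qed

lemma local_param_restrict:
  assumes "local_param M \<phi> D x" "open U" "U \<subseteq> D"
  shows "local_param M \<phi> U x"
  using local_param_reparametrize[OF assms assms(2) _ smooth_on_ident, of "\<lambda>x. x"]
  by (simp add: homeomorphism_def o_def)

lemma local_param_subset: "local_param M \<phi> D x \<Longrightarrow> x ` D \<subseteq> M"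
  unfolding local_param_def using openin_imp_subset by blast

context horosphere
begin

abbreviation cone_graph :: "(real \<times> 'v \<Rightarrow> real) \<Rightarrow> real \<times> 'v \<Rightarrow> real \<times> 'e \<times> real" where
  "cone_graph R \<equiv> \<lambda>u. lift (R u *\<^sub>R hor (snd u)) (fst u)"

definition graph_coord :: "real \<times> 'e \<times> real \<Rightarrow> real \<times> 'v" where
  "graph_coord z = (snd (snd z), horo_coord (base z))"

lemma smooth_on_graph_coord [smooth_intros]:
  "open S \<Longrightarrow> smooth_on S z \<Longrightarrow> (\<And>u. u \<in> S \<Longrightarrow> radius (base (z u)) \<noteq> 0) \<Longrightarrow>
    smooth_on S (\<lambda>u. graph_coord (z u))"
  unfolding graph_coord_def by (intro smooth_intros)

lemma graph_coord_recover:
  assumes "z \<in> light_cone_times_line" "radius (base z) \<noteq> 0"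
  shows "z = lift (radius (base z) *\<^sub>R hor (snd (graph_coord z))) (fst (graph_coord z))"
proof -
  have "base z \<in> light_cone" using assms(1) by (auto simp: light_cone_times_line_def base_def)
  from radius_horo_coord[OF this assms(2)] have "z = lift (base z) (snd (snd z))"
    by (simp add: base_def lift_def)
  then show ?thesis using radius_horo_coord[OF \<open>base z \<in> light_cone\<close> assms(2)]
    by (simp add: graph_coord_def)
qed

lemma graph_coord_cone_graph: "R u \<noteq> 0 \<Longrightarrow> graph_coord (cone_graph R u) = u"
  by (simp add: graph_coord_def horo_coord_hor)

definition graph_chart ::
  "'p::topological_space set \<Rightarrow> ('p \<Rightarrow> real \<times> 'e \<times> real) \<Rightarrow> (real \<times> 'v) set \<Rightarrow> (real \<times> 'v \<Rightarrow> 'p) \<Rightarrow>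
    (real \<times> 'v \<Rightarrow> real) \<Rightarrow> bool" where
  "graph_chart M \<phi> D x R \<longleftrightarrow> local_param M \<phi> D x \<and> smooth_on D R \<and>
     (\<forall>u\<in>D. R u > 0 \<and> \<phi> (x u) = cone_graph R u)"

end

section \<open>Graphs over a horosphere\<close>

lemma df_eqI: "(f has_derivative f') (at x) \<Longrightarrow> df f x = f'"
  by (rule frechet_derivative_at[symmetric])

locale horosphere_graph = horosphere w J
  for w :: "'e::euclidean_space" and J :: "'v::euclidean_space \<Rightarrow> 'e" +
  fixes R :: "real \<times> 'v \<Rightarrow> real" and D :: "(real \<times> 'v) set"
  assumes D: "open D" and R: "smooth_on D R" "\<And>u. u \<in> D \<Longrightarrow> R u > 0"
    and dim_e: "DIM('e) = DIM('v) + 1"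
begin

abbreviation "y \<equiv> \<lambda>u. R u *\<^sub>R hor (snd u)"

lemma snd_has_derivative: "(snd has_derivative snd) (at u)"
  by (rule bounded_linear_imp_has_derivative[OF bounded_linear_snd])

lemma smooth_y: "smooth_on D y"
  by (intro smooth_intros D R)

lemma smooth_cone_graph: "smooth_on D (cone_graph R)"
  by (intro smooth_intros smooth_y D)

lemma linear_R: "u \<in> D \<Longrightarrow> linear (df R u)"
  using smooth_on_df_linear[OF R(1)] .

lemma df_y: 
  assumes "u \<in> D"
  shows "df y u = (\<lambda>X. df R u X *\<^sub>R hor (snd u) + R u *\<^sub>R dhor (snd u) (snd X))"
proof -
  have "((\<lambda>u. hor (snd u)) has_derivative (\<lambda>X. dhor (snd u) (snd X))) (at u)"
    using diff_chain_at[OF snd_has_derivative hor_has_derivative] by (simp add: o_def)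
  from has_derivative_scaleR[OF smooth_on_has_derivative[OF R(1) assms] this]
  show ?thesis by (intro df_eqI) (simp add: add.commute)
qed

lemma D2_y: 
  assumes "u \<in> D"
  shows "D2 y u X Y = D2 R u X Y *\<^sub>R hor (snd u) + df R u Y *\<^sub>R dhor (snd u) (snd X)
    + df R u X *\<^sub>R dhor (snd u) (snd Y) + (R u * (snd X \<bullet> snd Y)) *\<^sub>R \<nu>"
proof -
  have 1: "((\<lambda>u. hor (snd u)) has_derivative (\<lambda>X. dhor (snd u) (snd X))) (at u)"
    using diff_chain_at[OF snd_has_derivative hor_has_derivative] by (simp add: o_def)
  have 2: "((\<lambda>u. dhor (snd u) (snd Y)) has_derivative (\<lambda>X. (snd X \<bullet> snd Y) *\<^sub>R \<nu>)) (at u)"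
    using diff_chain_at[OF snd_has_derivative dhor_has_derivative] by (simp add: o_def)
  have "((\<lambda>u. df R u Y *\<^sub>R hor (snd u) + R u *\<^sub>R dhor (snd u) (snd Y)) has_derivative
     (\<lambda>X. (df R u Y *\<^sub>R dhor (snd u) (snd X) + D2 R u X Y *\<^sub>R hor (snd u)) +
        (R u *\<^sub>R ((snd X \<bullet> snd Y) *\<^sub>R \<nu>) + df R u X *\<^sub>R dhor (snd u) (snd Y)))) (at u)"
    by (intro has_derivative_add has_derivative_scaleR 1 2 smooth_on_has_derivative[OF R(1) assms]
      smooth_on_has_derivative[OF smooth_on_df[OF R(1)] assms])
  then have "((\<lambda>u. df y u Y) has_derivative
     (\<lambda>X. (df R u Y *\<^sub>R dhor (snd u) (snd X) + D2 R u X Y *\<^sub>R hor (snd u)) +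
        (R u *\<^sub>R ((snd X \<bullet> snd Y) *\<^sub>R \<nu>) + df R u X *\<^sub>R dhor (snd u) (snd Y)))) (at u)"
    by (rule has_derivative_transform_within_open[OF _ D assms]) (simp add: df_y)
  from df_eqI[OF this] show ?thesis by simp
qed

lemma metric_graph:
  assumes "u \<in> D"
  shows "induced_metric (cone_graph R) u X Y = fst X * fst Y + (R u)\<^sup>2 * (snd X \<bullet> snd Y)"
  unfolding induced_metric_def df_lift[OF smooth_y assms] mink_lift df_y[OF assms]
  by (simp add: mink.add_left mink.add_right mink.scaleR_left mink.scaleR_right power2_eq_square)

lemma spacelike_graph:
  assumes "u \<in> D" "X \<noteq> 0"
  shows "induced_metric (cone_graph R) u X X > 0"
proof -
  have "fst X \<noteq> 0 \<or> snd X \<noteq> 0" using assms(2) by (auto simp: prod_eq_iff)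
  moreover have "fst X * fst X \<ge> 0" "(R u)\<^sup>2 * (snd X \<bullet> snd X) \<ge> 0" by auto
  moreover have "fst X \<noteq> 0 \<Longrightarrow> fst X * fst X > 0" by (auto simp: zero_less_mult_iff linorder_neq_iff)
  moreover have "snd X \<noteq> 0 \<Longrightarrow> (R u)\<^sup>2 * (snd X \<bullet> snd X) > 0"
    using R(2)[OF assms(1)] by simp
  ultimately show ?thesis unfolding metric_graph[OF assms(1)] by linarith
qed

lemma graph_in_cone:
  assumes "u \<in> D" shows "cone_graph R u \<in> light_cone_times_line"
  using R(2)[OF assms] hor_pos
  by (simp add: lift_light_cone light_cone_def mink.scaleR_left mink.scaleR_right)

text \<open>The null normal \<open>\<eta>\<close> of a graph, found by solving the linear equations \<open>\<langle>\<eta>, F\<^sub>* X\<rangle> = 0\<close> and then choosing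
  the component along \<open>hor\<close> so that \<open>\<langle>\<eta>,\<eta>\<rangle> = 0\<close>. The coefficient \<open>gradient\<close> is minus the gradient of
  \<open>1/R\<close> in the variable \<open>t\<close>, \<open>speed\<close> is the logarithmic derivative of \<open>R\<close> in the variable \<open>s\<close>.\<close>

definition gradient :: "real \<times> 'v \<Rightarrow> 'v" where
  "gradient u = (1 / (R u)\<^sup>2) *\<^sub>R (\<Sum>b\<in>Basis. df R u (0, b) *\<^sub>R b)"
definition speed :: "real \<times> 'v \<Rightarrow> real" where "speed u = df R u (1, 0) / R u"
definition normal_height :: "real \<times> 'v \<Rightarrow> real" where
  "normal_height u = ((speed u)\<^sup>2 + gradient u \<bullet> gradient u) / 2"
definition \<eta> :: "real \<times> 'v \<Rightarrow> real \<times> 'e \<times> real" where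
  "\<eta> u = lift ((1 / R u) *\<^sub>R \<nu> + (normal_height u * R u) *\<^sub>R hor (snd u) + dhor (snd u) (gradient u)) (speed u)"

lemma df_R_split:
  assumes "u \<in> D" shows "df R u X = R u * speed u * fst X + (R u)\<^sup>2 * (gradient u \<bullet> snd X)"
proof -
  note l = linear_R[OF assms]
  have "X = fst X *\<^sub>R (1, 0) + (0, snd X)" by (simp add: prod_eq_iff)
  then have "df R u X = df R u (fst X *\<^sub>R (1, 0) + (0, snd X))" by simp
  also have "\<dots> = fst X * df R u (1, 0) + df R u (0, snd X)"
    by (simp only: linear_add[OF l] linear_scale[OF l] real_scaleR_def)
  also have "df R u (0, snd X) = (\<Sum>b\<in>Basis. (snd X \<bullet> b) *\<^sub>R df R u (0, b))"
  proof -
    have "linear (\<lambda>v. df R u (0, v))"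
      using linear_compose[OF _ l, of "\<lambda>v. (0, v)"] by (simp add: o_def linear_iff)
    from linear_basis_expansion[OF this, of "snd X"] show ?thesis .
  qed
  also have "\<dots> = (\<Sum>b\<in>Basis. df R u (0, b) *\<^sub>R b) \<bullet> snd X"
    by (subst inner_sum_left) (simp add: inner_commute mult.commute)
  finally show ?thesis
    using R(2)[OF assms] by (simp add: gradient_def speed_def)
qed

lemma smooth_gradient: "smooth_on D gradient"
  unfolding gradient_def[abs_def] by (intro smooth_intros D R) (use R(2) in force)

lemma smooth_speed: "smooth_on D speed"
  unfolding speed_def[abs_def] by (intro smooth_intros D R) (use R(2) in force)

lemma smooth_eta: "smooth_on D \<eta>"
  unfolding \<eta>_def[abs_def] normal_height_def
  by (intro smooth_intros smooth_gradient smooth_speed D R) (use R(2) in force)+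

lemma graph_hypersurface:
  assumes u: "u \<in> D"
  shows "cone_line_hypersurface_at (cone_graph R) D u (\<eta> u) (real DIM('e))"
proof -
  have Ru: "R u > 0" using R(2)[OF u] .
  interpret sp: spacelike_immersion_at "cone_graph R" u
    by (rule smooth_spacelike_immersion_at[OF smooth_cone_graph u spacelike_graph[OF u]])
  have "mink (\<eta> u) (df (cone_graph R) u X) = 0" for X
    unfolding df_lift[OF smooth_y u] mink_lift df_y[OF u] \<eta>_def df_R_split[OF u, of X]
    using Ru by (simp add: mink.add_left mink.add_right mink.scaleR_left mink.scaleR_right field_simps power2_eq_square)
  then have 1: "\<eta> u \<in> normal_vectors (cone_graph R) u" by (simp add: normal_vectors_def)
  have 2: "mink (\<eta> u) (\<eta> u) = 0"
    unfolding mink_lift \<eta>_def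
    using Ru by (simp add: mink.add_left mink.add_right mink.scaleR_left mink.scaleR_right normal_height_def field_simps power2_eq_square)
  have 3: "mink (\<eta> u) (theta (cone_graph R) u) = -1"
    unfolding theta_lift unfolding mink_lift \<eta>_def 
    using Ru by (simp add: mink.add_left mink.scaleR_left mink.scaleR_right)
  show ?thesis
    by unfold_locales (use 1 2 3 D smooth_cone_graph graph_in_cone u dim_e in \<open>auto simp: \<close>)
qed

lemma second_form_eta:
  assumes u: "u \<in> D"
  shows "mink (D2 (cone_graph R) u X Y) (\<eta> u) = - D2 R u X Y / R u + df R u Y * (snd X \<bullet> gradient u)
    + df R u X * (snd Y \<bullet> gradient u) - (R u)\<^sup>2 * normal_height u * (snd X \<bullet> snd Y)"
  unfolding D2_lift[OF D smooth_y u] D2_y[OF u] \<eta>_def mink_lift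
  by (simp add: mink.add_left mink.add_right mink.scaleR_left mink.scaleR_right power2_eq_square)

lemma pseudo_umbilical_graph:
  assumes u: "u \<in> D"
  shows "pseudo_umbilical_at (cone_graph R) u \<longleftrightarrow>
    (\<exists>k b. (real DIM('e) - 2) * b = 2 * (real DIM('e) - 1) * k \<and>
       (\<forall>X Y. - D2 R u X Y / R u + df R u Y * (snd X \<bullet> gradient u)
           + df R u X * (snd Y \<bullet> gradient u) - (R u)\<^sup>2 * normal_height u * (snd X \<bullet> snd Y)
         = b * fst X * fst Y + k * (R u)\<^sup>2 * (snd X \<bullet> snd Y)))"
proof -
  interpret cone_line_hypersurface_at "cone_graph R" D u "\<eta> u" "real DIM('e)"
    by (rule graph_hypersurface[OF u])
  show ?thesis
    unfolding pseudo_umbilical_at_cone_line second_form_eta[OF u] metric_graph[OF u] df_lift[OF smooth_y u] lift_simps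
    by (simp add: algebra_simps)
qed

text \<open>The coordinate fields, divided by \<open>R\<close> in the directions of the horosphere, are an orthonormal frame,
  so the trace in the definition of \<open>H\<close> is a smooth expression in \<open>R\<close> and its derivatives.\<close>

lemma smooth_mean_curvature_graph: "smooth_on D (mean_curvature (cone_graph R))"
proof -
  let ?A = "\<lambda>u X. mink (D2 (cone_graph R) u X X) (\<eta> u)"
  let ?H = "\<lambda>u. (1 / real DIM('e)) *\<^sub>R ((real DIM('e) - 1) *\<^sub>R \<eta> u -
      (?A u (1, 0) + (\<Sum>b\<in>Basis. ?A u (0, b) / (R u)\<^sup>2)) *\<^sub>R theta (cone_graph R) u)"
  have "mean_curvature (cone_graph R) u = ?H u" if u: "u \<in> D" for u
  proof -
    interpret cone_line_hypersurface_at "cone_graph R" D u "\<eta> u" "real DIM('e)"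
      by (rule graph_hypersurface[OF u])
    have Ru: "R u > 0" using R(2)[OF u] .
    let ?e = "\<lambda>b::'v. (0::real, (1 / R u) *\<^sub>R b)"
    let ?B = "insert (1, 0) (?e ` Basis)"
    have inj: "inj_on ?e Basis" using Ru by (auto simp: inj_on_def)
    have nin: "(1, 0) \<notin> ?e ` Basis" by auto
    have "card ?B = DIM(real \<times> 'v)"
      using nin by (simp add: card_image[OF inj])
    moreover have "\<forall>X\<in>?B. \<forall>Y\<in>?B. g X Y = (if X = Y then 1 else 0)"
      using Ru by (auto simp: metric_graph[OF u] inner_Basis power2_eq_square)
    ultimately have B: "orthonormal_frame (cone_graph R) u ?B"
      by (simp add: orthonormal_frame_def)
    have bil: "bilinear (D2 (cone_graph R) u)" by (rule D2_bilinear[OF D(1) smooth_cone_graph u])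
    have "?A u (?e b) = ?A u (0, b) / (R u)\<^sup>2" for b
    proof -
      have e: "?e b = (1 / R u) *\<^sub>R (0, b)" by simp
      show ?thesis unfolding e
        by (simp only: bilinear_lmul[OF bil] bilinear_rmul[OF bil] mink.scaleR_left)
           (simp add: power2_eq_square)
    qed
    then have "(\<Sum>E\<in>?B. ?A u E) = ?A u (1, 0) + (\<Sum>b\<in>Basis. ?A u (0, b) / (R u)\<^sup>2)"
      using nin by (simp add: sum.reindex[OF inj])
    then show ?thesis unfolding mean_curvature_formula[OF B] by simp
  qed
  moreover have "smooth_on D ?H"
    unfolding theta_def
    by (intro smooth_intros D smooth_eta smooth_cone_graph R) (use R(2) in force)
  ultimately show ?thesis using smooth_on_cong[OF D, of ?H] by simp
qed

end

context horosphere
begin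

text \<open>The parameters of a graph chart are the functions \<open>graph_coord\<close> of the ambient point. The transition
  map \<open>h\<close> is therefore \<open>graph_coord \<circ> \<phi> \<circ> x\<close>, and no inverse of an immersion has to be differentiated.\<close>

lemma graph_chart_transition:
  assumes dim_e: "DIM('e) = DIM('v) + 1"
    and x0: "graph_chart M \<phi> D0 x0 R" and x: "local_param M \<phi> D x"
    and u: "u \<in> D" "x u = x0 d" "d \<in> D0"
  shows "\<exists>N h. reparametrization (cone_graph R) (\<phi> \<circ> x) h D0 N u \<and> h u = d \<and> N \<subseteq> D \<and>
    (\<forall>u'\<in>N. x u' = x0 (h u'))"
proof -
  have x0': "local_param M \<phi> D0 x0" and R: "smooth_on D0 R" "\<And>d. d \<in> D0 \<Longrightarrow> R d > 0"
    and \<phi>: "\<And>d. d \<in> D0 \<Longrightarrow> \<phi> (x0 d) = cone_graph R d"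
    using x0 by (auto simp: graph_chart_def)
  have cD: "open D" "smooth_on D (\<phi> \<circ> x)" and inj: "inj (df (\<phi> \<circ> x) u)"
    and D0: "open D0" "openin (top_of_set M) (x0 ` D0)"
    using x x0' u(1) by (auto simp: local_param_def)
  obtain y where y: "homeomorphism D (x ` D) x y" using x by (auto simp: local_param_def)
  interpret horosphere_graph w J R D0
    by unfold_locales (use R D0 dim_e in auto)
  define N where "N = D \<inter> x -` (x0 ` D0)"
  define h where "h = (\<lambda>u. graph_coord (\<phi> (x u)))"
  have "openin (top_of_set D) N"
    unfolding N_def
    by (rule continuous_openin_preimage[OF homeomorphism_cont1[OF y] _ D0(2)])
       (use local_param_subset[OF x] in auto)
  then have N: "open N" "N \<subseteq> D" using openin_open_eq[OF cD(1)] by auto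
  have key: "h u' = d'" "radius (base (\<phi> (x u'))) = R d'" if "x u' = x0 d'" "d' \<in> D0" for u' d'
    using that \<phi>[of d'] R(2)[of d'] by (auto simp: h_def graph_coord_cone_graph radius_hor)
  have key': "h u' \<in> D0 \<and> x u' = x0 (h u') \<and> radius (base (\<phi> (x u'))) \<noteq> 0" if u': "u' \<in> N" for u'
  proof -
    obtain d' where d': "x u' = x0 d'" "d' \<in> D0" using u' by (auto simp: N_def)
    show ?thesis using key[OF d'] d' R(2)[OF d'(2)] by simp
  qed
  have sN: "smooth_on N (\<lambda>u. \<phi> (x u))" using smooth_on_subset[OF cD(2) N(2)] by (simp add: o_def)
  have "smooth_on N h"
    unfolding h_def by (intro smooth_intros sN N) (use key' in blast)
  moreover have "u \<in> N" using u by (auto simp: N_def)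
  ultimately have "reparametrization (cone_graph R) (\<phi> \<circ> x) h D0 N u"
    using key' \<phi> D0 N inj smooth_cone_graph spacelike_graph
    by unfold_locales auto
  then show ?thesis using key(1)[OF u(2,3)] N(2) key' by blast
qed

end

section \<open>Pseudo-umbilicity as a pointwise condition\<close>

text \<open>Weingarten's equation, from differentiating \<open>\<langle>\<zeta>, F\<^sub>* Y\<rangle> = 0\<close>. It needs \<open>\<zeta>\<close> to be differentiable, which for
  \<open>\<zeta> = H\<close> is the reason why the smoothness of \<open>H\<close> has to be established.\<close>

lemma shape_operator_metric:
  assumes D: "open D" "smooth_on D F" and \<zeta>: "smooth_on D \<zeta>" "\<And>u. u \<in> D \<Longrightarrow> \<zeta> u \<in> normal_vectors F u"
    and u: "u \<in> D" and sp: "spacelike_immersion_at F u"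
  shows "induced_metric F u (shape_operator F \<zeta> u X) Y = mink (\<zeta> u) (D2 F u X Y)"
proof -
  interpret spacelike_immersion_at F u by (rule sp)
  have 1: "((\<lambda>u. mink (\<zeta> u) (df F u Y)) has_derivative
      (\<lambda>X. mink (\<zeta> u) (D2 F u X Y) + mink (df \<zeta> u X) (df F u Y))) (at u)"
    by (rule mink.FDERIV[OF smooth_on_has_derivative[OF \<zeta>(1) u] smooth_on_has_derivative[OF smooth_on_df[OF D(2)] u]])
  have 2: "((\<lambda>u. mink (\<zeta> u) (df F u Y)) has_derivative (\<lambda>X. 0)) (at u)"
    by (rule has_derivative_transform_within_open[OF has_derivative_const[of 0] D(1) u])
       (use \<zeta>(2) in \<open>auto simp: normal_vectors_def\<close>)
  have "mink (\<zeta> u) (D2 F u X Y) + mink (df \<zeta> u X) (df F u Y) = 0"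
    by (rule fun_cong[OF has_derivative_unique[OF 1 2], of X])
  moreover have "df F u (shape_operator F \<zeta> u X) = - df F u (tangential_part F u (df \<zeta> u X))"
    unfolding shape_operator_def by (rule linear_neg[OF lin])
  ultimately show ?thesis
    by (simp add: induced_metric_def mink.minus_left mink_tangential_part)
qed

text \<open>The parameter \<open>V\<close> fixes the factor \<open>'v\<close> of the chart type.\<close>

locale cone_line_manifold =
  fixes M :: "'p::topological_space set" and \<phi> :: "'p \<Rightarrow> real \<times> 'e::euclidean_space \<times> real"
    and V :: "'v::euclidean_space itself"
  assumes dim_e: "DIM('e) = DIM('v) + 1"
    and riem: "riemannian_submanifold TYPE(real \<times> 'v) M \<phi>"
    and cone: "\<phi> ` M \<subseteq> light_cone_times_line"
begin

lemma chart_smooth: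
  assumes "local_param M \<phi> (D :: (real \<times> 'v) set) x"
  shows "open D" "smooth_on D (\<phi> \<circ> x)"
  using assms by (auto simp: local_param_def)

lemma chart_spacelike:
  assumes "local_param M \<phi> (D :: (real \<times> 'v) set) x" "u \<in> D"
  shows "spacelike_immersion_at (\<phi> \<circ> x) u"
  by (rule smooth_spacelike_immersion_at[OF chart_smooth(2)[OF assms(1)] assms(2)])
     (use riem assms in \<open>auto simp: riemannian_submanifold_def\<close>)

lemma chart_cone:
  assumes "local_param M \<phi> (D :: (real \<times> 'v) set) x" "u \<in> D"
  shows "\<phi> (x u) \<in> light_cone_times_line"
  using local_param_subset[OF assms(1)] assms(2) cone by blast

text \<open>A tangent vector that leaves the graph coordinates unchanged points along the ray of the cone, so it
  is null and vanishes on a space-like submanifold. Hence the graph coordinates have an injective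
  derivative in any chart and are themselves local coordinates.\<close>

lemma graph_chart_exists:
  assumes "p \<in> M"
  shows "\<exists>w (J :: 'v \<Rightarrow> 'e) D x R u. horosphere w J \<and> horosphere.graph_chart w J M \<phi> D x R \<and>
    u \<in> D \<and> x u = p"
proof -
  obtain D :: "(real \<times> 'v) set" and x where x: "local_param M \<phi> D x" and p: "p \<in> x ` D"
    using riem assms by (auto simp: riemannian_submanifold_def)
  from p obtain u where u: "u \<in> D" "x u = p" by blast
  define F where "F = \<phi> \<circ> x"
  note D = chart_smooth[OF x, folded F_def]
  interpret sp: spacelike_immersion_at F u unfolding F_def by (rule chart_spacelike[OF x u(1)])
  have cone: "F u' \<in> light_cone_times_line" if "u' \<in> D" for u'
    using chart_cone[OF x that] by (simp add: F_def)
  define y0 where "y0 = base (F u)"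
  have y0: "fst y0 > 0" "snd y0 \<bullet> snd y0 = fst y0 * fst y0"
    using cone[OF u(1)] by (auto simp: y0_def base_def light_cone_times_line_def light_cone_def mink_def)
  \<comment> \<open>With this \<open>w\<close> the ray missed by the horosphere is opposite to the ray of the given point.\<close>
  define w where "w = (1 / fst y0) *\<^sub>R snd y0"
  have "w \<bullet> w = 1" using y0 by (simp add: w_def)
  then obtain J :: "'v \<Rightarrow> 'e" where "horosphere w J"
    using horosphere_exists[OF _ dim_e] by blast
  interpret horosphere w J by fact
  define r where "r = (\<lambda>u. radius (base (F u)))"
  define N where "N = D \<inter> r -` {0<..}"
  have "r u = fst y0 + snd y0 \<bullet> w" by (simp add: r_def radius_def y0_def)
  also have "\<dots> > 0" using y0 by (simp add: w_def)
  finally have r0: "r u > 0" .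
  have smr: "smooth_on D r" unfolding r_def by (intro smooth_intros D)
  then have N: "open N" "N \<subseteq> D" "u \<in> N"
    unfolding N_def using D(1) u(1) r0
    by (auto intro: continuous_open_preimage smooth_on_continuous)
  have smFN: "smooth_on N F" and smrN: "smooth_on N r"
    using smooth_on_subset D(2) smr N(2) by blast+
  have rN: "r u' > 0" if "u' \<in> N" for u' using that by (simp add: N_def)
  define g where "g = (\<lambda>u. graph_coord (F u))"
  have smg: "smooth_on N g"
    unfolding g_def by (intro smooth_intros N smFN) (use rN in \<open>fastforce simp: r_def\<close>)
  have rec: "F u' = lift (r u' *\<^sub>R hor (snd (g u'))) (fst (g u'))" if u': "u' \<in> N" for u'
    unfolding r_def g_def
    using rN[OF u'] by (intro graph_coord_recover cone subsetD[OF N(2) u']) (simp add: r_def)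
  have "inj (df g u)"
  proof (rule linear_injective_0[OF smooth_on_df_linear[OF smg N(3)], THEN iffD2], intro allI impI)
    fix X assume X: "df g u X = 0"
    note dg = smooth_on_has_derivative[OF smg N(3)]
    have 1: "((\<lambda>u. hor (snd (g u))) has_derivative (\<lambda>X. dhor (snd (g u)) (snd (df g u X)))) (at u)"
      using diff_chain_at[OF bounded_linear.has_derivative[OF bounded_linear_snd dg] hor_has_derivative]
      by (simp add: o_def)
    have "((\<lambda>u'. lift (r u' *\<^sub>R hor (snd (g u'))) (fst (g u'))) has_derivative
       (\<lambda>X. lift (r u *\<^sub>R dhor (snd (g u)) (snd (df g u X)) + df r u X *\<^sub>R hor (snd (g u))) (fst (df g u X)))) (at u)"
      by (intro lift_has_derivative has_derivative_scaleR 1 smooth_on_has_derivative[OF smrN N(3)]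
           bounded_linear.has_derivative[OF bounded_linear_fst dg])
    then have "(F has_derivative
       (\<lambda>X. lift (r u *\<^sub>R dhor (snd (g u)) (snd (df g u X)) + df r u X *\<^sub>R hor (snd (g u))) (fst (df g u X)))) (at u)"
      by (rule has_derivative_transform_within_open[OF _ N(1,3)]) (simp add: rec)
    from df_eqI[OF this] have "df F u X = lift (df r u X *\<^sub>R hor (snd (g u))) 0"
      by (simp add: X dhor_linear)
    then have "induced_metric F u X X = 0"
      by (simp add: induced_metric_def mink_lift mink.scaleR_left mink.scaleR_right)
    then show "X = 0" by (rule sp.g_eq_0)
  qed
  from smooth_inverse_function[OF N(1,3) smg this]
  obtain U V k where U: "open U" "U \<subseteq> N" "u \<in> U" and V: "open V" and hom: "homeomorphism U V g k"
    and k: "smooth_on V k" "\<And>v. v \<in> V \<Longrightarrow> inj (df k v)"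
    by metis
  have kU: "k v \<in> U" "g (k v) = v" if "v \<in> V" for v
    using hom that by (auto simp: homeomorphism_def)
  have "local_param M \<phi> V (x \<circ> k)"
    by (rule local_param_reparametrize[OF x U(1) _ V homeomorphism_symD[OF hom] k]) (use U N in auto)
  moreover have "smooth_on V (\<lambda>v. r (k v))"
    by (rule smooth_on_compose[OF V N(1) _ k(1) smrN]) (use kU(1) U(2) in auto)
  moreover have "r (k v) > 0 \<and> \<phi> ((x \<circ> k) v) = cone_graph (\<lambda>v. r (k v)) v" if v: "v \<in> V" for v
    using rec[of "k v"] rN[of "k v"] kU[OF v] U(2) by (auto simp: F_def)
  ultimately have "graph_chart M \<phi> V (x \<circ> k) (\<lambda>v. r (k v))"
    by (simp add: graph_chart_def)
  moreover have "g u \<in> V" "(x \<circ> k) (g u) = p"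
    using hom U(3) u(2) by (auto simp: homeomorphism_def)
  ultimately show ?thesis using \<open>horosphere w J\<close> by blast
qed

lemma transition:
  assumes "p \<in> M"
  obtains w and J :: "'v \<Rightarrow> 'e" and D0 x0 R d where "horosphere w J" 
    "horosphere.graph_chart w J M \<phi> D0 x0 R" "d \<in> D0" "x0 d = p"
    "\<forall>D x u. local_param M \<phi> D x \<and> u \<in> D \<and> x u = p \<longrightarrow>
      (\<exists>N h. reparametrization (horosphere.cone_graph w J R) (\<phi> \<circ> x) h D0 N u \<and> h u = d \<and> N \<subseteq> D \<and>
        (\<forall>u'\<in>N. x u' = x0 (h u')))"
proof -
  obtain w and J :: "'v \<Rightarrow> 'e" and D0 x0 R d where wJ: "horosphere w J" 
    and gc: "horosphere.graph_chart w J M \<phi> D0 x0 R" and d: "d \<in> D0" "x0 d = p"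
    using graph_chart_exists[OF assms] by blast
  interpret horosphere w J by (rule wJ)
  show thesis
  proof (rule that[OF wJ gc d], intro allI impI, elim conjE)
    fix D :: "(real \<times> 'v) set" and x u assume x: "local_param M \<phi> D x" "u \<in> D" "x u = p"
    show "\<exists>N h. reparametrization (cone_graph R) (\<phi> \<circ> x) h D0 N u \<and> h u = d \<and> N \<subseteq> D \<and>
        (\<forall>u'\<in>N. x u' = x0 (h u'))"
      by (rule graph_chart_transition[OF dim_e gc x(1,2) _ d(1)]) (simp add: x(3) d(2))
  qed
qed

text \<open>Two charts are compared by way of a graph chart at their common point.\<close>

lemma mean_curvature_independent:
  assumes "local_param M \<phi> (D :: (real \<times> 'v) set) x" "u \<in> D" "local_param M \<phi> (D' :: (real \<times> 'v) set) x'" "u' \<in> D'" "x u = x' u'"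
  shows "mean_curvature (\<phi> \<circ> x) u = mean_curvature (\<phi> \<circ> x') u'"
    "pseudo_umbilical_at (\<phi> \<circ> x) u \<longleftrightarrow> pseudo_umbilical_at (\<phi> \<circ> x') u'"
proof -
  have p: "x u \<in> M" using local_param_subset[OF assms(1)] assms(2) by blast
  obtain w and J :: "'v \<Rightarrow> 'e" and D0 x0 R d where "horosphere w J"
    "horosphere.graph_chart w J M \<phi> D0 x0 R" "d \<in> D0" "x0 d = x u" and
    tr: "\<forall>D z v. local_param M \<phi> D z \<and> v \<in> D \<and> z v = x u \<longrightarrow>
      (\<exists>N h. reparametrization (horosphere.cone_graph w J R) (\<phi> \<circ> z) h D0 N v \<and> h v = d \<and> N \<subseteq> D \<and>
        (\<forall>v'\<in>N. z v' = x0 (h v')))"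
    by (rule transition[OF p]) 
  obtain N h where 1: "reparametrization (horosphere.cone_graph w J R) (\<phi> \<circ> x) h D0 N u" "h u = d"
    using tr[rule_format, OF conjI[OF assms(1) conjI[OF assms(2) refl]]] by blast
  obtain N' h' where 2: "reparametrization (horosphere.cone_graph w J R) (\<phi> \<circ> x') h' D0 N' u'" "h' u' = d"
    using tr[rule_format, OF conjI[OF assms(3) conjI[OF assms(4) assms(5)[symmetric]]]] by blast
  show "mean_curvature (\<phi> \<circ> x) u = mean_curvature (\<phi> \<circ> x') u'"
    using reparametrization.mean_curvature_F[OF 1(1)] reparametrization.mean_curvature_F[OF 2(1)] 1(2) 2(2) by simp
  show "pseudo_umbilical_at (\<phi> \<circ> x) u \<longleftrightarrow> pseudo_umbilical_at (\<phi> \<circ> x') u'"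
    using reparametrization.pseudo_umbilical_at_F[OF 1(1)] reparametrization.pseudo_umbilical_at_F[OF 2(1)] 1(2) 2(2) by simp
qed

lemma mean_curvature_field_eq:
  assumes "local_param M \<phi> (D :: (real \<times> 'v) set) x" "u \<in> D"
  shows "mean_curvature_field TYPE(real \<times> 'v) M \<phi> (x u) = mean_curvature (\<phi> \<circ> x) u"
  unfolding mean_curvature_field_def
proof (rule the_equality)
  show "\<forall>(D' :: (real \<times> 'v) set) x'. \<forall>u'\<in>D'. local_param M \<phi> D' x' \<and> x' u' = x u \<longrightarrow>
        mean_curvature (\<phi> \<circ> x) u = mean_curvature (\<phi> \<circ> x') u'"
    by (intro allI ballI impI) (rule mean_curvature_independent(1)[OF assms], auto)
next
  fix h assume "\<forall>(D' :: (real \<times> 'v) set) x'. \<forall>u'\<in>D'. local_param M \<phi> D' x' \<and> x' u' = x u \<longrightarrow>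
        h = mean_curvature (\<phi> \<circ> x') u'"
  then show "h = mean_curvature (\<phi> \<circ> x) u" using assms by blast
qed

lemma smooth_mean_curvature_field:
  assumes x: "local_param M \<phi> (D :: (real \<times> 'v) set) x"
  shows "smooth_on D (mean_curvature_field TYPE(real \<times> 'v) M \<phi> \<circ> x)" (is "smooth_on D (?H \<circ> x)")
proof (rule smooth_on_local)
  fix u assume u: "u \<in> D"
  have p: "x u \<in> M" using local_param_subset[OF x] u by blast
  obtain w and J :: "'v \<Rightarrow> 'e" and D0 x0 R d where wJ: "horosphere w J" 
    and gc: "horosphere.graph_chart w J M \<phi> D0 x0 R" and dd: "d \<in> D0" "x0 d = x u"
    and tr: "\<forall>D z v. local_param M \<phi> D z \<and> v \<in> D \<and> z v = x u \<longrightarrow>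
      (\<exists>N h. reparametrization (horosphere.cone_graph w J R) (\<phi> \<circ> z) h D0 N v \<and> h v = d \<and> N \<subseteq> D \<and>
        (\<forall>v'\<in>N. z v' = x0 (h v')))"
    by (rule transition[OF p])
  interpret horosphere w J by (rule wJ)
  have gc': "local_param M \<phi> D0 x0" "open D0" "smooth_on D0 R" "\<And>d. d \<in> D0 \<Longrightarrow> R d > 0"
    using gc by (auto simp: graph_chart_def local_param_def)
  interpret G: horosphere_graph w J R D0 by unfold_locales (use gc' dim_e in auto)
  obtain N h where re: "reparametrization (cone_graph R) (\<phi> \<circ> x) h D0 N u" "N \<subseteq> D"
    and h: "\<And>v. v \<in> N \<Longrightarrow> x v = x0 (h v)"
    using tr[rule_format, OF conjI[OF x conjI[OF u refl]]] by blast
  interpret re: reparametrization "cone_graph R" "\<phi> \<circ> x" h D0 N u by (rule re)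
  have "?H (x v) = mean_curvature (cone_graph R) (h v)" if v: "v \<in> N" for v
  proof -
    have "h v \<in> D0" "v \<in> D" using re.hD v re(2) by auto
    from graph_chart_transition[OF dim_e gc x \<open>v \<in> D\<close> h[OF v] \<open>h v \<in> D0\<close>]
    obtain N' h' where "reparametrization (cone_graph R) (\<phi> \<circ> x) h' D0 N' v" "h' v = h v" by blast
    from reparametrization.mean_curvature_F[OF this(1)] this(2) mean_curvature_field_eq[OF x \<open>v \<in> D\<close>]
    show ?thesis by simp
  qed
  moreover have "smooth_on N (\<lambda>v. mean_curvature (cone_graph R) (h v))"
    by (rule smooth_on_compose[OF re.N(1) re.D(1) re.h(2,1) G.smooth_mean_curvature_graph])
  ultimately have "smooth_on N (?H \<circ> x)"
    using smooth_on_cong[OF re.N(1), of "\<lambda>v. mean_curvature (cone_graph R) (h v)" "?H \<circ> x"] by simp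
  then show "\<exists>N. open N \<and> u \<in> N \<and> smooth_on N (?H \<circ> x)" using re.N by blast
qed

text \<open>From the conditions at the points to a function on \<open>M\<close>: the factor is \<open>\<langle>H,H\<rangle>\<close>.\<close>

theorem pseudo_umbilical_iff:
  "pseudo_umbilical TYPE(real \<times> 'v) M \<phi> \<longleftrightarrow>
    (\<forall>(D :: (real \<times> 'v) set) x. local_param M \<phi> D x \<longrightarrow> (\<forall>u\<in>D. pseudo_umbilical_at (\<phi> \<circ> x) u))"
proof -
  let ?H = "mean_curvature_field TYPE(real \<times> 'v) M \<phi>"
  have shape: "induced_metric (\<phi> \<circ> x) u (shape_operator (\<phi> \<circ> x) (?H \<circ> x) u X) Y =
      mink (mean_curvature (\<phi> \<circ> x) u) (D2 (\<phi> \<circ> x) u X Y)"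
    if x: "local_param M \<phi> (D :: (real \<times> 'v) set) x" and u: "u \<in> D" for D x u X Y
  proof -
    have n: "(?H \<circ> x) u' \<in> normal_vectors (\<phi> \<circ> x) u'" if u': "u' \<in> D" for u'
      using spacelike_immersion_at.mean_curvature_normal[OF chart_spacelike[OF x u'] D2_bilinear[OF chart_smooth[OF x] u']]
      by (simp add: mean_curvature_field_eq[OF x u'])
    have "induced_metric (\<phi> \<circ> x) u (shape_operator (\<phi> \<circ> x) (?H \<circ> x) u X) Y =
      mink ((?H \<circ> x) u) (D2 (\<phi> \<circ> x) u X Y)"
      by (rule shape_operator_metric[where \<zeta> = "?H \<circ> x",
            OF chart_smooth[OF x] smooth_mean_curvature_field[OF x] n u chart_spacelike[OF x u]])
    then show ?thesis by (simp only: o_apply mean_curvature_field_eq[OF x u])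
  qed
  show ?thesis
  proof
    assume "pseudo_umbilical TYPE(real \<times> 'v) M \<phi>"
    then obtain f :: "'p \<Rightarrow> real" where f: "\<forall>(D :: (real \<times> 'v) set) x. local_param M \<phi> D x \<longrightarrow>
        smooth_on D (f \<circ> x) \<and> (\<forall>u\<in>D. \<forall>X Y.
          induced_metric (\<phi> \<circ> x) u (shape_operator (\<phi> \<circ> x) (?H \<circ> x) u X) Y =
            f (x u) * induced_metric (\<phi> \<circ> x) u X Y)"
      unfolding pseudo_umbilical_def umbilical_along_def by (elim exE)
    show "\<forall>(D :: (real \<times> 'v) set) x. local_param M \<phi> D x \<longrightarrow> (\<forall>u\<in>D. pseudo_umbilical_at (\<phi> \<circ> x) u)"
      unfolding pseudo_umbilical_at_def
    proof (intro allI impI ballI exI)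
      fix D :: "(real \<times> 'v) set" and x u X Y assume x: "local_param M \<phi> D x" and u: "u \<in> D"
      show "mink (mean_curvature (\<phi> \<circ> x) u) (D2 (\<phi> \<circ> x) u X Y) = f (x u) * induced_metric (\<phi> \<circ> x) u X Y"
        unfolding shape[OF x u, symmetric] by (rule f[rule_format, OF x, THEN conjunct2, rule_format, OF u])
    qed
  next
    assume R: "\<forall>(D :: (real \<times> 'v) set) x. local_param M \<phi> D x \<longrightarrow> (\<forall>u\<in>D. pseudo_umbilical_at (\<phi> \<circ> x) u)"
    let ?f = "\<lambda>p. mink (?H p) (?H p)"
    show "pseudo_umbilical TYPE(real \<times> 'v) M \<phi>"
      unfolding pseudo_umbilical_def umbilical_along_def
    proof (intro exI[of _ ?f] allI impI conjI ballI)
      fix D :: "(real \<times> 'v) set" and x assume x: "local_param M \<phi> D x"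
      show "smooth_on D (?f \<circ> x)"
        using smooth_on_mink[OF chart_smooth(1)[OF x] smooth_mean_curvature_field[OF x] smooth_mean_curvature_field[OF x]]
        by (simp add: o_def)
      fix u X Y assume u: "u \<in> D"
      have "\<forall>X Y. mink (mean_curvature (\<phi> \<circ> x) u) (D2 (\<phi> \<circ> x) u X Y) =
          mink (mean_curvature (\<phi> \<circ> x) u) (mean_curvature (\<phi> \<circ> x) u) * induced_metric (\<phi> \<circ> x) u X Y"
        by (rule iffD1[OF spacelike_immersion_at.pseudo_umbilical_at_iff[OF chart_spacelike[OF x u]
              D2_bilinear[OF chart_smooth[OF x] u]] R[rule_format, OF x u]])
      then show "induced_metric (\<phi> \<circ> x) u (shape_operator (\<phi> \<circ> x) (?H \<circ> x) u X) Y = ?f (x u) * induced_metric (\<phi> \<circ> x) u X Y"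
        unfolding shape[OF x u] mean_curvature_field_eq[OF x u] by (elim allE)
    qed
  qed
qed

end

section \<open>Sections of the light cone by hyperplanes\<close>

text \<open>Subtracting the multiple of \<open>y\<close> with the same time component leaves a purely spatial vector with the
  same square as \<open>v\<close>.\<close>

lemma null_orthogonal:
  assumes y: "y \<in> light_cone" and v: "mink y v = 0"
  shows "mink v v \<ge> 0" "mink v v = 0 \<Longrightarrow> v = (fst v / fst y) *\<^sub>R y"
proof -
  have y0: "fst y > 0" "snd y \<bullet> snd y = fst y * fst y" "snd y \<bullet> snd v = fst y * fst v"
    using y v by (auto simp: light_cone_def mink_def)
  then have y1: "snd v \<bullet> snd y = fst y * fst v" by (simp add: inner_commute)
  let ?r = "snd v - (fst v / fst y) *\<^sub>R snd y"
  have eq: "mink v v = ?r \<bullet> ?r"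
    using y0 y1 by (simp add: mink_def inner_diff_left inner_diff_right field_simps)
  then show "mink v v \<ge> 0" by simp
  assume "mink v v = 0"
  then have "?r = 0" using eq by simp
  then show "v = (fst v / fst y) *\<^sub>R y" using y0(1) by (simp add: prod_eq_iff)
qed

locale cone_section_immersion =
  fixes f :: "'v::euclidean_space \<Rightarrow> real \<times> 'e::euclidean_space" and D and a :: "real \<times> 'e" and \<tau> :: real
  assumes D: "open D" and f: "smooth_on D f" "\<And>u. u \<in> D \<Longrightarrow> f u \<in> cone_section a \<tau>"
    and \<tau>: "\<tau> \<noteq> 0" and inj: "\<And>u. u \<in> D \<Longrightarrow> inj (df f u)"
begin

lemma f_cone: "u \<in> D \<Longrightarrow> f u \<in> light_cone" "u \<in> D \<Longrightarrow> mink (f u) (f u) = 0" "u \<in> D \<Longrightarrow> mink (f u) a = \<tau>"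
  using f(2) by (auto simp: cone_section_def light_cone_def)

lemma df_orthogonal:
  assumes "u \<in> D" shows "mink (f u) (df f u X) = 0" "mink (df f u X) a = 0"
proof -
  note d = smooth_on_has_derivative[OF f(1) assms]
  have 1: "((\<lambda>u. mink (f u) (f u)) has_derivative (\<lambda>X. mink (f u) (df f u X) + mink (df f u X) (f u))) (at u)"
    by (rule mink.FDERIV[OF d d])
  have 2: "((\<lambda>u. mink (f u) (f u)) has_derivative (\<lambda>X. 0)) (at u)"
    by (rule has_derivative_transform_within_open[OF has_derivative_const[of 0] D assms]) (simp add: f_cone)
  from fun_cong[OF has_derivative_unique[OF 1 2], of X] show "mink (f u) (df f u X) = 0"
    by (simp add: mink_commute)
  have 1: "((\<lambda>u. mink (f u) a) has_derivative (\<lambda>X. mink (f u) 0 + mink (df f u X) a)) (at u)"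
    by (rule mink.FDERIV[OF d has_derivative_const])
  have 2: "((\<lambda>u. mink (f u) a) has_derivative (\<lambda>X. 0)) (at u)"
    by (rule has_derivative_transform_within_open[OF has_derivative_const[of \<tau>] D assms]) (simp add: f_cone)
  from fun_cong[OF has_derivative_unique[OF 1 2], of X] show "mink (df f u X) a = 0"
    by (simp add: mink.zero_right)
qed

lemma D2_pairing:
  assumes "u \<in> D" shows "mink (f u) (D2 f u X Y) = - induced_metric f u X Y" "mink (D2 f u X Y) a = 0"
proof -
  note d = smooth_on_has_derivative[OF f(1) assms] and d2 = smooth_on_has_derivative[OF smooth_on_df[OF f(1)] assms, of Y]
  have 1: "((\<lambda>u. mink (f u) (df f u Y)) has_derivative (\<lambda>X. mink (f u) (D2 f u X Y) + mink (df f u X) (df f u Y))) (at u)"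
    by (rule mink.FDERIV[OF d d2])
  have 2: "((\<lambda>u. mink (f u) (df f u Y)) has_derivative (\<lambda>X. 0)) (at u)"
    by (rule has_derivative_transform_within_open[OF has_derivative_const[of 0] D assms]) (simp add: df_orthogonal)
  from fun_cong[OF has_derivative_unique[OF 1 2], of X] show "mink (f u) (D2 f u X Y) = - induced_metric f u X Y"
    by (simp add: induced_metric_def)
  have 1: "((\<lambda>u. mink (df f u Y) a) has_derivative (\<lambda>X. mink (df f u Y) 0 + mink (D2 f u X Y) a)) (at u)"
    by (rule mink.FDERIV[OF d2 has_derivative_const])
  have 2: "((\<lambda>u. mink (df f u Y) a) has_derivative (\<lambda>X. 0)) (at u)"
    by (rule has_derivative_transform_within_open[OF has_derivative_const[of 0] D assms]) (simp add: df_orthogonal)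
  from fun_cong[OF has_derivative_unique[OF 1 2], of X] show "mink (D2 f u X Y) a = 0"
    by (simp add: mink.zero_right)
qed

text \<open>A null tangent vector of the light cone is a multiple \<open>\<lambda> f\<close>; being orthogonal to \<open>a\<close> it satisfies
  \<open>\<lambda> \<tau> = 0\<close>.\<close>

lemma spacelike_section:
  assumes u: "u \<in> D" and X: "X \<noteq> 0"
  shows "induced_metric f u X X > 0"
proof -
  note n = null_orthogonal[OF f_cone(1)[OF u] df_orthogonal(1)[OF u, of X]]
  have "df f u X \<noteq> 0"
    using inj[OF u] X linear_injective_0[OF smooth_on_df_linear[OF f(1) u]] by blast
  moreover have "df f u X = 0" if "mink (df f u X) (df f u X) = 0"
  proof -
    let ?l = "fst (df f u X) / fst (f u)"
    have l: "df f u X = ?l *\<^sub>R f u" by (rule n(2)[OF that])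
    have "mink (df f u X) a = ?l * \<tau>"
      by (subst l) (simp only: mink.scaleR_left f_cone(3)[OF u] real_scaleR_def)
    then have "?l = 0" using df_orthogonal(2)[OF u, of X] \<tau> by simp
    then show ?thesis by (subst l) (simp only: scaleR_zero_left)
  qed
  ultimately show ?thesis using n(1) unfolding induced_metric_def by fastforce
qed

lemma spacelike: "u \<in> D \<Longrightarrow> spacelike_immersion_at f u"
  by (rule smooth_spacelike_immersion_at[OF f(1) _ spacelike_section])

text \<open>The normal space is spanned by \<open>f\<close> itself, along which the immersion is umbilical, and by the
  constant vector \<open>a\<close>, whose shape operator vanishes.\<close>

lemma normal_D2:
  assumes u: "u \<in> D" and dim: "DIM('v) + 1 = DIM('e)" and \<zeta>: "\<zeta> \<in> normal_vectors f u"
  shows "mink \<zeta> (D2 f u X Y) =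
    - ((mink \<zeta> a - mink a a * mink \<zeta> (f u) / \<tau>) / \<tau>) * induced_metric f u X Y"
proof -
  interpret spacelike_immersion_at f u by (rule spacelike[OF u])
  have n: "f u \<in> normal_vectors f u" "a \<in> normal_vectors f u"
    using df_orthogonal[OF u] by (auto simp: normal_vectors_def mink_commute)
  have "mink (f u) a \<noteq> 0" using f_cone(3)[OF u] \<tau> by simp
  then obtain Z p q where z: "\<zeta> = df f u Z + p *\<^sub>R f u + q *\<^sub>R a"
    using codim2_decomposition[OF dim n f_cone(2)[OF u], of \<zeta>] by blast
  have af: "mink a (f u) = \<tau>" using f_cone(3)[OF u] by (simp add: mink_commute)
  have aD: "mink a (D2 f u X Y) = 0" using D2_pairing(2)[OF u] by (simp add: mink_commute)
  have "0 = mink \<zeta> (df f u Z)" using \<zeta> by (simp add: normal_vectors_def)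
  also have "\<dots> = g Z Z"
    using n by (simp add: z mink.add_left mink.scaleR_left induced_metric_def normal_vectors_def)
  finally have "Z = 0" using g_eq_0 by simp
  then have z: "\<zeta> = p *\<^sub>R f u + q *\<^sub>R a" using z linear_0[OF lin] by simp
  have "mink \<zeta> (f u) = q * \<tau>" "mink \<zeta> a = p * \<tau> + q * mink a a"
    using f_cone[OF u] af by (simp_all add: z mink.add_left mink.scaleR_left)
  then have "p = (mink \<zeta> a - mink a a * mink \<zeta> (f u) / \<tau>) / \<tau>" using \<tau> by simp
  moreover have "mink \<zeta> (D2 f u X Y) = - p * g X Y"
    using D2_pairing[OF u] aD by (simp add: z mink.add_left mink.scaleR_left)
  ultimately show ?thesis by simp
qed

end

lemma cone_section_chart:
  assumes "local_param Mh (\<lambda>y. y) D x" "Mh \<subseteq> cone_section a \<tau>" "\<tau> \<noteq> 0"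
  shows "cone_section_immersion x D a \<tau>"
  using assms local_param_subset[OF assms(1)]
  unfolding local_param_def by unfold_locales (auto simp: o_def)

lemma riemannian_cone_section:
  assumes "Mh \<subseteq> cone_section a \<tau>" "\<tau> \<noteq> 0"
    and "\<And>p. p \<in> Mh \<Longrightarrow> \<exists>(D :: 'v::euclidean_space set) x. local_param Mh (\<lambda>y. y) D x \<and> p \<in> x ` D"
  shows "riemannian_submanifold TYPE('v) Mh (\<lambda>y. y)"
  unfolding riemannian_submanifold_def
  using assms(3) cone_section_immersion.spacelike_section[OF cone_section_chart[OF _ assms(1,2)]]
  by (auto simp: o_def)

lemma totally_umbilical_cone_section:
  fixes Mh :: "(real \<times> 'e::euclidean_space) set"
  assumes Mh: "Mh \<subseteq> cone_section a \<tau>" "\<tau> \<noteq> 0" and dim: "DIM('v::euclidean_space) + 1 = DIM('e)"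
  shows "totally_umbilical TYPE('v) Mh (\<lambda>y. y)"
  unfolding totally_umbilical_def umbilical_along_def
proof (intro allI impI)
  fix \<zeta> assume n: "normal_field TYPE('v) Mh (\<lambda>y. y) \<zeta>"
  let ?f = "\<lambda>y. - ((mink (\<zeta> y) a - mink a a * mink (\<zeta> y) y / \<tau>) / \<tau>)"
  show "\<exists>f. \<forall>(D :: 'v set) x. local_param Mh (\<lambda>y. y) D x \<longrightarrow> smooth_on D (f \<circ> x) \<and>
       (\<forall>u\<in>D. \<forall>X Y. induced_metric ((\<lambda>y. y) \<circ> x) u (shape_operator ((\<lambda>y. y) \<circ> x) (\<zeta> \<circ> x) u X) Y
         = f (x u) * induced_metric ((\<lambda>y. y) \<circ> x) u X Y)"
  proof (intro exI[of _ ?f] allI impI conjI ballI)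
    fix D :: "'v set" and x assume x: "local_param Mh (\<lambda>y. y) D x"
    interpret cone_section_immersion x D a \<tau> by (rule cone_section_chart[OF x Mh])
    have sm: "smooth_on D (\<lambda>u. \<zeta> (x u))" and nv: "\<And>u. u \<in> D \<Longrightarrow> \<zeta> (x u) \<in> normal_vectors x u"
      using n x by (auto simp: normal_field_def o_def)
    show "smooth_on D (?f \<circ> x)"
      unfolding o_def by (intro smooth_intros sm D f) (use \<tau> in auto)
    fix u X Y assume u: "u \<in> D"
    have "induced_metric x u (shape_operator x (\<lambda>u. \<zeta> (x u)) u X) Y = mink (\<zeta> (x u)) (D2 x u X Y)"
      by (rule shape_operator_metric[OF D f(1) sm nv u spacelike[OF u]])
    then show "induced_metric ((\<lambda>y. y) \<circ> x) u (shape_operator ((\<lambda>y. y) \<circ> x) (\<zeta> \<circ> x) u X) Y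
         = ?f (x u) * induced_metric ((\<lambda>y. y) \<circ> x) u X Y"
      by (simp add: o_def normal_D2[OF u dim nv[OF u]])
  qed
qed

text \<open>The sign of the scalar is chosen to make the level positive, its size to make the square \<open>0\<close> or
  \<open>\<plusminus>1\<close>; the last equation records how the curvature constant survives the scaling.\<close>

lemma normalize_level:
  fixes a0 :: "real \<times> 'e::real_inner"
  assumes "mink a0 a0 = - 2 * \<kappa>" "\<And>y. y \<in> S \<Longrightarrow> mink y a0 = -1" "S \<noteq> {}"
  shows "\<exists>a c \<tau>. a \<noteq> 0 \<and> mink a a = c \<and> c \<in> {1, -1, 0} \<and> 0 < \<tau> \<and> (\<forall>y\<in>S. mink y a = \<tau>) \<and>
    c = - 2 * \<kappa> * \<tau>\<^sup>2"
proof -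
  define \<tau> where "\<tau> = (if \<kappa> = 0 then 1 else 1 / sqrt (2 * \<bar>\<kappa>\<bar>))"
  let ?a = "(- \<tau>) *\<^sub>R a0"
  have \<tau>: "\<tau> > 0" by (simp add: \<tau>_def)
  have "mink ?a ?a = - 2 * \<kappa> * \<tau>\<^sup>2"
    by (simp add: mink.scaleR_left mink.scaleR_right assms(1) power2_eq_square mink.minus_left mink.minus_right)
  moreover have "- 2 * \<kappa> * \<tau>\<^sup>2 \<in> {1, -1, 0}"
    by (auto simp: \<tau>_def power_divide abs_if)
  moreover have l: "\<forall>y\<in>S. mink y ?a = \<tau>"
    by (simp add: mink.scaleR_right assms(2) mink.minus_right)
  moreover have "?a \<noteq> 0" using l assms(3) \<tau> mink.zero_right by (metis all_not_in_conv less_irrefl)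
  ultimately show ?thesis using \<tau> by blast
qed

text \<open>For the graph \<open>\<rho> hor\<close> put \<open>v = 1/\<rho>\<close>, so that \<open>G = - grad v\<close>. The hypothesis on \<open>G\<close> says that the Hessian
  of \<open>v\<close> is \<open>K\<close> times the identity. Then \<open>K\<close> is constant and \<open>v\<close> a quadratic polynomial with leading part
  \<open>K |t|\<^sup>2 / 2\<close>; equivalently, \<open>v\<close> is the product of \<open>hor\<close> with a constant vector, up to sign. That vector is
  \<open>v \<nu> + dhor G + K hor\<close>.\<close>

lemma (in horosphere) horosphere_graph_in_hyperplane:
  assumes T: "convex T"
    and \<rho>: "\<And>t. t \<in> T \<Longrightarrow> (\<rho> has_derivative (\<lambda>v. (\<rho> t)\<^sup>2 * (G t \<bullet> v))) (at t)" "\<And>t. t \<in> T \<Longrightarrow> \<rho> t > 0"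
    and G: "\<And>t. t \<in> T \<Longrightarrow> (G has_derivative (\<lambda>v. - (\<rho> t * (\<kappa> + (G t \<bullet> G t) / 2)) *\<^sub>R v)) (at t)"
  shows "\<exists>a0. mink a0 a0 = - 2 * \<kappa> \<and> (\<forall>t\<in>T. mink (\<rho> t *\<^sub>R hor t) a0 = -1)"
proof (cases "T = {}")
  case True
  have "mink (\<kappa> *\<^sub>R hor 0 + \<nu>) (\<kappa> *\<^sub>R hor 0 + \<nu>) = - 2 * \<kappa>"
    by (simp add: mink.add_left mink.add_right mink.scaleR_left mink.scaleR_right)
  with True show ?thesis by blast
next
  case False
  then obtain t0 where t0: "t0 \<in> T" by auto
  define K where "K t = \<rho> t * (\<kappa> + (G t \<bullet> G t) / 2)" for t
  define A where "A t = (1 / \<rho> t) *\<^sub>R \<nu> + dhor t (G t) + K t *\<^sub>R hor t" for t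
  have "(A has_derivative (\<lambda>v. 0)) (at t)" if t: "t \<in> T" for t
  proof -
    have p: "\<rho> t > 0" by (rule \<rho>(2)[OF t])
    note dG = G[OF t, folded K_def]
    have 1: "((\<lambda>t. 1 / \<rho> t) has_derivative (\<lambda>v. - (G t \<bullet> v))) (at t)"
      using p by (auto intro!: derivative_eq_intros \<rho>(1)[OF t] simp: power2_eq_square field_simps)
    have 2: "(K has_derivative (\<lambda>v. 0)) (at t)"
      unfolding K_def[abs_def]
      by (rule has_derivative_eq_rhs, (rule derivative_intros \<rho>(1)[OF t] dG)+)
         (auto simp: fun_eq_iff K_def power2_eq_square field_simps inner_commute)
    have 3: "((\<lambda>t. dhor t (G t)) has_derivative (\<lambda>v. (v \<bullet> G t) *\<^sub>R \<nu> - K t *\<^sub>R dhor t v)) (at t)"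
      unfolding dhor_def
      by (rule has_derivative_eq_rhs, (rule derivative_intros dG bounded_linear.has_derivative[OF bounded_linear_J])+)
         (auto simp: fun_eq_iff \<nu>_def linear_scale[OF J(1)] linear_neg[OF J(1)] algebra_simps inner_commute)
    show ?thesis
      unfolding A_def[abs_def]
      by (rule has_derivative_eq_rhs, (rule derivative_intros 1 2 3 hor_has_derivative)+)
         (auto simp: fun_eq_iff inner_commute algebra_simps)
  qed
  then have "\<And>t. t \<in> T \<Longrightarrow> (A has_derivative (\<lambda>v. 0)) (at t within T)"
    using has_derivative_at_withinI by blast
  from has_derivative_zero_constant[OF T this] obtain c where "\<And>t. t \<in> T \<Longrightarrow> A t = c" by blast
  then have A: "A t = A t0" if "t \<in> T" for t using that t0 by simp
  have "mink (A t0) (A t0) = - 2 * \<kappa>"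
    using \<rho>(2)[OF t0]
    by (simp add: A_def K_def mink.add_left mink.add_right mink.scaleR_left mink.scaleR_right field_simps)
  moreover have "mink (\<rho> t *\<^sub>R hor t) (A t0) = -1" if t: "t \<in> T" for t
    unfolding A[OF t, symmetric] using \<rho>(2)[OF t]
    by (simp add: A_def mink.add_left mink.add_right mink.scaleR_left mink.scaleR_right)
  ultimately show ?thesis by blast
qed

section \<open>Integrating the pseudo-umbilical equation\<close>

lemma inner_ext:
  fixes x y :: "'a::real_inner"
  assumes "\<And>w. x \<bullet> w = y \<bullet> w" shows "x = y"
  using assms vector_eq_rdot by blast

context horosphere_graph
begin

lemma gradient_inner: "u \<in> D \<Longrightarrow> df R u (0, v) = (R u)\<^sup>2 * (gradient u \<bullet> v)"
  by (simp add: df_R_split)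

lemma df_gradient:
  assumes u: "u \<in> D"
  shows "D2 R u X (0, v) = 2 * R u * df R u X * (gradient u \<bullet> v) + (R u)\<^sup>2 * (df gradient u X \<bullet> v)"
proof -
  have "((\<lambda>u. (R u)\<^sup>2 * (gradient u \<bullet> v)) has_derivative
      (\<lambda>X. 2 * R u * df R u X * (gradient u \<bullet> v) + (R u)\<^sup>2 * (df gradient u X \<bullet> v))) (at u)"
    by (rule has_derivative_eq_rhs, (rule derivative_intros smooth_on_has_derivative[OF R(1) u]
          smooth_on_has_derivative[OF smooth_gradient u])+)
       (simp add: fun_eq_iff algebra_simps)
  then have "((\<lambda>u. df R u (0, v)) has_derivative
      (\<lambda>X. 2 * R u * df R u X * (gradient u \<bullet> v) + (R u)\<^sup>2 * (df gradient u X \<bullet> v))) (at u)"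
    by (rule has_derivative_transform_within_open[OF _ D u]) (simp add: gradient_inner)
  from df_eqI[OF this] show ?thesis by simp
qed

text \<open>The criterion for \<open>A\<^sub>\<eta>\<close>, evaluated on pairs of coordinate directions. The pairs tangent to the
  horosphere are rewritten in terms of \<open>gradient\<close>, whose derivative absorbs the products of first
  derivatives of \<open>R\<close>.\<close>

lemma pseudo_umbilical_graph_gradient:
  assumes u: "u \<in> D" and pu: "pseudo_umbilical_at (cone_graph R) u"
  obtains k b where "(real DIM('e) - 2) * b = 2 * (real DIM('e) - 1) * k"
    "D2 R u (1, 0) (1, 0) = - R u * b"
    "\<forall>v. R u * D2 R u (1, 0) (0, v) = df R u (1, 0) * df R u (0, v)"
    "\<forall>v. df gradient u (0, v) = - (R u * (k + normal_height u)) *\<^sub>R v"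
proof -
  have Ru: "R u > 0" by (rule R(2)[OF u])
  obtain k b where kb: "(real DIM('e) - 2) * b = 2 * (real DIM('e) - 1) * k"
    and A: "\<forall>X Y. - D2 R u X Y / R u + df R u Y * (snd X \<bullet> gradient u)
           + df R u X * (snd Y \<bullet> gradient u) - (R u)\<^sup>2 * normal_height u * (snd X \<bullet> snd Y)
         = b * fst X * fst Y + k * (R u)\<^sup>2 * (snd X \<bullet> snd Y)"
    using pu unfolding pseudo_umbilical_graph[OF u] by (elim exE conjE) (rule that)
  have 1: "D2 R u (1, 0) (1, 0) = - R u * b"
    using A[THEN spec, of "(1, 0)", THEN spec, of "(1, 0)"] Ru by (simp add: field_simps)
  have 2: "R u * D2 R u (1, 0) (0, v) = df R u (1, 0) * df R u (0, v)" for v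
    using A[THEN spec, of "(1, 0)", THEN spec, of "(0, v)"] Ru
    by (simp add: gradient_inner[OF u] inner_commute field_simps power2_eq_square)
  have 3: "df gradient u (0, v) = - (R u * (k + normal_height u)) *\<^sub>R v" for v
  proof (rule inner_ext)
    fix w
    have "R u * (R u * (- (df gradient u (0, v) \<bullet> w))) = R u * (R u * (R u * (k + normal_height u) * (v \<bullet> w)))"
      using A[THEN spec, of "(0, v)", THEN spec, of "(0, w)"] Ru
      unfolding df_gradient[OF u] gradient_inner[OF u]
      by (simp add: inner_commute field_simps power2_eq_square)
    then have "- (df gradient u (0, v) \<bullet> w) = R u * (k + normal_height u) * (v \<bullet> w)"
      using Ru by (metis mult_cancel_left less_irrefl)
    then show "df gradient u (0, v) \<bullet> w = (- (R u * (k + normal_height u)) *\<^sub>R v) \<bullet> w" by simp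
  qed
  show thesis by (rule that[OF kb 1]) (use 2 3 in auto)
qed

end

lemma slice_left_has_derivative:
  assumes "(f has_derivative f') (at (s, t))"
  shows "((\<lambda>s. f (s, t)) has_derivative (\<lambda>h. f' (h, 0))) (at s)"
proof -
  have "((\<lambda>s. (s, t)) has_derivative (\<lambda>h. (h, 0))) (at s)"
    by (intro has_derivative_Pair has_derivative_ident has_derivative_const)
  from diff_chain_at[OF this assms] show ?thesis by (simp add: o_def)
qed

lemma slice_right_has_derivative:
  assumes "(f has_derivative f') (at (s, t))"
  shows "((\<lambda>t. f (s, t)) has_derivative (\<lambda>h. f' (0, h))) (at t)"
proof -
  have "((\<lambda>t. (s, t)) has_derivative (\<lambda>h. (0, h))) (at t)"
    by (intro has_derivative_Pair has_derivative_ident has_derivative_const)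
  from diff_chain_at[OF this assms] show ?thesis by (simp add: o_def)
qed

lemma slice_left_has_field_derivative:
  fixes f :: "real \<times> 'v::real_normed_vector \<Rightarrow> real"
  assumes "(f has_derivative f') (at (s, t))"
  shows "((\<lambda>s. f (s, t)) has_field_derivative f' (1, 0)) (at s)"
proof -
  have l: "linear f'" using assms by (rule has_derivative_linear)
  have "f' (h, 0) = f' (1, 0) * h" for h
    using linear_scale[OF l, of h "(1, 0)"] by simp
  then have "(\<lambda>h. f' (h, 0)) = (*) (f' (1, 0))" by (rule ext)
  then show ?thesis
    using slice_left_has_derivative[OF assms] unfolding has_field_derivative_def by (simp only:)
qed

lemma convex_constant:
  fixes f :: "'a::real_normed_vector \<Rightarrow> 'b::real_normed_vector"
  assumes "convex S" "\<And>x. x \<in> S \<Longrightarrow> (f has_derivative (\<lambda>h. 0)) (at x)" "x \<in> S" "y \<in> S"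
  shows "f x = f y"
proof -
  have "\<And>x. x \<in> S \<Longrightarrow> (f has_derivative (\<lambda>h. 0)) (at x within S)"
    using assms(2) has_derivative_at_withinI by blast
  from has_derivative_zero_constant[OF assms(1) this] obtain c where "\<And>x. x \<in> S \<Longrightarrow> f x = c" by blast
  with assms(3,4) show ?thesis by simp
qed

locale pseudo_umbilical_graph = horosphere_graph w J R D
  for w :: "'e::euclidean_space" and J :: "'v::euclidean_space \<Rightarrow> 'e" and R D +
  fixes I T s0 t0
  assumes pu: "\<And>u. u \<in> D \<Longrightarrow> pseudo_umbilical_at (cone_graph R) u"
    and box: "I \<times> T \<subseteq> D" "open I" "convex I" "open T" "convex T" "s0 \<in> I" "t0 \<in> T"
begin

lemma in_D: "s \<in> I \<Longrightarrow> t \<in> T \<Longrightarrow> (s, t) \<in> D" using box(1) by auto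
lemma dR: "s \<in> I \<Longrightarrow> t \<in> T \<Longrightarrow> (R has_derivative df R (s, t)) (at (s, t))"
  using smooth_on_has_derivative[OF R(1) in_D] .
lemma pos: "s \<in> I \<Longrightarrow> t \<in> T \<Longrightarrow> R (s, t) > 0" using R(2)[OF in_D] .

definition \<alpha> :: "real \<Rightarrow> real" where "\<alpha> s = R (s, t0) / R (s0, t0)"
definition \<rho> :: "'v \<Rightarrow> real" where "\<rho> t = R (s0, t)"

lemma \<rho>_pos: "t \<in> T \<Longrightarrow> \<rho> t > 0" using pos box(6) by (simp add: \<rho>_def)
lemma \<alpha>_pos: "s \<in> I \<Longrightarrow> \<alpha> s > 0" using pos box(6,7) by (simp add: \<alpha>_def)
lemma \<alpha>_s0: "\<alpha> s0 = 1" using pos[OF box(6,7)] by (simp add: \<alpha>_def)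

text \<open>The mixed equation \<open>R R\<^sub>s\<^sub>v = R\<^sub>s R\<^sub>v\<close> is the vanishing of the derivative of \<open>R\<^sub>v / R\<close> in the variable \<open>s\<close>.\<close>

lemma log_gradient_independent:
  assumes s: "s \<in> I" and t: "t \<in> T"
  shows "df R (s, t) (0, v) / R (s, t) = df R (s0, t) (0, v) / R (s0, t)"
proof (rule convex_constant[OF box(3) _ s box(6)])
  fix s assume s: "s \<in> I"
  let ?u = "(s, t)"
  have u: "?u \<in> D" by (rule in_D[OF s t])
  obtain k b where "(real DIM('e) - 2) * b = 2 * (real DIM('e) - 1) * k"
    and "D2 R ?u (1, 0) (1, 0) = - R ?u * b"
    and mixed: "\<forall>v. R ?u * D2 R ?u (1, 0) (0, v) = df R ?u (1, 0) * df R ?u (0, v)"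
    and "\<forall>v. df gradient ?u (0, v) = - (R ?u * (k + normal_height ?u)) *\<^sub>R v"
    by (rule pseudo_umbilical_graph_gradient[OF u pu[OF u]])
  have l: "linear (\<lambda>X. D2 R ?u X (0, v))" "linear (df R ?u)"
    using has_derivative_linear[OF smooth_on_has_derivative[OF smooth_on_df[OF R(1)] u]] linear_R[OF u] .
  have 1: "D2 R ?u (h, 0) (0, v) = h * D2 R ?u (1, 0) (0, v)" for h
    using linear_scale[OF l(1), of h "(1, 0)"] by simp
  have 2: "df R ?u (h, 0) = h * df R ?u (1, 0)" for h
    using linear_scale[OF l(2), of h "(1, 0)"] by simp
  note d1 = slice_left_has_derivative[OF smooth_on_has_derivative[OF smooth_on_df[OF R(1)] u]]
  note d2 = slice_left_has_derivative[OF dR[OF s t]]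
  have p: "R ?u \<noteq> 0" using pos[OF s t] by simp
  have m: "D2 R ?u (1, 0) (0, v) = df R ?u (1, 0) * df R ?u (0, v) / R ?u"
    using mixed[rule_format, of v] p by (simp add: field_simps)
  have z: "- df R ?u (0, v) * (inverse (R ?u) * df R ?u (h, 0) * inverse (R ?u)) + D2 R ?u (h, 0) (0, v) / R ?u = 0" for h
    unfolding 1[of h] 2[of h] m by (simp add: divide_inverse algebra_simps)
  show "((\<lambda>s. df R (s, t) (0, v) / R (s, t)) has_derivative (\<lambda>h. 0)) (at s)"
    by (rule has_derivative_eq_rhs[OF has_derivative_divide[OF d1 d2 p]], rule ext, rule z)
qed

lemma separated:
  assumes s: "s \<in> I" and t: "t \<in> T"
  shows "R (s, t) = \<alpha> s * \<rho> t"
proof -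
  have "R (s, t) / R (s0, t) = R (s, t0) / R (s0, t0)"
  proof (rule convex_constant[OF box(5) _ t box(7)])
    fix t assume t: "t \<in> T"
    note d1 = slice_right_has_derivative[OF dR[OF s t]]
    note d2 = slice_right_has_derivative[OF dR[OF box(6) t]]
    have p: "R (s0, t) \<noteq> 0" "R (s, t) \<noteq> 0" using pos[OF box(6) t] pos[OF s t] by auto
    have e: "df R (s, t) (0, v) = df R (s0, t) (0, v) / R (s0, t) * R (s, t)" for v
      using log_gradient_independent[OF s t, of v] p(2) by (metis nonzero_divide_eq_eq)
    have "- R (s, t) * (inverse (R (s0, t)) * df R (s0, t) (0, v) * inverse (R (s0, t))) + df R (s, t) (0, v) / R (s0, t) = 0" for v
      unfolding e divide_inverse by (simp add: algebra_simps)
    then show "((\<lambda>t. R (s, t) / R (s0, t)) has_derivative (\<lambda>h. 0)) (at t)"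
      using has_derivative_divide[OF d1 d2 p(1)] by simp
  qed
  then show ?thesis using pos[OF box(6) t] by (simp add: \<alpha>_def \<rho>_def field_simps)
qed

definition "\<alpha>1 s = df R (s, t0) (1, 0) / R (s0, t0)"
definition "\<alpha>2 s = D2 R (s, t0) (1, 0) (1, 0) / R (s0, t0)"

lemma \<alpha>_derivative: "s \<in> I \<Longrightarrow> (\<alpha> has_field_derivative \<alpha>1 s) (at s)"
  unfolding \<alpha>_def[abs_def] \<alpha>1_def
  by (intro DERIV_cdivide slice_left_has_field_derivative dR box)

lemma \<alpha>1_derivative: "s \<in> I \<Longrightarrow> (\<alpha>1 has_field_derivative \<alpha>2 s) (at s)"
  unfolding \<alpha>1_def[abs_def] \<alpha>2_def
  by (intro DERIV_cdivide slice_left_has_field_derivative[of "\<lambda>u. df R u (1, 0)"]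
      smooth_on_has_derivative[OF smooth_on_df[OF R(1)] in_D] box)

lemma smooth_\<alpha>: "smooth_on I \<alpha>"
  unfolding \<alpha>_def[abs_def]
  by (intro smooth_intros box smooth_on_compose[OF box(2) D _ _ R(1)])
     (use in_D box pos[OF box(6,7)] in auto)

lemma deriv_\<alpha>:
  assumes s: "s \<in> I" shows "deriv \<alpha> s = \<alpha>1 s" "deriv (deriv \<alpha>) s = \<alpha>2 s"
proof -
  show d: "deriv \<alpha> s = \<alpha>1 s" by (rule DERIV_imp_deriv[OF \<alpha>_derivative[OF s]])
  have "(deriv \<alpha> has_field_derivative \<alpha>2 s) (at s)"
    by (rule has_field_derivative_transform_within_open[OF \<alpha>1_derivative[OF s] box(2) s])
       (simp add: DERIV_imp_deriv[OF \<alpha>_derivative])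
  then show "deriv (deriv \<alpha>) s = \<alpha>2 s" by (rule DERIV_imp_deriv)
qed

lemma speed_eq:
  assumes s: "s \<in> I" and t: "t \<in> T" 
  shows "speed (s, t) = \<alpha>1 s / \<alpha> s"
proof -
  have 1: "((\<lambda>s. R (s, t)) has_field_derivative df R (s, t) (1, 0)) (at s)"
    by (rule slice_left_has_field_derivative[OF dR[OF s t]])
  have "((\<lambda>s. \<alpha> s * \<rho> t) has_field_derivative \<alpha>1 s * \<rho> t) (at s)"
    by (rule DERIV_cmult_right[OF \<alpha>_derivative[OF s]])
  then have 2: "((\<lambda>s. R (s, t)) has_field_derivative \<alpha>1 s * \<rho> t) (at s)"
    by (rule has_field_derivative_transform_within_open[OF _ box(2) s]) (simp add: separated t)
  have "df R (s, t) (1, 0) = \<alpha>1 s * \<rho> t" by (rule DERIV_unique[OF 1 2])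
  then show ?thesis using \<rho>_pos[OF t] by (simp add: speed_def separated[OF s t])
qed

lemma second_derivative_eq:
  assumes s: "s \<in> I" and t: "t \<in> T" 
  shows "D2 R (s, t) (1, 0) (1, 0) = \<alpha>2 s * \<rho> t"
proof -
  have 1: "((\<lambda>s. df R (s, t) (1, 0)) has_field_derivative D2 R (s, t) (1, 0) (1, 0)) (at s)"
    by (rule slice_left_has_field_derivative[OF smooth_on_has_derivative[OF smooth_on_df[OF R(1)] in_D[OF s t]]])
  have e: "df R (s, t) (1, 0) = \<alpha>1 s * \<rho> t" if "s \<in> I" for s
    using speed_eq[OF that t] \<rho>_pos[OF t] \<alpha>_pos[OF that]
    by (simp add: speed_def separated[OF that t] field_simps)
  have "((\<lambda>s. \<alpha>1 s * \<rho> t) has_field_derivative \<alpha>2 s * \<rho> t) (at s)"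
    by (rule DERIV_cmult_right[OF \<alpha>1_derivative[OF s]])
  then have 2: "((\<lambda>s. df R (s, t) (1, 0)) has_field_derivative \<alpha>2 s * \<rho> t) (at s)"
    by (rule has_field_derivative_transform_within_open[OF _ box(2) s]) (simp add: e)
  show ?thesis by (rule DERIV_unique[OF 1 2])
qed

abbreviation G where "G t \<equiv> gradient (s0, t)"

lemma gradient_eq:
  assumes s: "s \<in> I" and t: "t \<in> T" 
  shows "gradient (s, t) = (1 / \<alpha> s) *\<^sub>R G t"
proof (rule inner_ext)
  fix v
  have "df R (s, t) (0, v) / R (s, t) = df R (s0, t) (0, v) / R (s0, t)"
    by (rule log_gradient_independent[OF s t])
  then have "R (s, t) * (gradient (s, t) \<bullet> v) = R (s0, t) * (G t \<bullet> v)"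
    using pos[OF s t] pos[OF box(6) t]
    by (simp add: gradient_inner in_D s t box power2_eq_square)
  then show "gradient (s, t) \<bullet> v = ((1 / \<alpha> s) *\<^sub>R G t) \<bullet> v"
    using \<alpha>_pos[OF s] \<rho>_pos[OF t] by (simp add: separated s t box \<alpha>_s0 field_simps)
qed

text \<open>\<open>k s\<close> is the value that the relation \<open>(n-2) b = 2 (n-1) k\<close> assigns to \<open>b = -\<alpha>''/\<alpha>\<close>.\<close>

definition "k s = (real DIM('e) - 2) * (- \<alpha>2 s / \<alpha> s) / (2 * (real DIM('e) - 1))"
definition "\<kappa> = k s0 + (\<alpha>1 s0)\<^sup>2 / 2"

text \<open>The equation for \<open>gradient\<close> on the slice through \<open>s\<close>, transported to the slice through \<open>s0\<close>. As the
  left-hand side does not involve \<open>s\<close>, neither does \<open>\<alpha>\<^sup>2 k + (\<alpha>')\<^sup>2 / 2\<close>.\<close>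

lemma G_derivative:
  assumes s: "s \<in> I" and t: "t \<in> T" 
  shows "(G has_derivative (\<lambda>v. - (\<rho> t * ((\<alpha> s)\<^sup>2 * k s + (\<alpha>1 s)\<^sup>2 / 2 + (G t \<bullet> G t) / 2)) *\<^sub>R v)) (at t)"
proof -
  let ?u = "(s, t)"
  have u: "?u \<in> D" by (rule in_D[OF s t])
  obtain k' b where kb: "(real DIM('e) - 2) * b = 2 * (real DIM('e) - 1) * k'"
    and b: "D2 R ?u (1, 0) (1, 0) = - R ?u * b"
    and "\<forall>v. R ?u * D2 R ?u (1, 0) (0, v) = df R ?u (1, 0) * df R ?u (0, v)"
    and dg: "\<forall>v. df gradient ?u (0, v) = - (R ?u * (k' + normal_height ?u)) *\<^sub>R v"
    by (rule pseudo_umbilical_graph_gradient[OF u pu[OF u]])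
  have a: "\<alpha> s > 0" by (rule \<alpha>_pos[OF s])
  have "\<rho> t * (\<alpha>2 s + b * \<alpha> s) = 0"
    using b by (simp add: second_derivative_eq s t separated algebra_simps)
  then have "\<alpha>2 s + b * \<alpha> s = 0" using \<rho>_pos[OF t] by simp
  then have "b = - \<alpha>2 s / \<alpha> s" using a by (simp add: field_simps)
  moreover have "2 * (real DIM('e) - 1) \<noteq> 0" using dim_e by simp
  then have "k' = (real DIM('e) - 2) * b / (2 * (real DIM('e) - 1))"
    by (rule nonzero_eq_divide_eq[THEN iffD2]) (use kb in \<open>simp only: mult.commute\<close>)
  ultimately have k': "k' = k s" by (simp only: k_def)
  have h: "normal_height ?u = ((\<alpha>1 s)\<^sup>2 / 2 + (G t \<bullet> G t) / 2) / (\<alpha> s)\<^sup>2"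
    using a by (simp add: normal_height_def speed_eq gradient_eq s t field_simps power2_eq_square)
  have "((\<lambda>t. \<alpha> s *\<^sub>R gradient (s, t)) has_derivative (\<lambda>v. \<alpha> s *\<^sub>R df gradient ?u (0, v))) (at t)"
    by (intro has_derivative_scaleR_right slice_right_has_derivative smooth_on_has_derivative[OF smooth_gradient u])
  then have "(G has_derivative (\<lambda>v. \<alpha> s *\<^sub>R df gradient ?u (0, v))) (at t)"
    by (rule has_derivative_transform_within_open[OF _ box(4) t]) (use a in \<open>simp add: gradient_eq s\<close>)
  moreover have "\<alpha> s * (R ?u * (k' + normal_height ?u)) =
      \<rho> t * ((\<alpha> s)\<^sup>2 * k s + (\<alpha>1 s)\<^sup>2 / 2 + (G t \<bullet> G t) / 2)"
    using a unfolding h k' separated[OF s t] by (simp add: field_simps power2_eq_square)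
  ultimately show ?thesis by (simp add: dg[rule_format])
qed

lemma \<kappa>_eq:
  assumes s: "s \<in> I" shows "(\<alpha> s)\<^sup>2 * k s + (\<alpha>1 s)\<^sup>2 / 2 = \<kappa>"
proof -
  obtain v :: 'v where v: "v \<noteq> 0" using nonempty_Basis nonzero_Basis by blast
  from has_derivative_unique[OF G_derivative[OF s box(7)] G_derivative[OF box(6,7)]]
  have "- (\<rho> t0 * ((\<alpha> s)\<^sup>2 * k s + (\<alpha>1 s)\<^sup>2 / 2 + (G t0 \<bullet> G t0) / 2)) *\<^sub>R v =
     - (\<rho> t0 * ((\<alpha> s0)\<^sup>2 * k s0 + (\<alpha>1 s0)\<^sup>2 / 2 + (G t0 \<bullet> G t0) / 2)) *\<^sub>R v"
    by (rule fun_cong)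
  then show ?thesis using v \<rho>_pos[OF box(7)] by (simp add: \<kappa>_def \<alpha>_s0)
qed

text \<open>The invariance of \<open>\<kappa>\<close> is the differential equation in disguise: substitute the definition of \<open>k\<close>.\<close>

lemma profile_ode:
  assumes s: "s \<in> I" and c: "c = - 2 * \<kappa> * \<tau>\<^sup>2"
  shows "(real DIM('e) - 2) * \<tau>\<^sup>2 * \<alpha> s * deriv (deriv \<alpha>) s
    - (real DIM('e) - 1) * (c + \<tau>\<^sup>2 * (deriv \<alpha> s)\<^sup>2) = 0"
proof -
  have n: "real DIM('e) - 1 > 0" using dim_e by simp
  have "2 * (real DIM('e) - 1) * ((\<alpha> s)\<^sup>2 * k s) = - (real DIM('e) - 2) * \<alpha>2 s * \<alpha> s"
    using n \<alpha>_pos[OF s] by (simp add: k_def power2_eq_square) (simp add: algebra_simps)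
  moreover have P: "(\<alpha> s)\<^sup>2 * k s = \<kappa> - (\<alpha>1 s)\<^sup>2 / 2" using \<kappa>_eq[OF s] by simp
  ultimately have "2 * (real DIM('e) - 1) * (\<kappa> - (\<alpha>1 s)\<^sup>2 / 2) = - (real DIM('e) - 2) * \<alpha>2 s * \<alpha> s"
    by (simp only:)
  then have "(real DIM('e) - 2) * \<alpha>2 s * \<alpha> s = (real DIM('e) - 1) * ((\<alpha>1 s)\<^sup>2 - 2 * \<kappa>)"
    by (simp add: field_simps)
  then have "\<tau>\<^sup>2 * ((real DIM('e) - 2) * \<alpha>2 s * \<alpha> s) = \<tau>\<^sup>2 * ((real DIM('e) - 1) * ((\<alpha>1 s)\<^sup>2 - 2 * \<kappa>))"
    by simp
  then show ?thesis unfolding c deriv_\<alpha>[OF s] by (simp add: algebra_simps)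
qed

definition \<gamma> :: "'v \<Rightarrow> real \<times> 'e" where "\<gamma> t = \<rho> t *\<^sub>R hor t"

lemma smooth_\<rho>: "smooth_on T \<rho>"
  unfolding \<rho>_def[abs_def]
  by (rule smooth_on_compose[OF box(4) D _ _ R(1)])
     (use in_D box in \<open>auto intro!: smooth_intros\<close>)

lemma smooth_\<gamma>: "smooth_on T \<gamma>"
  unfolding \<gamma>_def[abs_def] by (intro smooth_intros smooth_\<rho> box)

lemma \<gamma>_cone: "t \<in> T \<Longrightarrow> \<gamma> t \<in> light_cone"
  using \<rho>_pos hor_pos by (simp add: \<gamma>_def light_cone_def mink.scaleR_left mink.scaleR_right)

lemma \<gamma>_in_hyperplane: "\<exists>a0. mink a0 a0 = - 2 * \<kappa> \<and> (\<forall>t\<in>T. mink (\<gamma> t) a0 = -1)"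
  unfolding \<gamma>_def
proof (rule horosphere_graph_in_hyperplane[OF box(5), where G = G])
  fix t assume t: "t \<in> T"
  show "(\<rho> has_derivative (\<lambda>v. (\<rho> t)\<^sup>2 * (G t \<bullet> v))) (at t)"
    using slice_right_has_derivative[OF dR[OF box(6) t]]
    by (simp add: gradient_inner in_D box t \<rho>_def[abs_def])
  show "\<rho> t > 0" by (rule \<rho>_pos[OF t])
  show "(G has_derivative (\<lambda>v. - (\<rho> t * (\<kappa> + (G t \<bullet> G t) / 2)) *\<^sub>R v)) (at t)"
    using G_derivative[OF box(6) t] unfolding \<kappa>_eq[OF box(6)] .
qed

lemma \<gamma>_chart: "local_param (\<gamma> ` T) (\<lambda>y. y) T \<gamma>"
  unfolding local_param_def
proof (intro conjI ballI)
  show "open T" "openin (top_of_set (\<gamma> ` T)) (\<gamma> ` T)" using box by auto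
  have r: "radius (\<gamma> t) = \<rho> t" "horo_coord (\<gamma> t) = t" if "t \<in> T" for t
    using \<rho>_pos[OF that] by (simp_all add: \<gamma>_def radius_hor horo_coord_hor)
  have "continuous_on (\<gamma> ` T) horo_coord"
    unfolding horo_coord_def[abs_def] 
    by (intro continuous_intros linear_continuous_on_compose[OF _ adjoint_J_linear])
       (use r \<rho>_pos in \<open>fastforce simp: radius_def intro!: continuous_intros\<close>)+
  then have "homeomorphism T (\<gamma> ` T) \<gamma> horo_coord"
    using smooth_on_continuous[OF smooth_\<gamma>] r by (auto simp: homeomorphism_def image_image)
  then show "\<exists>y. homeomorphism T (\<gamma> ` T) \<gamma> y" by blast
  show "smooth_on T ((\<lambda>y. y) \<circ> \<gamma>)" using smooth_\<gamma> by (simp add: o_def)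
  fix t assume t: "t \<in> T"
  have "(\<gamma> has_derivative (\<lambda>v. \<rho> t *\<^sub>R dhor t v + df \<rho> t v *\<^sub>R hor t)) (at t)"
    unfolding \<gamma>_def[abs_def]
    by (intro has_derivative_scaleR hor_has_derivative smooth_on_has_derivative[OF smooth_\<rho> t])
  note e = df_eqI[OF this]
  have "inj (df \<gamma> t)"
  proof (rule linear_injective_0[OF smooth_on_df_linear[OF smooth_\<gamma> t], THEN iffD2], intro allI impI)
    fix v assume "df \<gamma> t v = 0"
    then have 0: "\<rho> t *\<^sub>R dhor t v + df \<rho> t v *\<^sub>R hor t = 0" by (simp add: e)
    have "\<rho> t * (v \<bullet> v) = mink (\<rho> t *\<^sub>R dhor t v + df \<rho> t v *\<^sub>R hor t) (dhor t v)"
      by (simp add: mink.add_left mink.scaleR_left)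
    also have "\<dots> = 0" unfolding 0 by (rule mink.zero_left)
    finally show "v = 0" using \<rho>_pos[OF t] by simp
  qed
  then show "inj (df ((\<lambda>y. y) \<circ> \<gamma>) t)" by (simp add: o_def)
qed

end

section \<open>Warped products over sections of the light cone\<close>

lemma smooth_deriv:
  fixes f :: "real \<Rightarrow> real"
  assumes "smooth_on I f" "open I"
  shows "s \<in> I \<Longrightarrow> (f has_field_derivative deriv f s) (at s)" "smooth_on I (deriv f)"
proof -
  have d: "(f has_field_derivative df f s 1) (at s)" if "s \<in> I" for s
  proof -
    have "df f s h = df f s 1 * h" for h
      using linear_scale[OF smooth_on_df_linear[OF assms(1) that], of h 1] by simp
    then have "df f s = (*) (df f s 1)" by (rule ext)
    then show ?thesis
      using smooth_on_has_derivative[OF assms(1) that] unfolding has_field_derivative_def by simp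
  qed
  then show "s \<in> I \<Longrightarrow> (f has_field_derivative deriv f s) (at s)"
    using DERIV_imp_deriv by metis
  show "smooth_on I (deriv f)"
    by (rule smooth_on_cong[OF assms(2) _ smooth_on_df[OF assms(1), of 1]])
       (use DERIV_imp_deriv[OF d] in auto)
qed

locale warped_section = cone_section_immersion \<gamma> T a \<tau>
  for \<gamma> :: "'v::euclidean_space \<Rightarrow> real \<times> 'e::euclidean_space" and T a \<tau> +
  fixes I :: "real set" and \<alpha> :: "real \<Rightarrow> real"
  assumes dim_e: "DIM('e) = DIM('v) + 1" and I: "open I" and \<alpha>: "smooth_on I \<alpha>" "\<And>s. s \<in> I \<Longrightarrow> \<alpha> s > 0"
begin

abbreviation "Y \<equiv> \<lambda>u. \<alpha> (fst u) *\<^sub>R \<gamma> (snd u)"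
abbreviation "F \<equiv> \<lambda>u. lift (Y u) (fst u)"

lemma open_box: "open (I \<times> T)" by (intro open_Times I D)

lemma smooth_Y: "smooth_on (I \<times> T) Y"
  by (intro smooth_intros open_box smooth_on_compose[OF open_box I _ _ \<alpha>(1)]
      smooth_on_compose[OF open_box D _ _ f(1)]) auto

lemma smooth_F: "smooth_on (I \<times> T) F"
  by (intro smooth_intros smooth_Y open_box)

lemma Y_factors:
  assumes "u \<in> I \<times> T"
  shows "((\<lambda>u. \<alpha> (fst u)) has_derivative (\<lambda>X. deriv \<alpha> (fst u) * fst X)) (at u)"
    "((\<lambda>u. deriv \<alpha> (fst u)) has_derivative (\<lambda>X. deriv (deriv \<alpha>) (fst u) * fst X)) (at u)"
    "((\<lambda>u. \<gamma> (snd u)) has_derivative (\<lambda>X. df \<gamma> (snd u) (snd X))) (at u)"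
    "((\<lambda>u. df \<gamma> (snd u) v) has_derivative (\<lambda>X. D2 \<gamma> (snd u) (snd X) v)) (at u)"
proof -
  have s: "fst u \<in> I" and t: "snd u \<in> T" using assms by auto
  have d2: "(deriv \<alpha> has_field_derivative deriv (deriv \<alpha>) (fst u)) (at (fst u))"
    by (rule smooth_deriv(1)[OF smooth_deriv(2)[OF \<alpha>(1) I] I s])
  have snd: "(snd has_derivative snd) (at u)"
    by (rule bounded_linear_imp_has_derivative[OF bounded_linear_snd])
  show "((\<lambda>u. \<alpha> (fst u)) has_derivative (\<lambda>X. deriv \<alpha> (fst u) * fst X)) (at u)"
    using diff_chain_at[OF fst_has_derivative smooth_deriv(1)[OF \<alpha>(1) I s, unfolded has_field_derivative_def]]
    by (simp add: o_def)
  show "((\<lambda>u. deriv \<alpha> (fst u)) has_derivative (\<lambda>X. deriv (deriv \<alpha>) (fst u) * fst X)) (at u)"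
    using diff_chain_at[OF fst_has_derivative d2[unfolded has_field_derivative_def]]
    by (simp add: o_def)
  show "((\<lambda>u. \<gamma> (snd u)) has_derivative (\<lambda>X. df \<gamma> (snd u) (snd X))) (at u)"
    using diff_chain_at[OF snd smooth_on_has_derivative[OF f(1) t]] by (simp add: o_def)
  show "((\<lambda>u. df \<gamma> (snd u) v) has_derivative (\<lambda>X. D2 \<gamma> (snd u) (snd X) v)) (at u)"
    using diff_chain_at[OF snd smooth_on_has_derivative[OF smooth_on_df[OF f(1)] t]] by (simp add: o_def)
qed

lemma df_Y:
  assumes "u \<in> I \<times> T"
  shows "df Y u = (\<lambda>X. (deriv \<alpha> (fst u) * fst X) *\<^sub>R \<gamma> (snd u) + \<alpha> (fst u) *\<^sub>R df \<gamma> (snd u) (snd X))"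
  by (intro df_eqI has_derivative_eq_rhs[OF has_derivative_scaleR[OF Y_factors(1,3)[OF assms]]]) 
     (simp add: add.commute)

lemma D2_Y:
  assumes u: "u \<in> I \<times> T"
  shows "D2 Y u X Z = (deriv (deriv \<alpha>) (fst u) * fst X * fst Z) *\<^sub>R \<gamma> (snd u)
    + (deriv \<alpha> (fst u) * fst Z) *\<^sub>R df \<gamma> (snd u) (snd X)
    + (deriv \<alpha> (fst u) * fst X) *\<^sub>R df \<gamma> (snd u) (snd Z) + \<alpha> (fst u) *\<^sub>R D2 \<gamma> (snd u) (snd X) (snd Z)"
proof -
  have "((\<lambda>u. (deriv \<alpha> (fst u) * fst Z) *\<^sub>R \<gamma> (snd u) + \<alpha> (fst u) *\<^sub>R df \<gamma> (snd u) (snd Z)) has_derivative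
     (\<lambda>X. ((deriv \<alpha> (fst u) * fst Z) *\<^sub>R df \<gamma> (snd u) (snd X) + (deriv (deriv \<alpha>) (fst u) * fst X * fst Z) *\<^sub>R \<gamma> (snd u))
       + (\<alpha> (fst u) *\<^sub>R D2 \<gamma> (snd u) (snd X) (snd Z) + (deriv \<alpha> (fst u) * fst X) *\<^sub>R df \<gamma> (snd u) (snd Z)))) (at u)"
    by (intro has_derivative_add has_derivative_scaleR Y_factors[OF u] has_derivative_mult_left)
  then have "((\<lambda>u. df Y u Z) has_derivative
     (\<lambda>X. ((deriv \<alpha> (fst u) * fst Z) *\<^sub>R df \<gamma> (snd u) (snd X) + (deriv (deriv \<alpha>) (fst u) * fst X * fst Z) *\<^sub>R \<gamma> (snd u))
       + (\<alpha> (fst u) *\<^sub>R D2 \<gamma> (snd u) (snd X) (snd Z) + (deriv \<alpha> (fst u) * fst X) *\<^sub>R df \<gamma> (snd u) (snd Z)))) (at u)"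
    by (rule has_derivative_transform_within_open[OF _ open_box u]) (simp only: df_Y)
  from df_eqI[OF this] show ?thesis by simp
qed

lemma metric_F:
  assumes u: "u \<in> I \<times> T"
  shows "induced_metric F u X Z = fst X * fst Z + (\<alpha> (fst u))\<^sup>2 * induced_metric \<gamma> (snd u) (snd X) (snd Z)"
proof -
  have t: "snd u \<in> T" using u by auto
  have "mink (df \<gamma> (snd u) v) (\<gamma> (snd u)) = 0" for v
    using df_orthogonal(1)[OF t] by (simp add: mink_commute)
  then show ?thesis
    unfolding induced_metric_def df_lift[OF smooth_Y u] mink_lift df_Y[OF u]
    using df_orthogonal[OF t] f_cone[OF t] 
    by (simp add: mink.add_left mink.add_right mink.scaleR_left mink.scaleR_right power2_eq_square)
qed

lemma spacelike_F:
  assumes u: "u \<in> I \<times> T" and X: "X \<noteq> 0"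
  shows "induced_metric F u X X > 0"
proof -
  have t: "snd u \<in> T" and a: "\<alpha> (fst u) > 0" using u \<alpha>(2) by auto
  interpret s: spacelike_immersion_at \<gamma> "snd u" by (rule spacelike[OF t])
  have "fst X \<noteq> 0 \<or> snd X \<noteq> 0" using X by (auto simp: prod_eq_iff)
  moreover have "fst X * fst X \<ge> 0" by simp
  moreover have "(\<alpha> (fst u))\<^sup>2 * induced_metric \<gamma> (snd u) (snd X) (snd X) \<ge> 0"
    using s.pos[of "snd X"] by (cases "snd X = 0") (auto simp: s.g_bilinear)
  moreover have "fst X \<noteq> 0 \<Longrightarrow> fst X * fst X > 0" by (auto simp: zero_less_mult_iff linorder_neq_iff)
  moreover have "snd X \<noteq> 0 \<Longrightarrow> (\<alpha> (fst u))\<^sup>2 * induced_metric \<gamma> (snd u) (snd X) (snd X) > 0"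
    using s.pos[of "snd X"] a by simp
  ultimately show ?thesis unfolding metric_F[OF u] by linarith
qed

text \<open>The vector \<open>- a/\<tau> + (c/2\<tau>\<^sup>2) \<gamma>\<close> is the null normal of \<open>\<gamma>\<close> whose product with \<open>\<gamma>\<close> is \<open>-1\<close>; dividing it
  by \<open>\<alpha>\<close> and correcting for the tangent vector in the direction \<open>s\<close> gives the second null normal of \<open>F\<close>.
  The eigenvalues of \<open>A\<^sub>\<eta>\<close> are \<open>b = -\<alpha>''/\<alpha>\<close> and \<open>k = - (c/\<tau>\<^sup>2 + (\<alpha>')\<^sup>2) / 2\<alpha>\<^sup>2\<close>, and the differential equation
  is the relation between them.\<close>

lemma pseudo_umbilical_F:
  assumes u: "u \<in> I \<times> T" and c: "c = mink a a"
    and ode: "(real DIM('e) - 2) * \<tau>\<^sup>2 * \<alpha> (fst u) * deriv (deriv \<alpha>) (fst u)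
      - (real DIM('e) - 1) * (c + \<tau>\<^sup>2 * (deriv \<alpha> (fst u))\<^sup>2) = 0"
  shows "pseudo_umbilical_at F u"
proof -
  define A where "A = \<alpha> (fst u)"
  define A1 where "A1 = deriv \<alpha> (fst u)"
  define A2 where "A2 = deriv (deriv \<alpha>) (fst u)"
  define y where "y = \<gamma> (snd u)"
  have t: "snd u \<in> T" and A: "A > 0" using u \<alpha>(2) by (auto simp: A_def)
  have yy: "mink y y = 0" "mink y a = \<tau>" "mink a y = \<tau>"
    using f_cone[OF t] by (simp_all add: y_def mink_commute)
  have dy: "mink y (df \<gamma> (snd u) v) = 0" "mink a (df \<gamma> (snd u) v) = 0"
    "mink (df \<gamma> (snd u) v) y = 0" "mink (df \<gamma> (snd u) v) a = 0" for v
    using df_orthogonal[OF t] by (simp_all add: y_def mink_commute)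
  have Dy: "mink (D2 \<gamma> (snd u) v v') y = - induced_metric \<gamma> (snd u) v v'" "mink (D2 \<gamma> (snd u) v v') a = 0" for v v'
    using D2_pairing[OF t] by (simp_all add: y_def mink_commute)
  define \<eta>h where "\<eta>h = (- 1 / \<tau>) *\<^sub>R a + (c / (2 * \<tau>\<^sup>2)) *\<^sub>R y"
  define \<eta> where "\<eta> = lift ((1 / A) *\<^sub>R \<eta>h + ((A1 / A)\<^sup>2 / 2 * A) *\<^sub>R y) (A1 / A)"
  have h: "mink \<eta>h y = -1" "mink y \<eta>h = -1" "mink \<eta>h \<eta>h = 0"
    using \<tau> by (simp_all add: \<eta>h_def mink.add_left mink.add_right mink.scaleR_left mink.scaleR_right
        mink.minus_left mink.minus_right
        mink.diff_left mink.diff_right yy c[symmetric]) (simp_all add: power2_eq_square field_simps)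
  have hd: "mink \<eta>h (df \<gamma> (snd u) v) = 0" "mink (df \<gamma> (snd u) v) \<eta>h = 0" for v
    by (simp_all add: \<eta>h_def mink.add_left mink.add_right mink.scaleR_left mink.scaleR_right mink.minus_left mink.minus_right
        mink.diff_left mink.diff_right dy)
  have hD: "mink (D2 \<gamma> (snd u) v v') \<eta>h = - (c / (2 * \<tau>\<^sup>2)) * induced_metric \<gamma> (snd u) v v'" for v v'
    by (simp add: \<eta>h_def mink.add_right mink.scaleR_right mink.minus_right mink.diff_right Dy)
  have "mink \<eta> (df F u X) = 0" for X
    unfolding df_lift[OF smooth_Y u] mink_lift df_Y[OF u] \<eta>_def A_def[symmetric] A1_def[symmetric] y_def[symmetric]
    using A by (simp add: mink.add_left mink.add_right mink.scaleR_left mink.scaleR_right h hd yy dy)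
  then have 1: "\<eta> \<in> normal_vectors F u" by (simp add: normal_vectors_def)
  have 2: "mink \<eta> \<eta> = 0"
    unfolding mink_lift \<eta>_def
    using A by (simp add: mink.add_left mink.add_right mink.scaleR_left mink.scaleR_right h yy field_simps power2_eq_square)
  have 3: "mink \<eta> (theta F u) = -1"
    unfolding theta_lift unfolding mink_lift \<eta>_def A_def[symmetric] y_def[symmetric]
    using A by (simp add: mink.add_left mink.scaleR_left mink.scaleR_right h yy)
  have cone: "F v \<in> light_cone_times_line" if "v \<in> I \<times> T" for v
    using that \<alpha>(2) f_cone(1,2)[of "snd v"]
    by (auto simp: lift_light_cone light_cone_def mink.scaleR_left mink.scaleR_right)
  interpret sp: spacelike_immersion_at F u
    by (rule smooth_spacelike_immersion_at[OF smooth_F u spacelike_F[OF u]])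
  interpret cone_line_hypersurface_at F "I \<times> T" u \<eta> "real DIM('e)"
    by unfold_locales (use 1 2 3 open_box smooth_F cone u dim_e in \<open>auto\<close>)
  have D2: "mink (D2 F u X Z) \<eta> = - A2 / A * (fst X * fst Z)
      - (c / (2 * \<tau>\<^sup>2) + A1\<^sup>2 / 2) * induced_metric \<gamma> (snd u) (snd X) (snd Z)" for X Z
    unfolding D2_lift[OF open_box smooth_Y u] mink_lift D2_Y[OF u] \<eta>_def A_def[symmetric] A1_def[symmetric]
      A2_def[symmetric] y_def[symmetric]
    using A by (simp add: mink.add_left mink.add_right mink.scaleR_left mink.scaleR_right h hd hD yy dy Dy)
       (simp add: field_simps power2_eq_square)
  define k where "k = - (c / (2 * \<tau>\<^sup>2) + A1\<^sup>2 / 2) / A\<^sup>2"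
  have "(real DIM('e) - 2) * (- A2 / A) = 2 * (real DIM('e) - 1) * k"
  proof -
    have "(real DIM('e) - 2) * \<tau>\<^sup>2 * A * A2 = (real DIM('e) - 1) * (c + \<tau>\<^sup>2 * A1\<^sup>2)"
      using ode by (simp add: A_def A1_def A2_def)
    then have "((real DIM('e) - 2) * \<tau>\<^sup>2 * A * A2) / (\<tau>\<^sup>2 * A\<^sup>2) = ((real DIM('e) - 1) * (c + \<tau>\<^sup>2 * A1\<^sup>2)) / (\<tau>\<^sup>2 * A\<^sup>2)"
      by simp
    moreover have "((real DIM('e) - 2) * \<tau>\<^sup>2 * A * A2) / (\<tau>\<^sup>2 * A\<^sup>2) = (real DIM('e) - 2) * (A2 / A)"
      using A \<tau> by (simp add: power2_eq_square)
    moreover have "((real DIM('e) - 1) * (c + \<tau>\<^sup>2 * A1\<^sup>2)) / (\<tau>\<^sup>2 * A\<^sup>2) = - (2 * (real DIM('e) - 1) * k)"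
      using A \<tau> unfolding k_def by (simp add: field_simps)
    ultimately show ?thesis by simp
  qed
  moreover have "mink (D2 F u X Z) \<eta> = k * sp.g X Z + (- A2 / A - k) * (\<sigma> X * \<sigma> Z)" for X Z
    unfolding D2 metric_F[OF u] df_lift[OF smooth_Y u] lift_simps A_def[symmetric]
    using A by (simp add: k_def field_simps)
  ultimately show ?thesis
    unfolding pseudo_umbilical_at_cone_line by blast
qed

end

section \<open>The classification\<close>

lemma (in cone_line_manifold) classification:
  "pseudo_umbilical TYPE(real \<times> 'v) M \<phi> \<longleftrightarrow>
    (\<forall>p\<in>M. \<exists>(I :: real set) (T :: 'v set) (x :: real \<times> 'v \<Rightarrow> 'p)
        (\<alpha>h :: real \<Rightarrow> real) (\<gamma> :: 'v \<Rightarrow> real \<times> 'e)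
        (Mh :: (real \<times> 'e) set) (a :: real \<times> 'e) (c :: real) (\<tau> :: real).
      open I \<and> is_interval I \<and>
      local_param M \<phi> (I \<times> T) x \<and> p \<in> x ` (I \<times> T) \<and>
      (\<forall>s\<in>I. \<forall>t\<in>T. \<phi> (x (s, t)) = (\<alpha>h s * fst (\<gamma> t), \<alpha>h s *\<^sub>R snd (\<gamma> t), s)) \<and>
      smooth_on I \<alpha>h \<and> (\<forall>s\<in>I. \<alpha>h s \<noteq> 0) \<and>
      riemannian_submanifold TYPE('v) Mh (\<lambda>y. y) \<and> Mh \<subseteq> light_cone \<and>
      local_param Mh (\<lambda>y. y) T \<gamma> \<and>
      totally_umbilical TYPE('v) Mh (\<lambda>y. y) \<and>
      a \<noteq> 0 \<and> mink a a = c \<and> c \<in> {1, -1, 0} \<and> 0 < \<tau> \<and>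
      Mh \<subseteq> cone_section a \<tau> \<and>
      (\<forall>s\<in>I. (real DIM('e) - 2) * \<tau>\<^sup>2 * \<alpha>h s * deriv (deriv \<alpha>h) s
              - (real DIM('e) - 1) * (c + \<tau>\<^sup>2 * (deriv \<alpha>h s)\<^sup>2) = 0))"
  (is "_ \<longleftrightarrow> (\<forall>p\<in>M. ?param p)")
proof
  assume pu: "pseudo_umbilical TYPE(real \<times> 'v) M \<phi>"
  show "\<forall>p\<in>M. ?param p"
  proof
    fix p assume p: "p \<in> M"
    obtain w and J :: "'v \<Rightarrow> 'e" and D x R u where wJ: "horosphere w J"
      and gc: "horosphere.graph_chart w J M \<phi> D x R" and u: "u \<in> D" "x u = p"
      using graph_chart_exists[OF p] by blast
    interpret horosphere w J by (rule wJ)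
    have x: "local_param M \<phi> D x" "open D" and R: "smooth_on D R" "\<And>u. u \<in> D \<Longrightarrow> R u > 0"
      and \<phi>: "\<And>u. u \<in> D \<Longrightarrow> \<phi> (x u) = cone_graph R u"
      using gc by (auto simp: graph_chart_def local_param_def)
    have pu_graph: "pseudo_umbilical_at (cone_graph R) v" if v: "v \<in> D" for v
    proof -
      from graph_chart_transition[OF dim_e gc x(1) v refl v] obtain N h
        where r: "reparametrization (cone_graph R) (\<phi> \<circ> x) h D N v" "h v = v" by blast
      have "pseudo_umbilical_at (\<phi> \<circ> x) v"
        using pu[unfolded pseudo_umbilical_iff] x(1) v by blast
      then show ?thesis using reparametrization.pseudo_umbilical_at_F[OF r(1)] r(2) by simp
    qed
    obtain s0 t0 where st: "u = (s0, t0)" by (cases u)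
    obtain A B where AB: "open A" "open B" "(s0, t0) \<in> A \<times> B" "A \<times> B \<subseteq> D"
      using open_prod_elim[OF x(2) u(1)] st by metis
    obtain e1 where e1: "e1 > 0" "ball s0 e1 \<subseteq> A" using AB(1,3) open_contains_ball by blast
    obtain e2 where e2: "e2 > 0" "ball t0 e2 \<subseteq> B" using AB(2,3) open_contains_ball by blast
    interpret P: pseudo_umbilical_graph w J R D "ball s0 e1" "ball t0 e2" s0 t0
      by unfold_locales (use x R dim_e pu_graph e1 e2 AB in auto)
    obtain a0 where a0: "mink a0 a0 = - 2 * P.\<kappa>" "\<And>t. t \<in> ball t0 e2 \<Longrightarrow> mink (P.\<gamma> t) a0 = -1"
      using P.\<gamma>_in_hyperplane by blast
    let ?Mh = "P.\<gamma> ` ball t0 e2"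
    have level: "mink y a0 = -1" if "y \<in> ?Mh" for y using that a0(2) by auto
    have "?Mh \<noteq> {}" using e2(1) by simp
    with level have "\<exists>a c \<tau>. a \<noteq> 0 \<and> mink a a = c \<and> c \<in> {1, -1, 0} \<and> 0 < \<tau> \<and>
        (\<forall>y\<in>?Mh. mink y a = \<tau>) \<and> c = - 2 * P.\<kappa> * \<tau>\<^sup>2"
      by (rule normalize_level[OF a0(1)])
    then obtain a c \<tau> where a: "a \<noteq> 0" "mink a a = c" "c \<in> {1, -1, 0}" "0 < \<tau>"
      "\<forall>y\<in>?Mh. mink y a = \<tau>" and c: "c = - 2 * P.\<kappa> * \<tau>\<^sup>2"
      by (elim exE conjE) (rule that)
    have Mh: "?Mh \<subseteq> light_cone" "?Mh \<subseteq> cone_section a \<tau>"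
      using P.\<gamma>_cone a(5) by (auto simp: cone_section_def)
    have \<tau>: "\<tau> \<noteq> 0" using a(4) by simp
    have "riemannian_submanifold TYPE('v) ?Mh (\<lambda>y. y)"
      by (rule riemannian_cone_section[OF Mh(2) \<tau>]) (use P.\<gamma>_chart in blast)
    moreover have "totally_umbilical TYPE('v) ?Mh (\<lambda>y. y)"
      by (rule totally_umbilical_cone_section[OF Mh(2) \<tau>]) (simp add: dim_e)
    moreover have "local_param M \<phi> (ball s0 e1 \<times> ball t0 e2) x"
      by (rule local_param_restrict[OF x(1)]) (use P.box in \<open>auto intro: open_Times\<close>)
    moreover have "p \<in> x ` (ball s0 e1 \<times> ball t0 e2)"
      using u(2) st e1(1) e2(1) by force
    moreover have "\<phi> (x (s, t)) = (P.\<alpha> s * fst (P.\<gamma> t), P.\<alpha> s *\<^sub>R snd (P.\<gamma> t), s)"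
      if "s \<in> ball s0 e1" "t \<in> ball t0 e2" for s t
      using \<phi>[OF P.in_D[OF that]] P.separated[OF that] by (simp add: lift_def P.\<gamma>_def)
    moreover have "P.\<alpha> s \<noteq> 0" if "s \<in> ball s0 e1" for s using P.\<alpha>_pos[OF that] by simp
    moreover have "is_interval (ball s0 e1)" by (simp add: is_interval_convex_1)
    ultimately show "?param p"
      using Mh a(1-4) P.smooth_\<alpha> P.\<gamma>_chart P.profile_ode[OF _ c]
      by (intro exI[of _ "ball s0 e1"] exI[of _ "ball t0 e2"] exI[of _ x] exI[of _ P.\<alpha>] exI[of _ P.\<gamma>]
          exI[of _ ?Mh] exI[of _ a] exI[of _ c] exI[of _ \<tau>]) (intro conjI ballI; (assumption | simp))
  qed
next
  assume R: "\<forall>p\<in>M. ?param p"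
  show "pseudo_umbilical TYPE(real \<times> 'v) M \<phi>"
    unfolding pseudo_umbilical_iff
  proof (intro allI impI ballI)
    fix D :: "(real \<times> 'v) set" and z u assume z: "local_param M \<phi> D z" and u: "u \<in> D"
    have "z u \<in> M" using local_param_subset[OF z] u by blast
    from R[rule_format, OF this]
    obtain I T and x :: "real \<times> 'v \<Rightarrow> 'p" and \<alpha>h \<gamma> and Mh :: "(real \<times> 'e) set" and a c \<tau> where I: "open I"
      and x: "local_param M \<phi> (I \<times> T) x" "z u \<in> x ` (I \<times> T)"
      and \<phi>: "\<forall>s\<in>I. \<forall>t\<in>T. \<phi> (x (s, t)) = (\<alpha>h s * fst (\<gamma> t), \<alpha>h s *\<^sub>R snd (\<gamma> t), s)"
      and \<alpha>h: "smooth_on I \<alpha>h" "\<forall>s\<in>I. \<alpha>h s \<noteq> 0"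
      and \<gamma>: "local_param Mh (\<lambda>y. y) T \<gamma>" and a: "mink a a = c" "0 < \<tau>" and Mh: "Mh \<subseteq> cone_section a \<tau>"
      and ode: "\<forall>s\<in>I. (real DIM('e) - 2) * \<tau>\<^sup>2 * \<alpha>h s * deriv (deriv \<alpha>h) s
              - (real DIM('e) - 1) * (c + \<tau>\<^sup>2 * (deriv \<alpha>h s)\<^sup>2) = 0"
      by (elim exE conjE) (rule that)
    from x(2) obtain v where v: "v \<in> I \<times> T" "x v = z u" by fastforce
    interpret cone_section_immersion \<gamma> T a \<tau>
      by (rule cone_section_chart[OF \<gamma> Mh]) (use a in simp)
    have eq: "(\<phi> \<circ> x) v' = lift (\<alpha>h (fst v') *\<^sub>R \<gamma> (snd v')) (fst v')" if "v' \<in> I \<times> T" for v'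
      using \<phi>[rule_format, of "fst v'" "snd v'"] that by (auto simp: lift_def)
    \<comment> \<open>Both \<open>\<gamma>\<close> and \<open>\<alpha>h \<gamma>\<close> are in the future cone.\<close>
    have pos: "\<alpha>h s > 0" if "s \<in> I" for s
    proof -
      obtain t where t: "t \<in> T" using v(1) by auto
      have "\<phi> (x (s, t)) \<in> light_cone_times_line" by (rule chart_cone[OF x(1)]) (use that t in auto)
      then have "\<alpha>h s * fst (\<gamma> t) > 0"
        using \<phi>[rule_format, OF that t] by (simp add: light_cone_times_line_def light_cone_def)
      moreover have "fst (\<gamma> t) > 0" using f_cone(1)[OF t] by (simp add: light_cone_def)
      ultimately show ?thesis by (simp add: zero_less_mult_iff)
    qed
    interpret W: warped_section \<gamma> T a \<tau> I \<alpha>h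
      by unfold_locales (use dim_e I \<alpha>h pos in auto)
    have "inj (df (\<phi> \<circ> x) v)" using x(1) v(1) by (auto simp: local_param_def)
    then have r: "reparametrization W.F (\<phi> \<circ> x) (\<lambda>v. v) (I \<times> T) (I \<times> T) v"
      using W.open_box W.smooth_F v(1) smooth_on_ident eq W.spacelike_F[OF v(1)]
      by (intro reparametrization.intro) auto
    have "pseudo_umbilical_at W.F v"
      by (rule W.pseudo_umbilical_F[OF v(1) a(1)[symmetric]]) (use ode v(1) in auto)
    then have "pseudo_umbilical_at (\<phi> \<circ> x) v"
      using reparametrization.pseudo_umbilical_at_F[OF r] by simp
    then show "pseudo_umbilical_at (\<phi> \<circ> z) u"
      using mean_curvature_independent(2)[OF x(1) v(1) z u v(2)] by simp
  qed
qed

theorem theorem4p4: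
  fixes M :: "'p::{second_countable_topology, t2_space} set"
    and \<phi> :: "'p \<Rightarrow> real \<times> (real^'n) \<times> real"
  assumes "CARD('n) > 2"
    and "CARD('n) = CARD('m::finite) + 1"
    and "riemannian_submanifold TYPE(real \<times> (real^'m)) M \<phi>"
    and "\<phi> ` M \<subseteq> light_cone_times_line"
    and "\<forall>p\<in>M. alpha TYPE(real \<times> (real^'m)) M \<phi> p \<noteq> 0"
  shows "pseudo_umbilical TYPE(real \<times> (real^'m)) M \<phi> \<longleftrightarrow>
    (\<forall>p\<in>M. \<exists>(I :: real set) (T :: (real^'m) set) (x :: real \<times> (real^'m) \<Rightarrow> 'p)
        (\<alpha>h :: real \<Rightarrow> real) (\<gamma> :: real^'m \<Rightarrow> real \<times> (real^'n))
        (Mh :: (real \<times> (real^'n)) set) (a :: real \<times> (real^'n)) (c :: real) (\<tau> :: real).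
      open I \<and> is_interval I \<and>
      local_param M \<phi> (I \<times> T) x \<and> p \<in> x ` (I \<times> T) \<and>
      (\<forall>s\<in>I. \<forall>t\<in>T. \<phi> (x (s, t)) = (\<alpha>h s * fst (\<gamma> t), \<alpha>h s *\<^sub>R snd (\<gamma> t), s)) \<and>
      smooth_on I \<alpha>h \<and> (\<forall>s\<in>I. \<alpha>h s \<noteq> 0) \<and>
      riemannian_submanifold TYPE(real^'m) Mh (\<lambda>y. y) \<and> Mh \<subseteq> light_cone \<and>
      local_param Mh (\<lambda>y. y) T \<gamma> \<and>
      totally_umbilical TYPE(real^'m) Mh (\<lambda>y. y) \<and>
      a \<noteq> 0 \<and> mink a a = c \<and> c \<in> {1, -1, 0} \<and> 0 < \<tau> \<and>
      Mh \<subseteq> cone_section a \<tau> \<and>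
      (\<forall>s\<in>I. (real CARD('n) - 2) * \<tau>\<^sup>2 * \<alpha>h s * deriv (deriv \<alpha>h) s
              - (real CARD('n) - 1) * (c + \<tau>\<^sup>2 * (deriv \<alpha>h s)\<^sup>2) = 0))"
proof -
  interpret cone_line_manifold M \<phi> "TYPE(real^'m)"
    by unfold_locales (use assms in auto)
  have "real CARD('n) = real DIM(real^'n)" by simp
  then show ?thesis by (simp only: classification)
qed

end
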